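(* Let $A$ be an expansive $d\times d$ integer matrix and $\mathcal D\subset\mathbb Z^d$ a complete set of representatives for $\mathbb Z^d/A^T\mathbb Z^d$ such that $(A,\mathcal D)$ satisfies the tiling condition, and let $C=\{\theta_0,\dots,\theta_{p-1}\}$ be a simple cycle of length $p$. On $X(A^T,\mathcal D)\times\tilde\Omega_C$ define the measure $\breve\mu$ by $$\int_{X(A^T,\mathcal D)\times\tilde\Omega_C}f\,d\breve\mu=\int_{X(A^T,\mathcal D)}\sum_{\omega\in\tilde\Omega_C}f(x,\omega)\,dx.$$ Define the operators $\breve T_k$, $k\in\mathbb Z^d$, and $\breve U$ on $L^2(X(A^T,\mathcal D)\times\tilde\Omega_C,\breve\mu)$ by $$\breve T_kf(x,\omega)=e^{2\pi ik\cdot x}f(x,\omega)\quad(x\in X(A^T,\mathcal D),\ \omega\in\tilde\Omega_C),\qquad \breve Uf=\sqrt{|\det A|}\,f\circ\rho^{-1}.$$ Then $\{\breve T_k,\breve U\}$ define a unitary representation of $G_A$, and $$\mathcal W:L^2(\mathbb R^d\times\mathbb Z_p)\to L^2(X(A^T,\mathcal D)\times\tilde\Omega_C,\breve\mu),\qquad \mathcal Wf=f\circ\hat i_C^{-1}\circ\mathfrak d,$$ is an isomorphism (of Hilbert spaces) that intertwines this representation with the representation $\{\hat T_{C,k},\hat U_C\}$ of $G_A$ on $L^2(\mathbb R^d\times\mathbb Z_p)$, i.e. $\mathcal W\hat T_{C,k}=\breve T_k\mathcal W$ for $k\in\mathbb Z^d$ and $\mathcal W\hat U_C=\breve U\mathcal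 W$.
   Context: $\mathbb N=\{0,1,2,\dots\}$. An integer matrix $A$ is expansive if all its eigenvalues $\lambda$ satisfy $|\lambda|>1$; $A^T$ is the transpose. For $x\in\mathbb R^d$, $e^{2\pi i x}:=(e^{2\pi i x_1},\dots,e^{2\pi i x_d})\in\mathbb T^d$; for $z=e^{2\pi i x}\in\mathbb T^d$ put $z^A:=e^{2\pi i A^Tx}$. The solenoid is $\mathcal S_A=\{(z_n)_{n\in\mathbb N}: z_n\in\mathbb T^d,\ z_{n+1}^A=z_n \text{ for all } n\in\mathbb N\}$, a compact abelian group under coordinatewise multiplication, with automorphism $\sigma_A(z_0,z_1,\dots)=(z_0^A,z_0,z_1,\dots)$. For $d\in\mathcal D$, $\tau_d(x)=(A^T)^{-1}(x+d)$. $\Omega=\mathcal D^{\mathbb N}$. $X(A^T,\mathcal D)=\{\sum_{j\ge1}(A^T)^{-j}d_j: d_j\in\mathcal D\}$. The tiling condition for $(A,\mathcal D)$: $X(A^T,\mathcal D)$ tiles $\mathbb R^d$ by $\mathbb Z^d$ up to measure zero, i.e. $\bigcup_{k\in\mathbb Z^d}(X+k)=\mathbb R^d$ up to a Lebesgue null set and $(X+k)\cap(X+k')$ is Lebesgue null for $k\neq k'$ in $\mathbb Z^d$. A finite set $C=\{\theta_0,\dots,\theta_{p-1}\}\subset\mathbb R^d$ is a cycle (associated to $l_0\dots l_{p-1}$, $l_i\in\mathcal D$) if $\tau_{l_0}\theta_0=\theta_1,\dots,\tau_{l_{p-2}}\theta_{p-2}=\theta_{p-1}$, $\tau_{l_{p-1}}\theta_{p-1}=\theta_0$.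 It is simple if $\theta_j\not\equiv\theta_{j'}\bmod\mathbb Z^d$ for $j\ne j'$. Indices of $\theta$ are modulo $p$; $\mathbb Z_p$ is the cyclic group of order $p$. For a cycle $C'$ associated to $m_0\dots m_{q-1}$, $\Omega_{C'}\subset\Omega$ is the set of words ending in the infinite repetition of $m_0\dots m_{q-1}$, and $\tilde\Omega_C:=\bigcup\{\Omega_{C'}: C'\text{ cycle contained in }(C-\mathbb Z^d)\cap X(A^T,\mathcal D)\}$, where $C-\mathbb Z^d=\{\theta_j-k\}$. $\hat i_C(x,j)=(e^{2\pi i((A^T)^{-n}x+\theta_{n+j})})_{n\in\mathbb N}$ is a bijection from $\mathbb R^d\times\mathbb Z_p$ onto its image $\mathcal S_A(C)\subset\mathcal S_A$. The map $\mathfrak d:X(A^T,\mathcal D)\times\tilde\Omega_C\to\mathcal S_A(C)$ is $\mathfrak d(x,\omega)=(e^{2\pi ix},e^{2\pi i\tau_{\omega_0}x},e^{2\pi i\tau_{\omega_1}\tau_{\omega_0}x},\dots)$. The map $\rho(x,\omega_0\omega_1\dots)=(\tau_{\omega_0}x,\omega_1\omega_2\dots)$ is invertible a.e. on $X(A^T,\mathcal D)\times\tilde\Omega_C$, with $\rho^{-1}(x,\omega_0\omega_1\dots)=(A^Tx-\omega_x,\omega_x\omega_0\omega_1\dots)$, where $\omega_x$ is, for a.e. $x\in X(A^T,\mathcal D)$, the unique element of $\mathcal D$ with $x\in\tau_{\omega_x}(X(A^T,\mathcal D))$. On $L^2(\mathbb R^d\times\mathbb Z_p)$ (Lebesgue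 times counting measure), $(\hat T_{C,k}h)(x,j)=e^{2\pi ik\cdot\theta_j}e^{2\pi ik\cdot x}h(x,j)$ and $(\hat U_Ch)(x,j)=\sqrt{|\det A|}\,h(A^Tx,j-1)$; these are the Fourier transforms (componentwise) of the operators $(f_j)_j\mapsto(e^{2\pi ik\cdot\theta_j}f_j(\cdot-k))_j$ and $(f_j)_j\mapsto(|\det A|^{-1/2}f_{j-1}(A^{-1}\cdot))_j$. $\mathbb Z^d[A^{-1}]=\{A^{-j}k: j\in\mathbb N,k\in\mathbb Z^d\}$ and $G_A=\mathbb Z^d[A^{-1}]\rtimes\mathbb Z$ is the set of pairs $(j,b)$ with product $(j,b)(k,c)=(j+k,A^jc+b)$. A unitary representation of $G_A$ is determined by unitaries $U$ (image of $(1,0)$) and $T_k$, $k\in\mathbb Z^d$ (image of $(0,k)$, with $T_kT_l=T_{k+l}$), subject to $UT_kU^{-1}=T_{Ak}$. *)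

theory Defs
  imports "HOL-Analysis.Analysis" "HOL-Algebra.Group_Action"
begin

text \<open>$L^2(M)$ is the set \<open>L2 M\<close> of classes of square-integrable functions modulo equality
  almost everywhere; values outside \<open>space M\<close> are irrelevant.\<close>

definition L2_fun :: "'a measure \<Rightarrow> ('a \<Rightarrow> complex) set" where
  "L2_fun M = {f \<in> borel_measurable M. integrable M (\<lambda>x. (norm (f x))\<^sup>2)}"

definition L2_class :: "'a measure \<Rightarrow> ('a \<Rightarrow> complex) \<Rightarrow> ('a \<Rightarrow> complex) set" where
  "L2_class M f = {g \<in> L2_fun M. AE x in M. g x = f x}"

definition L2 :: "'a measure \<Rightarrow> ('a \<Rightarrow> complex) set set" where
  "L2 M = L2_class M ` L2_fun M"

definition L2_rep :: "('a \<Rightarrow> complex) set \<Rightarrow> 'a \<Rightarrow> complex" where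
  "L2_rep F = (SOME f. f \<in> F)"

definition L2_add :: "'a measure \<Rightarrow> ('a \<Rightarrow> complex) set \<Rightarrow> ('a \<Rightarrow> complex) set \<Rightarrow> ('a \<Rightarrow> complex) set" where
  "L2_add M F G = L2_class M (\<lambda>x. L2_rep F x + L2_rep G x)"

definition L2_scale :: "'a measure \<Rightarrow> complex \<Rightarrow> ('a \<Rightarrow> complex) set \<Rightarrow> ('a \<Rightarrow> complex) set" where
  "L2_scale M c F = L2_class M (\<lambda>x. c * L2_rep F x)"

definition L2_inner :: "'a measure \<Rightarrow> ('a \<Rightarrow> complex) set \<Rightarrow> ('a \<Rightarrow> complex) set \<Rightarrow> complex" where
  "L2_inner M F G = (LINT x|M. L2_rep F x * cnj (L2_rep G x))"

text \<open>A map \<open>\<Phi>\<close> on functions acts on classes through any representative, provided that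
  \<open>L2_respects\<close> holds.\<close>

definition L2_respects ::
  "'a measure \<Rightarrow> 'b measure \<Rightarrow> (('a \<Rightarrow> complex) \<Rightarrow> 'b \<Rightarrow> complex) \<Rightarrow> bool" where
  "L2_respects M N \<Phi> \<longleftrightarrow>
     (\<forall>f \<in> L2_fun M. \<Phi> f \<in> L2_fun N) \<and>
     (\<forall>f \<in> L2_fun M. \<forall>g \<in> L2_fun M.
        (AE x in M. f x = g x) \<longrightarrow> (AE y in N. \<Phi> f y = \<Phi> g y))"

definition L2_lift ::
  "'a measure \<Rightarrow> 'b measure \<Rightarrow> (('a \<Rightarrow> complex) \<Rightarrow> 'b \<Rightarrow> complex) \<Rightarrow>
     ('a \<Rightarrow> complex) set \<Rightarrow> ('b \<Rightarrow> complex) set" where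
  "L2_lift M N \<Phi> = (\<lambda>F \<in> L2 M. L2_class N (\<Phi> (L2_rep F)))"

definition L2_iso ::
  "'a measure \<Rightarrow> 'b measure \<Rightarrow> (('a \<Rightarrow> complex) set \<Rightarrow> ('b \<Rightarrow> complex) set) \<Rightarrow> bool" where
  "L2_iso M N T \<longleftrightarrow>
     bij_betw T (L2 M) (L2 N) \<and>
     (\<forall>F \<in> L2 M. \<forall>G \<in> L2 M. T (L2_add M F G) = L2_add N (T F) (T G)) \<and>
     (\<forall>c. \<forall>F \<in> L2 M. T (L2_scale M c F) = L2_scale N c (T F)) \<and>
     (\<forall>F \<in> L2 M. \<forall>G \<in> L2 M. L2_inner N (T F) (T G) = L2_inner M F G)"

text \<open>\<open>group_action\<close> says that \<open>\<pi>\<close> is a homomorphism into the group of (extensional) bijections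
  of \<open>L2 M\<close>.\<close>

definition unitary_rep ::
  "('g, 'c) monoid_scheme \<Rightarrow> 'a measure \<Rightarrow> ('g \<Rightarrow> ('a \<Rightarrow> complex) set \<Rightarrow> ('a \<Rightarrow> complex) set) \<Rightarrow> bool" where
  "unitary_rep G M \<pi> \<longleftrightarrow>
     group_action G (L2 M) \<pi> \<and> (\<forall>g \<in> carrier G. L2_iso M M (\<pi> g))"

abbreviation real_vec :: "int^'n \<Rightarrow> real^'n" where
  "real_vec k \<equiv> \<chi> i. real_of_int (k $ i)"

abbreviation real_mat :: "int^'n^'n \<Rightarrow> real^'n^'n" where
  "real_mat A \<equiv> map_matrix real_of_int A"

definition expansive :: "int^'n^'n \<Rightarrow> bool" where
  "expansive A \<longleftrightarrow>
     (\<forall>(c::complex) (v::complex^'n). v \<noteq> 0 \<and> map_matrix of_int A *v v = c *s v \<longrightarrow> 1 < norm c)"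

definition complete_representatives :: "int^'n^'n \<Rightarrow> (int^'n) set \<Rightarrow> bool" where
  "complete_representatives A D \<longleftrightarrow>
     (\<forall>k. \<exists>!l. l \<in> D \<and> (\<exists>m. k - l = transpose A *v m))"

definition AT :: "int^'n^'n \<Rightarrow> real^'n \<Rightarrow> real^'n" where
  "AT A x = transpose (real_mat A) *v x"

definition AT_inv :: "int^'n^'n \<Rightarrow> real^'n \<Rightarrow> real^'n" where
  "AT_inv A x = matrix_inv (transpose (real_mat A)) *v x"

definition tau :: "int^'n^'n \<Rightarrow> int^'n \<Rightarrow> real^'n \<Rightarrow> real^'n" where
  "tau A l x = AT_inv A (x + real_vec l)"

definition tile :: "int^'n^'n \<Rightarrow> (int^'n) set \<Rightarrow> (real^'n) set" where
  "tile A D = {x. \<exists>d. range d \<subseteq> D \<and> (\<lambda>j. (AT_inv A ^^ Suc j) (real_vec (d j))) sums x}"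

definition tiling_condition :: "int^'n^'n \<Rightarrow> (int^'n) set \<Rightarrow> bool" where
  "tiling_condition A D \<longleftrightarrow>
     UNIV - (\<Union>k. (+) (real_vec k) ` tile A D) \<in> null_sets lebesgue \<and>
     (\<forall>k k'. k \<noteq> k' \<longrightarrow>
        (+) (real_vec k) ` tile A D \<inter> (+) (real_vec k') ` tile A D \<in> null_sets lebesgue)"

text \<open>A cycle of length \<open>p\<close> is given by its points \<open>\<theta> 0, \<dots>, \<theta> (p - 1)\<close> and its
  digits \<open>l 0, \<dots>, l (p - 1)\<close>; other values of \<open>\<theta>\<close> and \<open>l\<close> are irrelevant.\<close>

definition cycle :: "int^'n^'n \<Rightarrow> (int^'n) set \<Rightarrow> nat \<Rightarrow> (nat \<Rightarrow> real^'n) \<Rightarrow> (nat \<Rightarrow> int^'n) \<Rightarrow> bool" where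
  "cycle A D p \<theta> l \<longleftrightarrow>
     0 < p \<and> (\<forall>i<p. l i \<in> D \<and> tau A (l i) (\<theta> i) = \<theta> (Suc i mod p))"

definition simple_cycle :: "int^'n^'n \<Rightarrow> (int^'n) set \<Rightarrow> nat \<Rightarrow> (nat \<Rightarrow> real^'n) \<Rightarrow> bool" where
  "simple_cycle A D p \<theta> \<longleftrightarrow>
     (\<exists>l. cycle A D p \<theta> l) \<and>
     (\<forall>i<p. \<forall>j<p. i \<noteq> j \<longrightarrow> \<theta> i - \<theta> j \<notin> range real_vec)"

definition Omega_cycle :: "(int^'n) set \<Rightarrow> nat \<Rightarrow> (nat \<Rightarrow> int^'n) \<Rightarrow> (nat \<Rightarrow> int^'n) set" where
  "Omega_cycle D q m = {\<omega>. range \<omega> \<subseteq> D \<and> (\<exists>N. \<forall>n. \<omega> (N + n) = m (n mod q))}"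

definition Omega_tilde ::
  "int^'n^'n \<Rightarrow> (int^'n) set \<Rightarrow> nat \<Rightarrow> (nat \<Rightarrow> real^'n) \<Rightarrow> (nat \<Rightarrow> int^'n) set" where
  "Omega_tilde A D p \<theta> =
     \<Union>{Omega_cycle D q m | q \<eta> m. cycle A D q \<eta> m \<and>
          \<eta> ` {..<q} \<subseteq> {\<theta> j - real_vec k | j k. j < p} \<inter> tile A D}"

definition e2pi :: "real^'n \<Rightarrow> complex^'n" where
  "e2pi x = (\<chi> i. cis (2 * pi * x $ i))"

definition hat_i :: "int^'n^'n \<Rightarrow> nat \<Rightarrow> (nat \<Rightarrow> real^'n) \<Rightarrow> (real^'n) \<times> nat \<Rightarrow> nat \<Rightarrow> complex^'n" where
  "hat_i A p \<theta> = (\<lambda>(x, j) n. e2pi ((AT_inv A ^^ n) x + \<theta> ((n + j) mod p)))"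

text \<open>\<open>orbit A x \<omega> n\<close> is $\tau_{\omega_{n-1}} \cdots \tau_{\omega_0} x$.\<close>

primrec orbit :: "int^'n^'n \<Rightarrow> real^'n \<Rightarrow> (nat \<Rightarrow> int^'n) \<Rightarrow> nat \<Rightarrow> real^'n" where
  "orbit A x \<omega> 0 = x"
| "orbit A x \<omega> (Suc n) = tau A (\<omega> n) (orbit A x \<omega> n)"

definition frak_d :: "int^'n^'n \<Rightarrow> (real^'n) \<times> (nat \<Rightarrow> int^'n) \<Rightarrow> nat \<Rightarrow> complex^'n" where
  "frak_d A = (\<lambda>(x, \<omega>) n. e2pi (orbit A x \<omega> n))"

definition rho :: "int^'n^'n \<Rightarrow> (real^'n) \<times> (nat \<Rightarrow> int^'n) \<Rightarrow> (real^'n) \<times> (nat \<Rightarrow> int^'n)" where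
  "rho A = (\<lambda>(x, \<omega>). (tau A (\<omega> 0) x, \<lambda>n. \<omega> (Suc n)))"

text \<open>\<open>first_digit A D x\<close> is $\omega_x$; it is arbitrary on the null set where the digit is not unique.\<close>

definition first_digit :: "int^'n^'n \<Rightarrow> (int^'n) set \<Rightarrow> real^'n \<Rightarrow> int^'n" where
  "first_digit A D x = (THE w. w \<in> D \<and> x \<in> tau A w ` tile A D)"

definition rho_inv ::
  "int^'n^'n \<Rightarrow> (int^'n) set \<Rightarrow> (real^'n) \<times> (nat \<Rightarrow> int^'n) \<Rightarrow> (real^'n) \<times> (nat \<Rightarrow> int^'n)" where
  "rho_inv A D = (\<lambda>(x, \<omega>).
     (AT A x - real_vec (first_digit A D x), case_nat (first_digit A D x) \<omega>))"

text \<open>The index set $\mathbb{Z}_p$ is \<open>{..<p}\<close>, with addition modulo \<open>p\<close>.\<close>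

definition hat_mu :: "nat \<Rightarrow> ((real^'n) \<times> nat) measure" where
  "hat_mu p = lebesgue \<Otimes>\<^sub>M count_space {..<p}"

text \<open>The defining integral formula of this measure is the lemma \<open>nn_integral_breve_mu\<close> below.\<close>

definition breve_mu ::
  "int^'n^'n \<Rightarrow> (int^'n) set \<Rightarrow> nat \<Rightarrow> (nat \<Rightarrow> real^'n) \<Rightarrow> ((real^'n) \<times> (nat \<Rightarrow> int^'n)) measure" where
  "breve_mu A D p \<theta> = lebesgue_on (tile A D) \<Otimes>\<^sub>M count_space (Omega_tilde A D p \<theta>)"

definition That ::
  "nat \<Rightarrow> (nat \<Rightarrow> real^'n) \<Rightarrow> int^'n \<Rightarrow> ((real^'n) \<times> nat \<Rightarrow> complex) \<Rightarrow> (real^'n) \<times> nat \<Rightarrow> complex" where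
  "That p \<theta> k h = (\<lambda>(x, j).
     cis (2 * pi * (real_vec k \<bullet> \<theta> j)) * cis (2 * pi * (real_vec k \<bullet> x)) * h (x, j))"

definition Uhat ::
  "int^'n^'n \<Rightarrow> nat \<Rightarrow> ((real^'n) \<times> nat \<Rightarrow> complex) \<Rightarrow> (real^'n) \<times> nat \<Rightarrow> complex" where
  "Uhat A p h = (\<lambda>(x, j). of_real (sqrt \<bar>of_int (det A)\<bar>) * h (AT A x, (j + p - 1) mod p))"

definition Tbreve ::
  "int^'n \<Rightarrow> ((real^'n) \<times> (nat \<Rightarrow> int^'n) \<Rightarrow> complex) \<Rightarrow> (real^'n) \<times> (nat \<Rightarrow> int^'n) \<Rightarrow> complex" where
  "Tbreve k f = (\<lambda>(x, \<omega>). cis (2 * pi * (real_vec k \<bullet> x)) * f (x, \<omega>))"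

definition Ubreve ::
  "int^'n^'n \<Rightarrow> (int^'n) set \<Rightarrow> ((real^'n) \<times> (nat \<Rightarrow> int^'n) \<Rightarrow> complex) \<Rightarrow>
     (real^'n) \<times> (nat \<Rightarrow> int^'n) \<Rightarrow> complex" where
  "Ubreve A D f = (\<lambda>y. of_real (sqrt \<bar>of_int (det A)\<bar>) * (f \<circ> rho_inv A D) y)"

definition W ::
  "int^'n^'n \<Rightarrow> nat \<Rightarrow> (nat \<Rightarrow> real^'n) \<Rightarrow> ((real^'n) \<times> nat \<Rightarrow> complex) \<Rightarrow>
     (real^'n) \<times> (nat \<Rightarrow> int^'n) \<Rightarrow> complex" where
  "W A p \<theta> f = f \<circ> inv_into (UNIV \<times> {..<p}) (hat_i A p \<theta>) \<circ> frak_d A"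

definition A_powi :: "int^'n^'n \<Rightarrow> int \<Rightarrow> real^'n \<Rightarrow> real^'n" where
  "A_powi A j = (if 0 \<le> j then (\<lambda>v. real_mat A *v v) ^^ nat j
                 else (\<lambda>v. matrix_inv (real_mat A) *v v) ^^ nat (- j))"

definition G_A :: "int^'n^'n \<Rightarrow> (int \<times> (real^'n)) monoid" where
  "G_A A = \<lparr>carrier = UNIV \<times> {A_powi A (- int j) (real_vec k) | j k. True},
            mult = (\<lambda>(j, b) (k, c). (j + k, A_powi A j c + b)),
            one = (0, 0)\<rparr>"

text \<open>The values of \<open>\<pi>\<close> outside the carrier are fixed, so that \<open>\<pi>\<close> can be unique.\<close>

definition rep_generated_by ::
  "int^'n^'n \<Rightarrow> 'a measure \<Rightarrow> (('a \<Rightarrow> complex) set \<Rightarrow> ('a \<Rightarrow> complex) set) \<Rightarrow>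
     (int^'n \<Rightarrow> ('a \<Rightarrow> complex) set \<Rightarrow> ('a \<Rightarrow> complex) set) \<Rightarrow>
     (int \<times> (real^'n) \<Rightarrow> ('a \<Rightarrow> complex) set \<Rightarrow> ('a \<Rightarrow> complex) set) \<Rightarrow> bool" where
  "rep_generated_by A M U T \<pi> \<longleftrightarrow>
     unitary_rep (G_A A) M \<pi> \<and> \<pi> \<in> extensional (carrier (G_A A)) \<and>
     \<pi> (1, 0) = U \<and> (\<forall>k. \<pi> (0, real_vec k) = T k)"

lemma L2_lift_class:
  assumes "L2_respects M N \<Phi>" and "f \<in> L2_fun M"
  shows "L2_lift M N \<Phi> (L2_class M f) = L2_class N (\<Phi> f)"
proof -
  define g where "g = L2_rep (L2_class M f)"
  have "f \<in> L2_class M f" using assms(2) by (simp add: L2_class_def)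
  then have "g \<in> L2_class M f" unfolding g_def L2_rep_def by (rule someI[of "\<lambda>h. h \<in> L2_class M f"])
  then have "g \<in> L2_fun M" "AE x in M. g x = f x" by (simp_all add: L2_class_def)
  then have "AE y in N. \<Phi> g y = \<Phi> f y" using assms by (simp add: L2_respects_def)
  then have "(AE y in N. h y = \<Phi> g y) \<longleftrightarrow> (AE y in N. h y = \<Phi> f y)" for h
    by (intro iffI; elim AE_mp) (auto elim: eventually_mono)
  then show ?thesis using assms(2)
    by (simp add: L2_lift_def L2_def L2_class_def[of N] g_def[symmetric])
qed

lemma countable_Omega_tilde: "countable (Omega_tilde A D p \<theta>)"
proof -
  let ?w = "\<lambda>(u, v) n. if n < length u then u ! n else v ! ((n - length u) mod length v)"
  have "Omega_tilde A D p \<theta> \<subseteq> range ?w"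
  proof
    fix \<omega> assume "\<omega> \<in> Omega_tilde A D p \<theta>"
    then obtain q m N where q: "0 < q" and N: "\<And>n. \<omega> (N + n) = m (n mod q)"
      by (auto simp: Omega_tilde_def Omega_cycle_def cycle_def)
    have "\<omega> n = ?w (map \<omega> [0..<N], map m [0..<q]) n" for n
      using q N[of "n - N"] by auto
    then show "\<omega> \<in> range ?w" by blast
  qed
  then show ?thesis by (rule countable_subset) simp
qed

lemma nn_integral_breve_mu:
  assumes "f \<in> borel_measurable (breve_mu A D p \<theta>)"
  shows "(\<integral>\<^sup>+ y. f y \<partial>breve_mu A D p \<theta>) =
    (\<integral>\<^sup>+ x. (\<integral>\<^sup>+ \<omega>. f (x, \<omega>) \<partial>count_space (Omega_tilde A D p \<theta>)) \<partial>lebesgue_on (tile A D))"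
proof -
  interpret sigma_finite_measure "count_space (Omega_tilde A D p \<theta>)"
    by (rule sigma_finite_measure_count_space_countable[OF countable_Omega_tilde])
  show ?thesis using nn_integral_fst[of f "lebesgue_on (tile A D)"] assms
    by (simp add: breve_mu_def)
qed

lemma AT_inverse:
  assumes "invertible (real_mat A)"
  shows "AT_inv A (AT A x) = x" and "AT A (AT_inv A x) = x"
proof -
  let ?M = "transpose (real_mat A)"
  have "\<exists>M'. ?M ** M' = mat 1 \<and> M' ** ?M = mat 1"
    using transpose_invertible[OF assms] by (simp add: invertible_def)
  then have "?M ** matrix_inv ?M = mat 1 \<and> matrix_inv ?M ** ?M = mat 1"
    unfolding matrix_inv_def by (rule someI_ex)
  then show "AT_inv A (AT A x) = x" and "AT A (AT_inv A x) = x"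
    by (simp_all add: AT_def AT_inv_def matrix_vector_mul_assoc del: transpose_matrix_vector)
qed

lemma rho_rho_inv:
  assumes "invertible (real_mat A)"
  shows "rho A (rho_inv A D y) = y"
  by (cases y) (simp add: rho_def rho_inv_def tau_def AT_inverse[OF assms])

lemma rho_inv_rho:
  assumes "invertible (real_mat A)" and "first_digit A D (tau A (\<omega> 0) x) = \<omega> 0"
  shows "rho_inv A D (rho A (x, \<omega>)) = (x, \<omega>)"
proof -
  have "AT A (tau A (\<omega> 0) x) - real_vec (\<omega> 0) = x"
    by (simp add: tau_def AT_inverse[OF assms(1)])
  then show ?thesis using assms(2)
    by (auto simp: rho_def rho_inv_def fun_eq_iff split: nat.split)
qed

end

theory Submission
  imports Defs "HOL-Computational_Algebra.Fundamental_Theorem_Algebra"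
begin

text \<open>
  Write \<open>M = A\<^sup>T\<close>, \<open>X\<close> for the tile and \<open>\<Omega>\<close> for the admissible words, and read all congruences
  modulo \<open>\<int>\<^sup>d\<close>. The point of the proof is that both spaces parametrise the same sequences on the
  torus, and that the change of parameters is a piecewise translation which cuts every layer
  \<open>\<real>\<^sup>d \<times> {j}\<close> into the translates of \<open>X\<close>.

  A word \<open>\<omega>\<close> in \<open>\<Omega>\<close> ends in the digits of a cycle whose points are congruent to points of the
  given one. Since two orbits driven by the same digits differ by \<open>M\<^sup>-\<^sup>n\<close> of their initial difference, there is a position
  \<open>j\<close> on the cycle and a lattice point \<open>k\<close> with
  \<open>\<tau>\<^bsub>\<omega>(n-1)\<^esub> \<dots> \<tau>\<^bsub>\<omega>(0)\<^esub> x \<equiv> M\<^sup>-\<^sup>n (x - \<theta>\<^sub>j - k) + \<theta>\<^bsub>n+j\<^esub>\<close> for all \<open>n\<close> and all \<open>x\<close>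
  (\<open>code_exists\<close>). Hence \<open>\<W>\<close> sends \<open>f\<close> to \<open>(x, \<omega>) \<mapsto> f (x - \<theta>\<^sub>j - k, j)\<close>. The map
  \<open>\<omega> \<mapsto> (k, j)\<close> is a bijection onto \<open>\<int>\<^sup>d \<times> \<int>\<^sub>p\<close>: it is injective because digits are representatives
  modulo \<open>M \<int>\<^sup>d\<close> (\<open>code_inj\<close>), and surjective because the word obtained by solving the congruences
  digit by digit drives a bounded sequence of lattice translates of the points of the cycle, which is
  eventually periodic by the pigeonhole principle (\<open>code_surj\<close>). Since
  almost every point of \<open>\<real>\<^sup>d\<close> lies in exactly one translate of \<open>X\<close>, the change of parameters is
  measure preserving and invertible almost everywhere (\<open>distr_unfold\<close>, \<open>W_surj\<close>), so \<open>\<W>\<close> is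
  unitary.

  The intertwining relations are then identities between functions. For the translations it
  is \<open>k \<cdot> l \<in> \<int>\<close> for lattice points. For the dilation, prepending the digit \<open>a\<close> to
  \<open>\<omega>\<close> applies \<open>M\<close> to the unfolded point and moves \<open>j\<close> one step back (\<open>code_cons\<close>). Once it is known that
  \<open>\<rho>\<^sup>-\<^sup>1\<close> pulls null sets back to null sets (\<open>Ubreve_AE\<close>), the operator \<open>f \<mapsto> \<surd>\<bar>det A\<bar> f \<circ> \<rho>\<^sup>-\<^sup>1\<close>
  agrees almost everywhere with the conjugate of the dilation on \<open>\<real>\<^sup>d \<times> \<int>\<^sub>p\<close> under \<open>\<W>\<close>, from
  which it inherits square-integrability of the images and unitarity.

  Besides the linear change of variables, two general facts enter. All powers of \<open>M\<^sup>-\<^sup>1\<close> are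
  dominated by a summable sequence (\<open>AT_inv_powers_summable\<close>); this is deduced from the eigenvalue condition by splitting
  an annihilating polynomial into linear factors. And unitaries \<open>U\<close>, \<open>T\<^sub>k\<close> with
  \<open>T\<^bsub>k+l\<^esub> = T\<^sub>k T\<^sub>l\<close> and \<open>U T\<^sub>k = T\<^bsub>Ak\<^esub> U\<close> extend uniquely to \<open>G\<^sub>A\<close>
  (\<open>rep_generated_by_exists_unique\<close>), because \<open>A\<^sup>i k\<close> has to act as \<open>U\<^sup>i T\<^sub>k U\<^sup>-\<^sup>i\<close>.
\<close>

section \<open>Powers of the inverse of an expansive matrix\<close>

definition poly_act :: "complex poly \<Rightarrow> complex^'n^'n \<Rightarrow> complex^'n \<Rightarrow> complex^'n" where
  "poly_act P B v = (\<Sum>i\<le>degree P. coeff P i *s (((*v) B) ^^ i) v)"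

lemma poly_act_eq:
  assumes "degree P \<le> N"
  shows "poly_act P B v = (\<Sum>i\<le>N. coeff P i *s (((*v) B) ^^ i) v)"
  unfolding poly_act_def using assms
  by (intro sum.mono_neutral_left) (auto simp: coeff_eq_0)

text \<open>A root \<open>c\<close> of the polynomial can be removed in two ways: by applying \<open>B - c\<close> to the value or to the
argument. The first is used when \<open>B - c\<close> is injective, the second when \<open>\<bar>c\<bar> < 1\<close>.\<close>

lemma poly_act_linear_factor:
  "poly_act ([:-c, 1:] * Q) B v = B *v poly_act Q B v - c *s poly_act Q B v" (is ?shift)
  "poly_act ([:-c, 1:] * Q) B v = poly_act Q B (B *v v - c *s v)" (is ?arg)
proof -
  define x where "x = (\<lambda>i. (((*v) B) ^^ i) v)"
  define N where "N = degree Q"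
  have deg: "degree ([:-c, 1:] * Q) \<le> Suc N"
    using degree_mult_le[of "[:-c, 1:]" Q] by (simp add: N_def)
  have "poly_act ([:-c, 1:] * Q) B v = (\<Sum>i\<le>Suc N. coeff (pCons 0 Q - smult c Q) i *s x i)"
    unfolding poly_act_eq[OF deg] x_def by (simp add: mult_pCons_left algebra_simps)
  also have "\<dots> = (\<Sum>i\<le>Suc N. coeff (pCons 0 Q) i *s x i) - (\<Sum>i\<le>Suc N. (c * coeff Q i) *s x i)"
    by (simp add: vector_sub_rdistrib sum_subtractf)
  also have "(\<Sum>i\<le>Suc N. coeff (pCons 0 Q) i *s x i) = (\<Sum>i\<le>N. coeff Q i *s x (Suc i))"
    by (subst sum.atMost_Suc_shift) simp
  also have "(\<Sum>i\<le>Suc N. (c * coeff Q i) *s x i) = (\<Sum>i\<le>N. (c * coeff Q i) *s x i)"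
    by (simp add: N_def coeff_eq_0)
  finally have eq: "poly_act ([:-c, 1:] * Q) B v =
      (\<Sum>i\<le>N. coeff Q i *s x (Suc i)) - (\<Sum>i\<le>N. (c * coeff Q i) *s x i)" .
  have "B *v poly_act Q B v = (\<Sum>i\<le>N. coeff Q i *s x (Suc i))"
    by (simp add: poly_act_def N_def x_def vec.scale vec.sum)
  moreover have "c *s poly_act Q B v = (\<Sum>i\<le>N. (c * coeff Q i) *s x i)"
    by (simp add: poly_act_def N_def x_def vec.scale_sum_right)
  ultimately show ?shift using eq by simp
  have iter: "(((*v) B) ^^ i) (B *v v - c *s v) = x (Suc i) - c *s x i" for i
    by (induction i) (simp_all add: x_def vec.diff vec.scale)
  show ?arg
    unfolding eq by (simp add: poly_act_def N_def[symmetric] iter sum_subtractf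
        vector_ssub_ldistrib mult.commute)
qed

text \<open>Summing the recurrence bounds the partial sums by \<open>a 0 + r * sum a + suminf e\<close>, and \<open>r < 1\<close>.\<close>

lemma summable_contracting_recurrence:
  fixes a e :: "nat \<Rightarrow> real"
  assumes a: "\<And>n. 0 \<le> a n" and r: "0 \<le> r" "r < 1"
    and e: "summable e" "\<And>n. 0 \<le> e n"
    and rec: "\<And>n. a (Suc n) \<le> r * a n + e n"
  shows "summable a"
proof (rule bounded_imp_summable[OF a])
  fix n
  have "sum a {..n} \<le> sum a {..Suc n}" using a by simp
  also have "\<dots> = a 0 + (\<Sum>i\<le>n. a (Suc i))" by (rule sum.atMost_Suc_shift)
  also have "\<dots> \<le> a 0 + (\<Sum>i\<le>n. r * a i + e i)" using rec by (intro add_left_mono sum_mono)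
  also have "\<dots> = a 0 + r * sum a {..n} + sum e {..n}"
    by (simp add: sum.distrib sum_distrib_left)
  also have "sum e {..n} \<le> suminf e" using e by (intro sum_le_suminf) auto
  finally have "(1 - r) * sum a {..n} \<le> a 0 + suminf e" by (simp add: algebra_simps)
  then show "sum a {..n} \<le> (a 0 + suminf e) / (1 - r)" using r by (simp add: field_simps)
qed

lemma norm_complex_scale: "norm (c *s (x :: complex^'n)) = norm c * norm x"
  by (simp add: norm_vec_def L2_set_def norm_mult power_mult_distrib
      flip: sum_distrib_left) (simp add: real_sqrt_mult)

text \<open>Induction on the degree of the annihilating polynomial, splitting off one root \<open>c\<close>. If
\<open>\<bar>c\<bar> < 1\<close>, the orbit of \<open>v\<close> satisfies a contracting recurrence whose inhomogeneous term is the orbit of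
\<open>B v - c v\<close>, which is killed by the quotient. Otherwise \<open>c\<close> is not an eigenvalue, so the quotient
already kills \<open>v\<close>.\<close>

lemma summable_powers_if_annihilated:
  fixes B :: "complex^'n^'n"
  assumes eig: "\<And>c v. v \<noteq> 0 \<Longrightarrow> B *v v = c *s v \<Longrightarrow> norm c < 1"
  shows "P \<noteq> 0 \<Longrightarrow> poly_act P B v = 0 \<Longrightarrow> summable (\<lambda>n. norm ((((*v) B) ^^ n) v))"
proof (induction "degree P" arbitrary: P v)
  case 0
  then obtain a where "P = [:a:]" by (metis degree_0_id degree_eq_zeroE)
  with 0 have "v = 0" by (simp add: poly_act_def)
  moreover have "(((*v) B) ^^ n) 0 = 0" for n by (induction n) simp_all
  ultimately show ?case by simp
next
  case (Suc d)
  obtain c where "poly P c = 0"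
    using fundamental_theorem_of_algebra_alt[of P] Suc.hyps(2) by fastforce
  then obtain Q where PQ: "P = [:-c, 1:] * Q" by (auto simp: poly_eq_0_iff_dvd dvd_def)
  have Q: "Q \<noteq> 0" using PQ Suc.prems by auto
  then have "degree P = Suc (degree Q)" unfolding PQ by (subst degree_mult_eq) auto
  with Suc.hyps(2) have dQ: "d = degree Q" by simp
  show ?case
  proof (cases "norm c < 1")
    case True
    let ?w = "B *v v - c *s v"
    have "poly_act Q B ?w = 0" using Suc.prems(2) unfolding PQ poly_act_linear_factor(2) .
    then have sw: "summable (\<lambda>n. norm ((((*v) B) ^^ n) ?w))" using Suc.hyps(1)[OF dQ Q] by simp
    have "(((*v) B) ^^ n) ?w = (((*v) B) ^^ Suc n) v - c *s (((*v) B) ^^ n) v" for n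
      by (induction n) (simp_all add: vec.diff vec.scale)
    then have "(((*v) B) ^^ Suc n) v = c *s (((*v) B) ^^ n) v + (((*v) B) ^^ n) ?w" for n
      by simp
    then have rec: "norm ((((*v) B) ^^ Suc n) v) \<le> norm c * norm ((((*v) B) ^^ n) v) + norm ((((*v) B) ^^ n) ?w)" for n
      by (metis norm_triangle_ineq norm_complex_scale)
    show ?thesis
      by (rule summable_contracting_recurrence[OF norm_ge_zero norm_ge_zero True sw norm_ge_zero rec])
  next
    case False
    have "poly_act Q B v = 0"
    proof (rule ccontr)
      assume nz: "poly_act Q B v \<noteq> 0"
      have "B *v poly_act Q B v = c *s poly_act Q B v"
        using Suc.prems(2) unfolding PQ poly_act_linear_factor(1) by simp
      from eig[OF nz this] False show False by simp
    qed
    then show ?thesis using Suc.hyps(1)[OF dQ Q] by simp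
  qed
qed

text \<open>The first \<open>CARD('n) + 1\<close> vectors of the orbit are linearly dependent or contain a repetition.\<close>

lemma annihilating_poly_exists:
  fixes B :: "complex^'n^'n"
  shows "\<exists>P. P \<noteq> 0 \<and> poly_act P B v = 0"
proof -
  define N where "N = CARD('n)"
  define x where "x = (\<lambda>i. (((*v) B) ^^ i) v)"
  have "\<exists>u :: nat \<Rightarrow> complex. (\<exists>i\<le>N. u i \<noteq> 0) \<and> (\<Sum>i\<le>N. u i *s x i) = 0"
  proof (cases "inj_on x {..N}")
    case True
    have "vec.dim (x ` {..N}) \<le> N"
      using vec.dim_subset_UNIV[of "x ` {..N}"] by (simp add: N_def vec.dimension_def card_cart_basis)
    moreover have "card (x ` {..N}) = Suc N" using True by (simp add: card_image)
    ultimately have "vec.dependent (x ` {..N})" by (intro vec.dependent_biggerset_general) simp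
    then obtain w where w: "\<exists>y\<in>x ` {..N}. w y \<noteq> 0" "(\<Sum>y\<in>x ` {..N}. w y *s y) = 0"
      by (auto simp: vec.dependent_finite)
    then show ?thesis
      by (intro exI[of _ "w \<circ> x"]) (auto simp: sum.reindex[OF True])
  next
    case False
    then obtain i j where ij: "i \<le> N" "j \<le> N" "i \<noteq> j" "x i = x j" by (auto simp: inj_on_def)
    let ?u = "\<lambda>k. if k = i then 1 else if k = j then - 1 else 0 :: complex"
    have "(\<Sum>k\<le>N. ?u k *s x k) = (\<Sum>k\<in>{i, j}. ?u k *s x k)"
      using ij by (intro sum.mono_neutral_right) auto
    then have "(\<Sum>k\<le>N. ?u k *s x k) = 0" using ij by simp
    then show ?thesis using ij by (intro exI[of _ ?u]) auto
  qed
  then obtain u where u: "\<exists>i\<le>N. u i \<noteq> 0" "(\<Sum>i\<le>N. u i *s x i) = 0" by blast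
  define P where "P = (\<Sum>i\<le>N. monom (u i) i)"
  have co: "coeff P i = (if i \<le> N then u i else 0)" for i
    by (simp add: P_def coeff_sum)
  have "degree P \<le> N" by (rule degree_le) (simp add: co)
  then have "poly_act P B v = 0" using u(2) by (simp add: poly_act_eq co x_def)
  moreover have "P \<noteq> 0" using u(1) co by (metis coeff_0)
  ultimately show ?thesis by blast
qed

abbreviation cplx_vec :: "real^'n \<Rightarrow> complex^'n" where
  "cplx_vec x \<equiv> \<chi> i. complex_of_real (x $ i)"

abbreviation cplx_mat :: "real^'n^'m \<Rightarrow> complex^'n^'m" where
  "cplx_mat B \<equiv> map_matrix complex_of_real B"

lemma cplx_vec_mult: "cplx_vec (B *v x) = cplx_mat B *v cplx_vec x"
  by (simp add: vec_eq_iff matrix_vector_mult_def)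

lemma cplx_mat_mult: "cplx_mat (B ** C) = cplx_mat B ** cplx_mat C"
  by (simp add: vec_eq_iff matrix_matrix_mult_def)

lemma cplx_mat_of_int: "cplx_mat (real_mat A) = map_matrix of_int A"
  by (simp add: vec_eq_iff)

lemma norm_cplx_vec: "norm (cplx_vec x) = norm x"
  by (simp add: norm_vec_def L2_set_def)

lemma expansive_invertible:
  fixes A :: "int^'n^'n"
  assumes "expansive A" shows "invertible (real_mat A)"
proof -
  have "x = 0" if "real_mat A *v x = 0" for x :: "real^'n"
  proof (rule ccontr)
    assume "x \<noteq> 0"
    then have nz: "cplx_vec x \<noteq> 0" by (simp add: vec_eq_iff)
    have "map_matrix of_int A *v cplx_vec x = cplx_vec (real_mat A *v x)"
      by (simp add: cplx_vec_mult cplx_mat_of_int)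
    also have "\<dots> = 0 *s cplx_vec x" using that by (simp add: vec_eq_iff)
    finally have "map_matrix of_int A *v cplx_vec x = 0 *s cplx_vec x" .
    with nz assms have "1 < norm (0::complex)" unfolding expansive_def by blast
    then show False by simp
  qed
  then show ?thesis by (simp add: invertible_left_inverse matrix_left_invertible_ker)
qed

lemma eigenvalue_transpose:
  fixes B :: "complex^'n^'n"
  assumes "v \<noteq> 0" "transpose B *v v = c *s v"
  shows "\<exists>w. w \<noteq> 0 \<and> B *v w = c *s w"
proof -
  have sub: "(C - mat c) *v w = C *v w - c *s w" for C :: "complex^'n^'n" and w
    by (simp add: matrix_vector_mult_diff_rdistrib)
      (simp add: vec_eq_iff mat_def matrix_vector_mult_def if_distrib[of "\<lambda>x. x * _"] cong: if_cong)
  have "(transpose B - mat c) *v v = 0" using assms by (simp add: sub)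
  then have "det (transpose B - mat c) = 0"
    using assms(1) by (metis invertible_det_nz invertible_left_inverse matrix_left_invertible_ker)
  moreover have "transpose B - mat c = transpose (B - mat c)"
    by (auto simp: vec_eq_iff transpose_def mat_def)
  ultimately have "det (B - mat c) = 0" by (metis det_transpose)
  then obtain w where "w \<noteq> 0" "(B - mat c) *v w = 0"
    by (metis invertible_det_nz invertible_left_inverse matrix_left_invertible_ker)
  then show ?thesis by (auto simp: sub)
qed

text \<open>Eigenvalues of the inverse transpose are inverses of eigenvalues of \<open>A\<close>, so the orbits of
the unit vectors are summable after complexification; adding them up gives a bound that is
uniform in the direction of \<open>x\<close>.\<close>

lemma AT_inv_powers_summable:
  assumes A: "expansive A"
  obtains K where "summable K" "\<And>n x. norm ((AT_inv A ^^ n) x) \<le> K n * norm x"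
proof -
  let ?M = "transpose (real_mat A)"
  let ?B = "cplx_mat (matrix_inv ?M)"
  have inv: "?M ** matrix_inv ?M = mat 1"
  proof -
    have "\<exists>M'. ?M ** M' = mat 1 \<and> M' ** ?M = mat 1"
      using transpose_invertible[OF expansive_invertible[OF A]] by (simp add: invertible_def)
    then show ?thesis unfolding matrix_inv_def by (rule someI2_ex) blast
  qed
  have tr: "cplx_mat ?M = transpose (map_matrix of_int A)"
    by (simp add: vec_eq_iff transpose_def)
  have cinv: "transpose (map_matrix of_int A) ** ?B = mat 1"
    unfolding tr[symmetric] cplx_mat_mult[symmetric] inv by (simp add: vec_eq_iff mat_def)
  have eig: "norm c < 1" if v: "v \<noteq> 0" "?B *v v = c *s v" for c v
  proof -
    have "v = transpose (map_matrix of_int A) *v (?B *v v)"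
      unfolding matrix_vector_mul_assoc cinv by simp
    also have "\<dots> = c *s (transpose (map_matrix of_int A) *v v)"
      unfolding v(2) by (rule vec.scale)
    finally have *: "v = c *s (transpose (map_matrix of_int A) *v v)" .
    then have c: "c \<noteq> 0" using v(1) by auto
    have "transpose (map_matrix of_int A) *v v = inverse c *s v"
      by (subst (2) *) (simp add: c)
    from eigenvalue_transpose[OF v(1) this] obtain w
      where "w \<noteq> 0" "map_matrix of_int A *v w = inverse c *s w" by blast
    with A have "1 < norm (inverse c)" unfolding expansive_def by blast
    then show ?thesis using c by (simp add: norm_inverse one_less_inverse_iff)
  qed
  have pow: "cplx_vec ((AT_inv A ^^ n) x) = (((*v) ?B) ^^ n) (cplx_vec x)" for n x
    by (induction n) (simp_all add: AT_inv_def cplx_vec_mult)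
  have sm: "summable (\<lambda>n. norm ((AT_inv A ^^ n) x))" for x
  proof -
    obtain P where "P \<noteq> 0" "poly_act P ?B (cplx_vec x) = 0"
      using annihilating_poly_exists by blast
    then have "summable (\<lambda>n. norm ((((*v) ?B) ^^ n) (cplx_vec x)))"
      using summable_powers_if_annihilated eig by blast
    then show ?thesis by (simp flip: pow add: norm_cplx_vec)
  qed
  define K where "K = (\<lambda>n. \<Sum>i\<in>UNIV. norm ((AT_inv A ^^ n) (axis i 1)))"
  have lin: "linear (AT_inv A ^^ n)" for n
  proof (induction n)
    case (Suc n)
    have "linear (AT_inv A)" by (simp add: AT_inv_def[abs_def])
    from linear_compose[OF Suc this] show ?case by (simp add: o_def)
  qed (simp add: linear_iff)
  show thesis
  proof
    show "summable K" unfolding K_def by (intro summable_sum sm)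
    fix n x
    have "(AT_inv A ^^ n) x = (AT_inv A ^^ n) (\<Sum>i\<in>UNIV. x $ i *s axis i 1)"
      by (simp add: basis_expansion)
    also have "\<dots> = (\<Sum>i\<in>UNIV. (x $ i) *\<^sub>R (AT_inv A ^^ n) (axis i 1))"
      by (simp add: linear_sum[OF lin] linear_cmul[OF lin] scalar_mult_eq_scaleR)
    also have "norm \<dots> \<le> (\<Sum>i\<in>UNIV. norm ((x $ i) *\<^sub>R (AT_inv A ^^ n) (axis i 1)))"
      by (rule norm_sum)
    also have "\<dots> \<le> (\<Sum>i\<in>UNIV. norm x * norm ((AT_inv A ^^ n) (axis i 1)))"
      by (intro sum_mono) (simp add: mult_right_mono component_le_norm_cart)
    finally show "norm ((AT_inv A ^^ n) x) \<le> K n * norm x"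
      by (simp add: K_def sum_distrib_left mult.commute)
  qed
qed

section \<open>Digits and the tile\<close>

lemma real_vec_add: "real_vec (k + l) = real_vec k + real_vec l"
  and real_vec_diff: "real_vec (k - l) = real_vec k - real_vec l"
  and real_vec_minus: "real_vec (- k) = - real_vec k"
  and real_vec_0: "real_vec 0 = 0"
  and real_vec_inj: "real_vec k = real_vec l \<longleftrightarrow> k = l"
  by (simp_all add: vec_eq_iff)

lemma AT_real_vec: "AT A (real_vec k) = real_vec (transpose A *v k)"
  by (simp add: AT_def vec_eq_iff matrix_vector_mult_def transpose_def)

abbreviation int_lattice :: "(real^'n) set" where
  "int_lattice \<equiv> range real_vec"

lemma lattice_iff: "x \<in> int_lattice \<longleftrightarrow> (\<forall>i. x $ i \<in> \<int>)"
proof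
  assume "\<forall>i. x $ i \<in> \<int>"
  then have "x = real_vec (\<chi> i. \<lfloor>x $ i\<rfloor>)" by (simp add: vec_eq_iff)
  then show "x \<in> int_lattice" by (rule range_eqI)
qed auto

lemma lattice_intros [simp, intro]:
  "real_vec k \<in> int_lattice" "0 \<in> int_lattice"
  "x \<in> int_lattice \<Longrightarrow> y \<in> int_lattice \<Longrightarrow> x + y \<in> int_lattice"
  "x \<in> int_lattice \<Longrightarrow> y \<in> int_lattice \<Longrightarrow> x - y \<in> int_lattice"
  "x \<in> int_lattice \<Longrightarrow> - x \<in> int_lattice"
  by (auto simp: lattice_iff)

lemma lattice_commute: "x - y \<in> int_lattice \<Longrightarrow> y - x \<in> int_lattice"
  using lattice_intros(5)[of "x - y"] by simp

lemma lattice_trans: "x - y \<in> int_lattice \<Longrightarrow> y - z \<in> int_lattice \<Longrightarrow> x - z \<in> int_lattice"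
  using lattice_intros(3)[of "x - y" "y - z"] by simp

lemma lattice_AT: "x \<in> int_lattice \<Longrightarrow> AT A x \<in> int_lattice"
  by (auto simp: AT_real_vec)

lemma closed_lattice: "closed (int_lattice :: (real^'n) set)"
proof -
  have "int_lattice = (\<Inter>i :: 'n. {x :: real^'n. x $ i \<in> \<int>})" by (auto simp: lattice_iff)
  moreover have "closed {x :: real^'n. x $ i \<in> \<int>}" for i :: 'n
    using closed_vimage[of "\<int> :: real set" "\<lambda>x :: real^'n. x $ i"]
    by (simp add: vimage_def continuous_intros)
  ultimately show ?thesis by (simp add: closed_INT)
qed

lemma lattice_small_eq_0:
  fixes x :: "real^'n"
  assumes "x \<in> int_lattice" "norm x < 1" shows "x = 0"
proof -
  obtain k where k: "x = real_vec k" using assms(1) by blast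
  have "\<bar>real_of_int (k $ i)\<bar> < 1" for i
    using component_le_norm_cart[of x i] assms(2) k by simp
  then have "k $ i = 0" for i by (simp flip: of_int_abs)
  then show ?thesis by (simp add: k vec_eq_iff)
qed

lemma finite_bounded_lattice: "finite {k :: int^'n. norm (real_vec k) \<le> R}"
proof -
  have "{k :: int^'n. norm (real_vec k) \<le> R}
      \<subseteq> (\<lambda>f. \<chi> i. f i) ` (PiE UNIV (\<lambda>_. {-\<lceil>R\<rceil>..\<lceil>R\<rceil>}))"
  proof
    fix k :: "int^'n" assume "k \<in> {k. norm (real_vec k) \<le> R}"
    then have R: "\<bar>real_of_int (k $ i)\<bar> \<le> R" for i
      using component_le_norm_cart[of "real_vec k" i] by simp
    have "k $ i \<in> {-\<lceil>R\<rceil>..\<lceil>R\<rceil>}" for i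
      using R[of i] by (auto simp: abs_le_iff) linarith+
    then show "k \<in> (\<lambda>f. \<chi> i. f i) ` (PiE UNIV (\<lambda>_. {-\<lceil>R\<rceil>..\<lceil>R\<rceil>}))"
      by (intro image_eqI[of _ _ "($) k"]) auto
  qed
  then show ?thesis by (rule finite_subset) (intro finite_imageI finite_PiE; simp)
qed

lemma linear_AT: "linear (AT A)" and linear_AT_inv: "linear (AT_inv A)"
  by (simp_all add: AT_def[abs_def] AT_inv_def[abs_def] del: transpose_matrix_vector)

lemma linear_AT_inv_pow: "linear (AT_inv A ^^ n)"
proof (induction n)
  case (Suc n)
  from linear_compose[OF Suc linear_AT_inv] show ?case by (simp add: o_def)
qed (simp add: linear_iff)

lemmas AT_add = linear_add[OF linear_AT] and AT_diff = linear_diff[OF linear_AT]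
  and AT_inv_add = linear_add[OF linear_AT_inv] and AT_inv_diff = linear_diff[OF linear_AT_inv]
  and AT_inv_pow_diff = linear_diff[OF linear_AT_inv_pow]

locale digit_system =
  fixes A :: "int^'n^'n" and D :: "(int^'n) set"
  assumes expansive: "expansive A"
    and representatives: "complete_representatives A D"
begin

lemmas AT_AT_inv [simp] = AT_inverse(2)[OF expansive_invertible[OF expansive]]
  and AT_inv_AT [simp] = AT_inverse(1)[OF expansive_invertible[OF expansive]]

lemma AT_pow_AT_inv_pow: "(AT A ^^ n) ((AT_inv A ^^ n) x) = x"
proof (induction n)
  case (Suc n)
  have "(AT A ^^ Suc n) ((AT_inv A ^^ Suc n) x) = (AT A ^^ n) (AT A (AT_inv A ((AT_inv A ^^ n) x)))"
    by (simp add: funpow_swap1)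
  with Suc show ?case by simp
qed simp

lemma AT_inv_pow_AT_pow: "(AT_inv A ^^ n) ((AT A ^^ n) x) = x"
proof (induction n)
  case (Suc n)
  have "(AT_inv A ^^ Suc n) ((AT A ^^ Suc n) x) = (AT_inv A ^^ n) (AT_inv A (AT A ((AT A ^^ n) x)))"
    by (simp add: funpow_swap1)
  with Suc show ?case by simp
qed simp

lemma AT_inv_pow_tendsto_0: "(\<lambda>n. (AT_inv A ^^ n) x) \<longlonglongrightarrow> 0"
proof -
  obtain K where K: "summable K" "\<And>n x. norm ((AT_inv A ^^ n) x) \<le> K n * norm x"
    using AT_inv_powers_summable[OF expansive] by blast
  have "(\<lambda>n. K n * norm x) \<longlonglongrightarrow> 0"
    using tendsto_mult_left_zero[OF summable_LIMSEQ_zero[OF K(1)]] .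
  then show ?thesis by (rule Lim_null_comparison[rotated]) (simp add: K(2))
qed

lemma bounded_AT_inv_pow: "\<exists>R. \<forall>n. norm ((AT_inv A ^^ n) x) \<le> R"
  using convergent_imp_Bseq[OF convergentI[OF AT_inv_pow_tendsto_0[of x]]]
  by (auto simp: Bseq_def)

lemma digit_eqI:
  assumes "l \<in> D" "l' \<in> D" "AT_inv A (real_vec l - real_vec l') \<in> int_lattice"
  shows "l = l'"
proof -
  obtain m where "AT_inv A (real_vec l - real_vec l') = real_vec m" using assms(3) by blast
  then have "real_vec (l - l') = AT A (real_vec m)" by (metis AT_AT_inv real_vec_diff)
  then have "l - l' = transpose A *v m" by (simp only: AT_real_vec real_vec_inj)
  moreover have "l - l = transpose A *v 0" by simp
  ultimately show ?thesis
    using assms(1,2) representatives unfolding complete_representatives_def by blast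
qed

lemma digit_exists: "\<exists>l\<in>D. AT_inv A (real_vec k - real_vec l) \<in> int_lattice"
proof -
  obtain l m where "l \<in> D" "k - l = transpose A *v m"
    using representatives unfolding complete_representatives_def by blast
  then have "AT_inv A (real_vec k - real_vec l) = real_vec m"
    by (metis AT_inv_AT AT_real_vec real_vec_diff)
  then show ?thesis using \<open>l \<in> D\<close> by auto
qed

text \<open>Every digit is congruent modulo \<open>A\<^sup>T \<int>\<^sup>d\<close> to its remainder in \<open>A\<^sup>T [0, 1)\<^sup>d\<close>, and this bounded set
contains finitely many lattice points. Distinct digits have distinct remainders.\<close>

lemma finite_D: "finite D"
proof -
  define fl :: "real^'n \<Rightarrow> int^'n" where "fl = (\<lambda>y. \<chi> i. \<lfloor>y $ i\<rfloor>)"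
  define r where "r = (\<lambda>l. l - transpose A *v fl (AT_inv A (real_vec l)))"
  obtain C where C: "\<And>x. norm (AT A x) \<le> C * norm x" "C > 0"
    using linear_bounded_pos[OF linear_AT] by blast
  have "norm (real_vec (r l)) \<le> C * real CARD('n)" for l
  proof -
    define y where "y = AT_inv A (real_vec l)"
    have "real_vec (r l) = AT A (y - real_vec (fl y))"
      unfolding r_def real_vec_diff y_def AT_diff by (simp add: AT_real_vec)
    moreover have "norm (y - real_vec (fl y)) \<le> real CARD('n)"
    proof -
      have "\<bar>(y - real_vec (fl y)) $ i\<bar> \<le> 1" for i by (simp add: fl_def) linarith
      then have "(\<Sum>i\<in>UNIV. \<bar>(y - real_vec (fl y)) $ i\<bar>) \<le> (\<Sum>i\<in>(UNIV :: 'n set). 1)"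
        by (intro sum_mono)
      then show ?thesis using norm_le_l1_cart[of "y - real_vec (fl y)"] by simp
    qed
    ultimately show ?thesis
      using C(1)[of "y - real_vec (fl y)"] mult_left_mono[OF _ less_imp_le[OF C(2)]]
      by (metis order.trans)
  qed
  then have "finite (r ` D)" by (intro finite_subset[OF _ finite_bounded_lattice]) auto
  moreover have "inj_on r D"
  proof (rule inj_onI)
    fix l l' assume l: "l \<in> D" "l' \<in> D" "r l = r l'"
    then have "l - l' = transpose A *v (fl (AT_inv A (real_vec l)) - fl (AT_inv A (real_vec l')))"
      by (simp add: r_def matrix_vector_mult_diff_distrib algebra_simps)
    then have "AT_inv A (real_vec l - real_vec l') \<in> int_lattice"
      by (metis AT_inv_AT AT_real_vec real_vec_diff lattice_intros(1))
    with l show "l = l'" by (blast intro: digit_eqI)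
  qed
  ultimately show ?thesis by (rule finite_imageD)
qed

lemma D_nonempty: "D \<noteq> {}" using digit_exists by blast

lemma digit_series_bound:
  obtains M where "summable M"
    "\<And>j l. l \<in> D \<Longrightarrow> norm ((AT_inv A ^^ Suc j) (real_vec l)) \<le> M j"
proof -
  obtain K where K: "summable K" "\<And>n x. norm ((AT_inv A ^^ n) x) \<le> K n * norm x"
    using AT_inv_powers_summable[OF expansive] by blast
  define R where "R = (\<Sum>l\<in>D. norm (real_vec l))"
  have K0: "0 \<le> K n" for n
    using order_trans[OF norm_ge_zero K(2)[of n "axis undefined 1"]] by simp
  show thesis
  proof
    show "summable (\<lambda>j. K (Suc j) * R)"
      using K(1) by (intro summable_mult2) (simp only: summable_Suc_iff)
    fix j l assume "l \<in> D"
    then have "norm (real_vec l) \<le> R"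
      unfolding R_def using finite_D by (intro member_le_sum) auto
    then show "norm ((AT_inv A ^^ Suc j) (real_vec l)) \<le> K (Suc j) * R"
      using K(2)[of "Suc j" "real_vec l"] mult_left_mono[OF _ K0] order_trans by blast
  qed
qed

lemma summable_digits:
  assumes "range d \<subseteq> D"
  shows "summable (\<lambda>j. (AT_inv A ^^ Suc j) (real_vec (d j)))"
proof -
  obtain M where M: "summable M"
    "\<And>j l. l \<in> D \<Longrightarrow> norm ((AT_inv A ^^ Suc j) (real_vec l)) \<le> M j"
    using digit_series_bound by blast
  show ?thesis by (rule summable_comparison_test'[OF M(1), of 0]) (use assms M(2) in blast)
qed

lemma tile_eq_image:
  "tile A D = (\<lambda>s. \<Sum>j. (AT_inv A ^^ Suc j) (s j)) ` PiE UNIV (\<lambda>_. real_vec ` D)"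
proof (intro equalityI subsetI)
  fix x assume "x \<in> tile A D"
  then obtain d where d: "range d \<subseteq> D" "(\<lambda>j. (AT_inv A ^^ Suc j) (real_vec (d j))) sums x"
    unfolding tile_def by blast
  have "x = (\<Sum>j. (AT_inv A ^^ Suc j) (real_vec (d j)))" using d(2) by (rule sums_unique)
  moreover have "(\<lambda>j. real_vec (d j)) \<in> PiE UNIV (\<lambda>_. real_vec ` D)" using d(1) by auto
  ultimately show "x \<in> (\<lambda>s. \<Sum>j. (AT_inv A ^^ Suc j) (s j)) ` PiE UNIV (\<lambda>_. real_vec ` D)"
    by (rule image_eqI)
next
  fix x assume "x \<in> (\<lambda>s. \<Sum>j. (AT_inv A ^^ Suc j) (s j)) ` PiE UNIV (\<lambda>_. real_vec ` D)"
  then obtain s where s: "s \<in> PiE UNIV (\<lambda>_ :: nat. real_vec ` D)" "x = (\<Sum>j. (AT_inv A ^^ Suc j) (s j))"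
    by blast
  have "s j \<in> real_vec ` D" for j using PiE_mem[OF s(1)] by blast
  then have "\<forall>j. \<exists>l. l \<in> D \<and> s j = real_vec l" by blast
  from choice[OF this] obtain d where d: "\<And>j. d j \<in> D" "\<And>j. s j = real_vec (d j)" by blast
  then have "range d \<subseteq> D" by auto
  from summable_sums[OF summable_digits[OF this]] this
  show "x \<in> tile A D" unfolding tile_def s(2) d(2) by blast
qed

text \<open>The digit expansion is a uniform limit of continuous functions on the compact product space of
digit sequences.\<close>

lemma compact_tile: "compact (tile A D)"
  unfolding tile_eq_image
proof (rule compact_continuous_image)
  obtain M where M: "summable M"
    "\<And>j l. l \<in> D \<Longrightarrow> norm ((AT_inv A ^^ Suc j) (real_vec l)) \<le> M j"
    using digit_series_bound by blast
  let ?P = "PiE UNIV (\<lambda>_ :: nat. real_vec ` D)"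
  have ul: "uniform_limit ?P (\<lambda>n s. \<Sum>j<n. (AT_inv A ^^ Suc j) (s j))
      (\<lambda>s. \<Sum>j. (AT_inv A ^^ Suc j) (s j)) sequentially"
  proof (rule Weierstrass_m_test[OF _ M(1)])
    fix j s assume "s \<in> ?P"
    then obtain l where l: "l \<in> D" "s j = real_vec l" by blast
    show "norm ((AT_inv A ^^ Suc j) (s j)) \<le> M j" using M(2)[OF l(1)] unfolding l(2) .
  qed
  have cont: "continuous_on UNIV (AT_inv A ^^ j)" for j
    by (rule linear_continuous_on[OF linear_AT_inv_pow[unfolded linear_conv_bounded_linear]])
  have "continuous_on ?P (\<lambda>s. \<Sum>j<n. (AT_inv A ^^ Suc j) (s j))" for n
    by (intro continuous_on_sum continuous_on_compose2[OF cont]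
        continuous_on_subset[OF continuous_on_product_coordinates]) auto
  then show "continuous_on ?P (\<lambda>s. \<Sum>j. (AT_inv A ^^ Suc j) (s j))"
    by (intro uniform_limit_theorem[OF _ ul]) auto
  have "compact (real_vec ` D)" using finite_D by (simp add: finite_imp_compact)
  then have "compactin (product_topology (\<lambda>_. euclidean) UNIV) ?P"
    by (simp add: compactin_PiE)
  then show "compact ?P" by (simp add: euclidean_product_topology)
qed

lemma tile_nonempty: "tile A D \<noteq> {}"
proof -
  obtain l where "l \<in> D" using D_nonempty by blast
  then have "(\<lambda>_. real_vec l) \<in> PiE UNIV (\<lambda>_ :: nat. real_vec ` D)" by auto
  then show ?thesis unfolding tile_eq_image by blast
qed

lemma tau_tile:
  assumes "l \<in> D" "x \<in> tile A D" shows "tau A l x \<in> tile A D"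
proof -
  obtain d where d: "range d \<subseteq> D" "(\<lambda>j. (AT_inv A ^^ Suc j) (real_vec (d j))) sums x"
    using assms(2) unfolding tile_def by blast
  have "(\<lambda>j. AT_inv A ((AT_inv A ^^ Suc j) (real_vec (d j)))) sums AT_inv A x"
    using d(2) by (rule bounded_linear.sums[OF linear_AT_inv[unfolded linear_conv_bounded_linear]])
  then have "(\<lambda>j. (AT_inv A ^^ Suc (Suc j)) (real_vec (case_nat l d (Suc j)))) sums AT_inv A x" by simp
  from sums_Suc[OF this]
  have "(\<lambda>j. (AT_inv A ^^ Suc j) (real_vec (case_nat l d j))) sums tau A l x"
    by (simp add: tau_def AT_inv_add)
  moreover have "case_nat l d j \<in> D" for j using d(1) assms(1) by (cases j) auto
  then have "range (case_nat l d) \<subseteq> D" by blast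
  ultimately show ?thesis unfolding tile_def by blast
qed

lemma tile_subset_tau: "tile A D \<subseteq> (\<Union>l\<in>D. tau A l ` tile A D)"
proof
  fix x assume "x \<in> tile A D"
  then obtain d where d: "range d \<subseteq> D" "(\<lambda>j. (AT_inv A ^^ Suc j) (real_vec (d j))) sums x"
    unfolding tile_def by blast
  let ?e = "\<lambda>j. d (Suc j)"
  have e: "range ?e \<subseteq> D" using d(1) by auto
  let ?y = "\<Sum>j. (AT_inv A ^^ Suc j) (real_vec (?e j))"
  have y: "(\<lambda>j. (AT_inv A ^^ Suc j) (real_vec (?e j))) sums ?y"
    by (rule summable_sums[OF summable_digits[OF e]])
  then have "(\<lambda>j. AT_inv A ((AT_inv A ^^ Suc j) (real_vec (?e j)))) sums AT_inv A ?y"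
    by (rule bounded_linear.sums[OF linear_AT_inv[unfolded linear_conv_bounded_linear]])
  then have "(\<lambda>j. (AT_inv A ^^ Suc (Suc j)) (real_vec (d (Suc j)))) sums AT_inv A ?y" by simp
  from sums_Suc[OF this]
  have "(\<lambda>j. (AT_inv A ^^ Suc j) (real_vec (d j))) sums tau A (d 0) ?y"
    by (simp add: tau_def AT_inv_add)
  then have "x = tau A (d 0) ?y" by (rule sums_unique2[OF d(2)])
  moreover have "?y \<in> tile A D" unfolding tile_def using e y by blast
  ultimately show "x \<in> (\<Union>l\<in>D. tau A l ` tile A D)" using d(1) by blast
qed

text \<open>All maps \<open>\<tau>\<^sub>l\<close> have the same linear part, so the digits cancel in the difference of two orbits.\<close>

lemma orbit_diff:
  "orbit A x \<omega> n - orbit A y \<omega> n = (AT_inv A ^^ n) (x - y)"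
  by (induction n) (simp_all add: tau_def flip: AT_inv_diff)

lemma orbit_tile: "x \<in> tile A D \<Longrightarrow> range \<omega> \<subseteq> D \<Longrightarrow> orbit A x \<omega> n \<in> tile A D"
  by (induction n) (auto intro!: tau_tile)

end

section \<open>Coding words by lattice points and positions on the cycle\<close>

lemma e2pi_eq_iff: "e2pi x = e2pi y \<longleftrightarrow> x - y \<in> int_lattice"
proof -
  have "cis (2 * pi * a) = cis (2 * pi * b) \<longleftrightarrow> a - b \<in> \<int>" for a b
  proof -
    have "cis (2 * pi * a) = cis (2 * pi * b) \<longleftrightarrow>
        sin (2 * pi * a) = sin (2 * pi * b) \<and> cos (2 * pi * a) = cos (2 * pi * b)"
      by (auto simp: complex_eq_iff)
    also have "\<dots> \<longleftrightarrow> (\<exists>n :: int. 2 * pi * a = 2 * pi * b + 2 * pi * n)"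
      by (rule sin_cos_eq_iff)
    also have "\<dots> \<longleftrightarrow> (\<exists>n :: int. a - b = n)"
    proof (intro ex_cong1)
      fix n :: int
      have "2 * pi * a = 2 * pi * b + 2 * pi * n \<longleftrightarrow> 2 * pi * a = 2 * pi * (b + n)"
        by (simp add: distrib_left)
      then show "2 * pi * a = 2 * pi * b + 2 * pi * n \<longleftrightarrow> a - b = n" by auto
    qed
    also have "\<dots> \<longleftrightarrow> a - b \<in> \<int>" by (auto elim: Ints_cases)
    finally show ?thesis .
  qed
  then show ?thesis by (simp add: e2pi_def vec_eq_iff lattice_iff)
qed

locale simple_cycle_system = digit_system A D
  for A :: "int^'n^'n" and D :: "(int^'n) set" +
  fixes p :: nat and \<theta> :: "nat \<Rightarrow> real^'n"
  assumes simple: "simple_cycle A D p \<theta>"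
begin

lemma p_pos: "0 < p"
  using simple by (auto simp: simple_cycle_def cycle_def)

lemma AT_cycle: "AT A (\<theta> (Suc n mod p)) - \<theta> (n mod p) \<in> int_lattice"
proof -
  obtain l where l: "\<And>i. i < p \<Longrightarrow> tau A (l i) (\<theta> i) = \<theta> (Suc i mod p)"
    using simple unfolding simple_cycle_def cycle_def by blast
  have "\<theta> (Suc n mod p) = tau A (l (n mod p)) (\<theta> (n mod p))"
    using l[of "n mod p"] p_pos by (simp add: mod_Suc_eq)
  then show ?thesis by (simp add: tau_def)
qed

lemma cycle_eqI: "\<theta> (i mod p) - \<theta> (j mod p) \<in> int_lattice \<Longrightarrow> i mod p = j mod p"
  using simple p_pos mod_less_divisor unfolding simple_cycle_def by blast

text \<open>Points of the cycle modulo the lattice are moved one step back by \<open>A\<^sup>T\<close>.\<close>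

lemma cycle_step:
  assumes "x - \<theta> (n mod p) \<in> int_lattice" "y - \<theta> (m mod p) \<in> int_lattice" "AT A y - x \<in> int_lattice"
  shows "m mod p = Suc n mod p"
proof -
  define i where "i = m + p - 1"
  have i: "Suc i mod p = m mod p" using p_pos by (simp add: i_def)
  have "AT A y - AT A (\<theta> (m mod p)) \<in> int_lattice"
    using lattice_AT[OF assms(2)] by (simp add: AT_diff)
  moreover have "AT A (\<theta> (m mod p)) - \<theta> (i mod p) \<in> int_lattice" using AT_cycle[of i] by (simp only: i)
  ultimately have "AT A y - \<theta> (i mod p) \<in> int_lattice" by (rule lattice_trans)
  then have "\<theta> (i mod p) - x \<in> int_lattice"
    using lattice_trans[OF lattice_commute assms(3)] by blast
  then have "\<theta> (i mod p) - \<theta> (n mod p) \<in> int_lattice" using assms(1) by (rule lattice_trans)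
  then have "i mod p = n mod p" by (rule cycle_eqI)
  then show ?thesis using i by (metis mod_Suc_eq)
qed

text \<open>A lift to \<open>\<real>\<^sup>d\<close> of the sequence on the torus that \<open>hat_i\<close> assigns to \<open>(x, j)\<close>.\<close>

definition solenoid_path :: "real^'n \<Rightarrow> nat \<Rightarrow> nat \<Rightarrow> real^'n" where
  "solenoid_path x j n = (AT_inv A ^^ n) x + \<theta> ((n + j) mod p)"

lemma hat_i_eq: "hat_i A p \<theta> (x, j) n = e2pi (solenoid_path x j n)"
  by (simp add: hat_i_def solenoid_path_def)

lemma AT_solenoid_path:
  "AT A (solenoid_path x j (Suc n)) - solenoid_path x j n \<in> int_lattice"
  using AT_cycle[of "n + j"] by (simp add: solenoid_path_def AT_add)

text \<open>The contracting parts tend to \<open>0\<close>. Along multiples of \<open>p\<close> this leaves a lattice point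
\<open>\<theta>\<^sub>j - \<theta>\<^sub>k\<close> in the limit, so \<open>j = k\<close> by simplicity. Then the images of \<open>x - y\<close> are lattice points
that tend to \<open>0\<close>, so they vanish eventually.\<close>

lemma hat_i_inj: "inj_on (hat_i A p \<theta>) (UNIV \<times> {..<p})"
proof (rule inj_onI, safe)
  fix x y :: "real^'n" and j k
  assume jk: "j < p" "k < p" and eq: "hat_i A p \<theta> (x, j) = hat_i A p \<theta> (y, k)"
  have path: "solenoid_path x j n - solenoid_path y k n \<in> int_lattice" for n
    using fun_cong[OF eq, of n] by (simp only: hat_i_eq e2pi_eq_iff)
  have pth: "(AT_inv A ^^ n) (x - y) + (\<theta> ((n + j) mod p) - \<theta> ((n + k) mod p)) \<in> int_lattice" for n
  proof -
    have "(AT_inv A ^^ n) (x - y) + (\<theta> ((n + j) mod p) - \<theta> ((n + k) mod p))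
        = solenoid_path x j n - solenoid_path y k n"
      by (simp add: solenoid_path_def AT_inv_pow_diff)
    with path show ?thesis by (simp only:)
  qed
  have lim: "(\<lambda>t. (AT_inv A ^^ (p * t)) (x - y) + (\<theta> j - \<theta> k)) \<longlonglongrightarrow> 0 + (\<theta> j - \<theta> k)"
    using AT_inv_pow_tendsto_0 p_pos
    by (intro tendsto_add tendsto_const
        filterlim_compose[OF AT_inv_pow_tendsto_0] filterlim_subseq) (simp add: strict_mono_def)
  have mem: "(AT_inv A ^^ (p * t)) (x - y) + (\<theta> j - \<theta> k) \<in> int_lattice" for t
    using pth[of "p * t"] jk by simp
  have "0 + (\<theta> j - \<theta> k) \<in> int_lattice"
    by (rule closed_sequentially[OF closed_lattice mem lim])
  then have "\<theta> (j mod p) - \<theta> (k mod p) \<in> int_lattice" using jk by simp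
  from cycle_eqI[OF this] jk show "j = k" by simp
  then have "(AT_inv A ^^ n) (x - y) \<in> int_lattice" for n using pth[of n] by simp
  moreover have "\<forall>\<^sub>F n in sequentially. norm ((AT_inv A ^^ n) (x - y)) < 1"
    using order_tendstoD(2)[OF tendsto_norm_zero[OF AT_inv_pow_tendsto_0[of "x - y"]], of 1] by simp
  then obtain n where "norm ((AT_inv A ^^ n) (x - y)) < 1"
    by (auto simp: eventually_sequentially)
  ultimately have "(AT_inv A ^^ n) (x - y) = 0" using lattice_small_eq_0 by blast
  then have "x - y = (AT A ^^ n) 0" using AT_pow_AT_inv_pow[of n "x - y"] by simp
  moreover have "(AT A ^^ n) 0 = 0" by (induction n) (simp_all add: linear_0[OF linear_AT])
  ultimately show "x = y" by simp
qed

text \<open>The pair \<open>(k, j)\<close> identifies the word \<open>\<omega>\<close> among all words with a path on the solenoid. The base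
points are chosen so that the congruence for \<open>n = 0\<close> always holds; since digits cancel in
differences of orbits, the choice of \<open>x\<close> is immaterial.\<close>

definition code :: "(nat \<Rightarrow> int^'n) \<Rightarrow> int^'n \<Rightarrow> nat \<Rightarrow> bool" where
  "code \<omega> k j \<longleftrightarrow> j < p \<and>
     (\<forall>x n. orbit A x \<omega> n - solenoid_path (x - \<theta> j - real_vec k) j n \<in> int_lattice)"

lemma codeI:
  assumes "j < p" and "\<And>n. orbit A x \<omega> n - solenoid_path (x - \<theta> j - real_vec k) j n \<in> int_lattice"
  shows "code \<omega> k j"
  unfolding code_def
proof (intro conjI allI assms(1))
  fix y n
  have "orbit A y \<omega> n - solenoid_path (y - \<theta> j - real_vec k) j n
      = orbit A x \<omega> n - solenoid_path (x - \<theta> j - real_vec k) j n"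
    using orbit_diff[of y \<omega> n x]
    by (simp add: solenoid_path_def AT_inv_pow_diff algebra_simps)
  then show "orbit A y \<omega> n - solenoid_path (y - \<theta> j - real_vec k) j n \<in> int_lattice"
    using assms(2) by simp
qed

lemma frak_d_code:
  assumes "code \<omega> k j"
  shows "frak_d A (x, \<omega>) = hat_i A p \<theta> (x - \<theta> j - real_vec k, j)"
proof
  fix n show "frak_d A (x, \<omega>) n = hat_i A p \<theta> (x - \<theta> j - real_vec k, j) n"
    unfolding hat_i_eq using assms by (simp add: frak_d_def code_def e2pi_eq_iff)
qed

lemma inv_hat_i_frak_d:
  assumes "code \<omega> k j"
  shows "inv_into (UNIV \<times> {..<p}) (hat_i A p \<theta>) (frak_d A (x, \<omega>)) = (x - \<theta> j - real_vec k, j)"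
  unfolding frak_d_code[OF assms] using assms
  by (intro inv_into_f_f hat_i_inj) (simp add: code_def)

lemma code_unique:
  assumes "code \<omega> k j" "code \<omega> k' j'" shows "k = k' \<and> j = j'"
  using inv_hat_i_frak_d[OF assms(1), of 0] inv_hat_i_frak_d[OF assms(2), of 0]
  by (auto simp: vec_eq_iff)

text \<open>A congruence between an orbit and a path on the solenoid goes back in time, because
  \<open>A\<^sup>T\<close> respects the lattice and undoes every digit map up to the lattice.\<close>

lemma path_congruence_backwards:
  assumes "orbit A x \<omega> (m + n) - solenoid_path y j (m + n) \<in> int_lattice"
  shows "orbit A x \<omega> n - solenoid_path y j n \<in> int_lattice"
  using assms
proof (induction m)
  case (Suc m)
  have "orbit A x \<omega> (m + n) - AT A (orbit A x \<omega> (Suc m + n)) \<in> int_lattice"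
    by (simp add: tau_def)
  moreover have "AT A (orbit A x \<omega> (Suc m + n)) - AT A (solenoid_path y j (Suc m + n)) \<in> int_lattice"
    using lattice_AT[OF Suc.prems] by (simp only: AT_diff)
  moreover have "AT A (solenoid_path y j (Suc m + n)) - solenoid_path y j (m + n) \<in> int_lattice"
    using AT_solenoid_path by simp
  ultimately have "orbit A x \<omega> (m + n) - solenoid_path y j (m + n) \<in> int_lattice"
    by (blast intro: lattice_trans)
  then show ?case by (rule Suc.IH)
qed simp

text \<open>From some index on, \<open>\<omega>\<close> repeats the digits of a cycle in \<open>C - \<int>\<^sup>d\<close>. The positions on that cycle
advance with the positions on \<open>C\<close>, so the tail of the orbit is congruent to a path on the
solenoid; congruences then propagate back to \<open>n = 0\<close>.\<close>

lemma code_exists: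
  assumes "\<omega> \<in> Omega_tilde A D p \<theta>"
  shows "\<exists>k j. code \<omega> k j"
proof -
  obtain q \<eta> m where cyc: "cycle A D q \<eta> m"
    and sub: "\<eta> ` {..<q} \<subseteq> {\<theta> j - real_vec k | j k. j < p} \<inter> tile A D"
    and tail: "\<omega> \<in> Omega_cycle D q m"
    using assms unfolding Omega_tilde_def by blast
  have q: "0 < q" and step: "\<And>i. i < q \<Longrightarrow> tau A (m i) (\<eta> i) = \<eta> (Suc i mod q)"
    using cyc unfolding cycle_def by blast+
  have sub: "\<exists>j k. \<eta> i = \<theta> j - real_vec k \<and> j < p" if "i < q" for i
    using subsetD[OF sub, of "\<eta> i"] that by blast
  obtain N where N: "\<And>n. \<omega> (N + n) = m (n mod q)"
    using tail unfolding Omega_cycle_def by blast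
  define h where "h = (\<lambda>n. \<eta> (n mod q))"
  have h_step: "h (Suc n) = tau A (\<omega> (N + n)) (h n)" for n
    using step[of "n mod q"] q by (simp add: h_def N mod_Suc_eq)
  have h_theta: "\<exists>i. h n - \<theta> (i mod p) \<in> int_lattice" for n
  proof -
    obtain i k where "h n = \<theta> i - real_vec k" "i < p" using sub[of "n mod q"] q by (auto simp: h_def)
    then have "h n - \<theta> (i mod p) \<in> int_lattice" by simp
    then show ?thesis ..
  qed
  obtain j0 where j0: "h 0 - \<theta> (j0 mod p) \<in> int_lattice" using h_theta by blast
  have h_pos: "h n - \<theta> ((n + j0) mod p) \<in> int_lattice" for n
  proof (induction n)
    case (Suc n)
    obtain i where i: "h (Suc n) - \<theta> (i mod p) \<in> int_lattice" using h_theta by blast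
    have "AT A (h (Suc n)) - h n \<in> int_lattice" by (simp add: h_step tau_def)
    from cycle_step[OF Suc i this] i show ?case by simp
  qed (use j0 in simp)
  \<comment> \<open>this is \<open>j0 - N\<close> modulo \<open>p\<close>, written without subtraction\<close>
  define j where "j = (j0 + N * (p - 1)) mod p"
  have j: "(N + n + j) mod p = (n + j0) mod p" for n
  proof -
    have "(N + n + j) mod p = (N + n + (j0 + N * (p - 1))) mod p" by (simp add: j_def mod_simps)
    also have "N + n + (j0 + N * (p - 1)) = n + j0 + N * p" using p_pos by (cases p) auto
    finally show ?thesis by simp
  qed
  \<comment> \<open>the path through the tail at time \<open>N\<close>, followed back to time \<open>0\<close>\<close>
  define y where "y = (AT A ^^ N) (orbit A 0 \<omega> N - h 0)"
  have orbit_tail: "orbit A 0 \<omega> (N + n) = (AT_inv A ^^ n) (orbit A 0 \<omega> N - h 0) + h n" for n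
    by (induction n) (simp_all add: h_step tau_def AT_inv_add)
  have "(AT_inv A ^^ (N + n)) y = (AT_inv A ^^ n) (orbit A 0 \<omega> N - h 0)" for n
    unfolding y_def by (subst add.commute) (simp add: funpow_add AT_inv_pow_AT_pow)
  then have "orbit A 0 \<omega> (N + n) - solenoid_path y j (N + n) \<in> int_lattice" for n
    using h_pos[of n] by (simp add: orbit_tail solenoid_path_def j)
  then have path: "orbit A 0 \<omega> n - solenoid_path y j n \<in> int_lattice" for n
    by (rule path_congruence_backwards)
  have jp: "j < p" using p_pos by (simp add: j_def)
  obtain k where "0 - solenoid_path y j 0 = real_vec k" using path[of 0] by auto
  then have k: "0 - (y + \<theta> j) = real_vec k" using jp by (simp add: solenoid_path_def)
  have y: "y = 0 - \<theta> j - real_vec k" unfolding k[symmetric] by simp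
  have "code \<omega> k j" using path by (intro codeI[OF jp, of 0]) (simp add: y)
  then show ?thesis by blast
qed

text \<open>Both orbits of \<open>0\<close> are congruent to the same path. As long as they agree, two possible next
digits differ by an element of \<open>A\<^sup>T \<int>\<^sup>d\<close>, hence are equal.\<close>

lemma code_inj:
  assumes "code \<omega> k j" "code \<omega>' k j" "range \<omega> \<subseteq> D" "range \<omega>' \<subseteq> D"
  shows "\<omega> = \<omega>'"
proof -
  have close: "orbit A 0 \<omega> n - orbit A 0 \<omega>' n \<in> int_lattice" for n
    using assms(1,2) unfolding code_def by (blast intro: lattice_trans lattice_commute)
  have dig: "\<omega> n = \<omega>' n" if "orbit A 0 \<omega> n = orbit A 0 \<omega>' n" for n
  proof (rule digit_eqI)
    show "AT_inv A (real_vec (\<omega> n) - real_vec (\<omega>' n)) \<in> int_lattice"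
      using close[of "Suc n"] that by (simp add: tau_def flip: AT_inv_diff)
  qed (use assms(3,4) in auto)
  have "orbit A 0 \<omega> n = orbit A 0 \<omega>' n" for n
    by (induction n) (simp_all add: dig)
  with dig show ?thesis by blast
qed

text \<open>An orbit started in the tile stays there and approaches the periodic orbit with the same digits;
the tile is closed.\<close>

lemma periodic_point_in_tile:
  assumes step: "\<And>n. h (Suc n) = tau A (d n) (h n)" and d: "range d \<subseteq> D"
    and per: "\<And>n. h (n + q) = h n" and q: "0 < q"
  shows "h n \<in> tile A D"
proof -
  obtain x where x: "x \<in> tile A D" using tile_nonempty by blast
  have hd: "h n = orbit A (h 0) d n" for n by (induction n) (simp_all add: step)
  have hp: "h (n + q * t) = h n" for t
  proof (induction t)
    case (Suc t)
    have "h (n + q * Suc t) = h ((n + q * t) + q)" by (simp add: algebra_simps)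
    with Suc show ?case by (simp only: per)
  qed simp
  have lim: "(\<lambda>t. h n + (AT_inv A ^^ (n + q * t)) (x - h 0)) \<longlonglongrightarrow> h n + 0"
    using q by (intro tendsto_add tendsto_const
        filterlim_compose[OF AT_inv_pow_tendsto_0] filterlim_subseq) (simp add: strict_mono_def)
  have in_tile: "h n + (AT_inv A ^^ (n + q * t)) (x - h 0) \<in> tile A D" for t
  proof -
    have "h n + (AT_inv A ^^ (n + q * t)) (x - h 0) = orbit A x d (n + q * t)"
      using orbit_diff[of x d "n + q * t" "h 0"] hp[of t] hd[of "n + q * t"]
      by (simp add: algebra_simps)
    then show ?thesis using orbit_tile[OF x d] by simp
  qed
  have "h n + 0 \<in> tile A D"
    by (rule closed_sequentially[OF compact_imp_closed[OF compact_tile] in_tile lim])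
  then show ?thesis by simp
qed

text \<open>Choose digits one after the other so that the orbit of a point \<open>x\<close> of the tile follows the
prescribed path. Removing the contracting part leaves a sequence \<open>h\<close> in \<open>C - \<int>\<^sup>d\<close> driven by the same
digits. It is bounded, so it takes some value twice. Each value of \<open>h\<close> determines the next digit, so
\<open>h\<close> and the digits are periodic from there on, and they form a cycle in \<open>C - \<int>\<^sup>d\<close>.\<close>

lemma code_surj:
  assumes j: "j < p"
  shows "\<exists>\<omega>\<in>Omega_tilde A D p \<theta>. code \<omega> k j"
proof -
  obtain x where x: "x \<in> tile A D" using tile_nonempty by blast
  define c where "c = x - \<theta> j - real_vec k"
  define w where "w = solenoid_path c j"
  define dig where "dig = (\<lambda>y z. SOME l. l \<in> D \<and> tau A l y - z \<in> int_lattice)"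
  have dig: "dig y z \<in> D \<and> tau A (dig y z) y - z \<in> int_lattice" if yz: "AT A z - y \<in> int_lattice" for y z
  proof -
    obtain l where l: "AT A z - y = real_vec l" using yz by blast
    obtain l' where l': "l' \<in> D" "AT_inv A (real_vec l - real_vec l') \<in> int_lattice"
      using digit_exists by blast
    have "z - tau A l' y = AT_inv A (AT A z - y - real_vec l')"
      by (simp add: tau_def AT_inv_diff AT_inv_add)
    then have "tau A l' y - z \<in> int_lattice" using l l'(2) by (intro lattice_commute[of z]) simp
    with l'(1) have "l' \<in> D \<and> tau A l' y - z \<in> int_lattice" ..
    then show ?thesis unfolding dig_def by (rule someI[of "\<lambda>l. l \<in> D \<and> tau A l y - z \<in> int_lattice"])
  qed
  define ob where "ob = rec_nat x (\<lambda>n y. tau A (dig y (w (Suc n))) y)"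
  define \<omega> where "\<omega> = (\<lambda>n. dig (ob n) (w (Suc n)))"
  have ob_0: "ob 0 = x" and ob_Suc: "ob (Suc n) = tau A (\<omega> n) (ob n)" for n
    by (simp_all add: ob_def \<omega>_def)
  have orb: "orbit A x \<omega> n = ob n" for n by (induction n) (simp_all add: ob_0 ob_Suc)
  have pull: "AT A (w (Suc n)) - ob n \<in> int_lattice" if "ob n - w n \<in> int_lattice" for n
    using AT_solenoid_path lattice_commute[OF that] unfolding w_def by (rule lattice_trans)
  have close: "ob n - w n \<in> int_lattice" for n
  proof (induction n)
    case 0 show ?case using j by (simp add: ob_0 w_def solenoid_path_def c_def)
  next
    case (Suc n)
    from dig[OF pull[OF this]] show ?case by (simp add: ob_Suc \<omega>_def)
  qed
  have \<omega>D: "\<omega> n \<in> D" for n using dig[OF pull[OF close]] by (simp add: \<omega>_def)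
  then have ran: "range \<omega> \<subseteq> D" by blast
  have code: "code \<omega> k j"
    using close by (intro codeI[OF j, of x]) (simp add: orb w_def c_def)
  \<comment> \<open>subtracting the contracting part leaves an orbit in the translates of the cycle\<close>
  define h where "h = (\<lambda>n. ob n - (AT_inv A ^^ n) c)"
  have h_step: "h (Suc n) = tau A (\<omega> n) (h n)" for n
    by (simp add: h_def ob_Suc tau_def AT_inv_diff AT_inv_add)
  have h_theta: "h n - \<theta> ((n + j) mod p) \<in> int_lattice" for n
    using close[of n] by (simp add: h_def w_def solenoid_path_def algebra_simps)
  have "finite (range h)"
  proof -
    obtain R1 where R1: "\<And>n. norm ((AT_inv A ^^ n) c) \<le> R1" using bounded_AT_inv_pow by blast
    obtain R2 where R2: "\<And>y. y \<in> tile A D \<Longrightarrow> norm y \<le> R2"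
      using compact_imp_bounded[OF compact_tile] by (auto simp: bounded_iff)
    have hR: "norm (h n) \<le> R1 + R2" for n
      using norm_triangle_ineq4[of "ob n" "(AT_inv A ^^ n) c"] R1[of n] R2[OF orbit_tile[OF x ran, of n]]
      by (simp add: orb h_def)
    define R3 where "R3 = (\<Sum>i<p. norm (\<theta> i))"
    have "range h \<subseteq> (\<lambda>(i, l). \<theta> i + real_vec l) ` ({..<p} \<times> {l. norm (real_vec l) \<le> R1 + R2 + R3})"
    proof safe
      fix n
      obtain l where l: "h n - \<theta> ((n + j) mod p) = real_vec l" using h_theta by blast
      have i: "(n + j) mod p < p" using p_pos by simp
      then have "norm (\<theta> ((n + j) mod p)) \<le> R3" unfolding R3_def by (intro member_le_sum) auto
      then have "norm (real_vec l) \<le> R1 + R2 + R3"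
        using norm_triangle_ineq4[of "h n" "\<theta> ((n + j) mod p)"] hR[of n] unfolding l[symmetric] by linarith
      moreover have "h n = \<theta> ((n + j) mod p) + real_vec l" using l by (simp add: algebra_simps)
      ultimately show "h n \<in> (\<lambda>(i, l). \<theta> i + real_vec l) ` ({..<p} \<times> {l. norm (real_vec l) \<le> R1 + R2 + R3})"
        using i by (intro image_eqI[of _ _ "((n + j) mod p, l)"]) auto
    qed
    then show ?thesis by (rule finite_subset) (intro finite_imageI finite_cartesian_product finite_bounded_lattice; simp)
  qed
  then have "\<not> inj h" using finite_imageD[of h UNIV] infinite_UNIV_nat by blast
  then obtain a b where ab: "a < b" "h a = h b" by (metis injI linorder_neqE_nat)
  define q where "q = b - a"
  have q: "0 < q" "b = q + a" using ab by (auto simp: q_def)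
  have dig_eq: "\<omega> m = \<omega> n" if "h m = h n" for m n
  proof (rule digit_eqI[OF \<omega>D \<omega>D])
    have "h m - \<theta> ((n + j) mod p) \<in> int_lattice" using h_theta[of n] that by simp
    from lattice_trans[OF lattice_commute[OF h_theta[of m]] this]
    have "(m + j) mod p = (n + j) mod p" by (rule cycle_eqI)
    then have e: "(Suc m + j) mod p = (Suc n + j) mod p" by (metis add_Suc mod_Suc_eq)
    have "h (Suc m) - h (Suc n) \<in> int_lattice"
      by (rule lattice_trans[OF h_theta[of "Suc m", unfolded e] lattice_commute[OF h_theta[of "Suc n"]]])
    then show "AT_inv A (real_vec (\<omega> m) - real_vec (\<omega> n)) \<in> int_lattice"
      using that by (simp add: h_step tau_def flip: AT_inv_diff)
  qed
  define h' where "h' = (\<lambda>n. h (a + n))"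
  define d' where "d' = (\<lambda>n. \<omega> (a + n))"
  have h'_per: "h' (n + q) = h' n" for n
  proof (induction n)
    case 0 show ?case using ab q by (simp add: h'_def add.commute)
  next
    case (Suc n) then show ?case using dig_eq[of "a + (n + q)" "a + n"] by (simp add: h'_def h_step)
  qed
  have mod_q: "f (n mod q) = f n" if "\<And>n. f (n + q) = f n" for f :: "nat \<Rightarrow> 'z" and n
  proof -
    have "f (m + t * q) = f m" for m t
      by (induction t) (simp_all add: that add.assoc[symmetric] add.commute[of q])
    from this[of "n mod q" "n div q"] show ?thesis by simp
  qed
  have d'_per: "d' (n + q) = d' n" for n
    using dig_eq[of "a + (n + q)" "a + n"] h'_per[of n] by (simp add: h'_def d'_def)
  have h'_step: "h' (Suc n) = tau A (d' n) (h' n)" for n by (simp add: h'_def d'_def h_step)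
  have d'D: "range d' \<subseteq> D" using \<omega>D by (auto simp: d'_def)
  have "cycle A D q h' d'"
    unfolding cycle_def using q d'D h'_step mod_q[of h', OF h'_per] by auto
  moreover have "h' ` {..<q} \<subseteq> {\<theta> j - real_vec k | j k. j < p} \<inter> tile A D"
  proof (intro subsetI IntI; elim imageE)
    fix y n assume y: "y = h' n"
    show "y \<in> tile A D" unfolding y using h'_step d'D h'_per q(1) by (rule periodic_point_in_tile)
    obtain l where "h' n - \<theta> ((a + n + j) mod p) = real_vec l" using h_theta unfolding h'_def by blast
    then have "y = \<theta> ((a + n + j) mod p) - real_vec (- l)"
      unfolding real_vec_minus y by (simp add: algebra_simps)
    moreover have "(a + n + j) mod p < p" using p_pos by simp
    ultimately show "y \<in> {\<theta> j - real_vec k | j k. j < p}" by blast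
  qed
  moreover have "\<omega> \<in> Omega_cycle D q d'"
    unfolding Omega_cycle_def using ran mod_q[of d', OF d'_per] by (auto simp: d'_def intro!: exI[of _ a])
  ultimately have "\<omega> \<in> Omega_tilde A D p \<theta>" unfolding Omega_tilde_def by blast
  with code show ?thesis by blast
qed

lemma Omega_tilde_range: "\<omega> \<in> Omega_tilde A D p \<theta> \<Longrightarrow> range \<omega> \<subseteq> D"
  by (auto simp: Omega_tilde_def Omega_cycle_def)

lemma Omega_tilde_cons:
  assumes "\<omega> \<in> Omega_tilde A D p \<theta>" "a \<in> D"
  shows "case_nat a \<omega> \<in> Omega_tilde A D p \<theta>"
proof -
  obtain q \<eta> m N where c: "cycle A D q \<eta> m"
      "\<eta> ` {..<q} \<subseteq> {\<theta> j - real_vec k | j k. j < p} \<inter> tile A D"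
    and w: "range \<omega> \<subseteq> D" "\<And>n. \<omega> (N + n) = m (n mod q)"
    using assms(1) unfolding Omega_tilde_def Omega_cycle_def by blast
  have "case_nat a \<omega> n \<in> D" for n using w(1) assms(2) by (cases n) auto
  moreover have "case_nat a \<omega> (Suc N + n) = m (n mod q)" for n using w(2) by simp
  ultimately have "case_nat a \<omega> \<in> Omega_cycle D q m" unfolding Omega_cycle_def by blast
  with c show ?thesis unfolding Omega_tilde_def by blast
qed

lemma orbit_cons: "orbit A (AT A x - real_vec a) (case_nat a \<omega>) (Suc n) = orbit A x \<omega> n"
  by (induction n) (simp_all add: tau_def)

text \<open>Prepending a digit shifts the torus sequence by one place, which undoes one application of the inverse of
\<open>A\<^sup>T\<close> and one step on the cycle.\<close>

lemma code_cons:
  assumes "code \<omega> k j"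
  defines "j' \<equiv> (j + p - 1) mod p"
  shows "\<exists>k'. code (case_nat a \<omega>) k' j' \<and>
    (\<forall>x. (AT A x - real_vec a) - \<theta> j' - real_vec k' = AT A (x - \<theta> j - real_vec k))"
proof -
  have j: "j < p" and j': "j' < p" "Suc j' mod p = j"
    using assms p_pos by (auto simp: code_def mod_Suc_eq)
  have "AT A (\<theta> j) - \<theta> j' \<in> int_lattice" using AT_cycle[of j'] j' by simp
  then have "AT A (\<theta> j) - \<theta> j' + AT A (real_vec k) - real_vec a \<in> int_lattice"
    by (rule lattice_intros(4)[OF lattice_intros(3)[OF _ lattice_AT[OF lattice_intros(1)]] lattice_intros(1)])
  then obtain k' where "AT A (\<theta> j) - \<theta> j' + AT A (real_vec k) - real_vec a = real_vec k'" by blast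
  then have k': "(AT A x - real_vec a) - \<theta> j' - real_vec k' = AT A (x - \<theta> j - real_vec k)" for x
    by (simp add: AT_diff AT_add algebra_simps)
  have "code (case_nat a \<omega>) k' j'"
  proof (rule codeI[OF j'(1), of "AT A 0 - real_vec a"])
    fix n
    show "orbit A (AT A 0 - real_vec a) (case_nat a \<omega>) n
        - solenoid_path (AT A 0 - real_vec a - \<theta> j' - real_vec k') j' n \<in> int_lattice"
    proof (cases n)
      case 0 then show ?thesis using j' by (simp add: solenoid_path_def)
    next
      case (Suc m)
      have "(Suc m + j') mod p = (m + j) mod p" using j'(2) by (metis add_Suc_shift mod_add_right_eq)
      then have path: "solenoid_path (AT A y) j' (Suc m) = solenoid_path y j m" for y
        by (simp add: solenoid_path_def funpow_swap1)
      have "orbit A 0 \<omega> m - solenoid_path (0 - \<theta> j - real_vec k) j m \<in> int_lattice"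
        using assms(1) unfolding code_def by blast
      then show ?thesis unfolding Suc k' orbit_cons path .
    qed
  qed
  with k' show ?thesis by blast
qed

end

section \<open>Linear change of variables for Lebesgue measure\<close>

lemma abs_det_involution:
  fixes h :: "real^'n \<Rightarrow> real^'n"
  assumes "linear h" "\<And>x. h (h x) = x"
  shows "\<bar>det (matrix h)\<bar> = 1"
proof -
  have "h \<circ> h = id" using assms(2) by auto
  then have "matrix h ** matrix h = mat 1"
    using matrix_compose[OF assms(1) assms(1)] by (simp add: matrix_id_mat_1)
  then have "det (matrix h) * det (matrix h) = 1" by (metis det_mul det_I)
  then show ?thesis by (auto simp: square_eq_1_iff)
qed

text \<open>The volume of a sheared box is known when the box starts at a nonnegative \<open>j\<close>-th coordinate; a
translation along the \<open>j\<close>-th axis reduces to this case.\<close>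

lemma shear_image_measure:
  fixes h :: "real^'n \<Rightarrow> real^'n" and i j :: 'n
  assumes ij: "i \<noteq> j" and h: "h = (\<lambda>x. \<chi> k. if k = i then x $ i + x $ j else x $ k)"
  shows "measure lebesgue (h ` cbox a b) = measure lebesgue (cbox a b)"
proof (cases "cbox a b = {}")
  case False
  \<comment> \<open>moves the lower corner to \<open>j\<close>-th coordinate \<open>0\<close>\<close>
  define v :: "real^'n" where "v = - (a $ j) *\<^sub>R axis j 1"
  have lin: "linear h" unfolding h by (rule linearI) (auto simp: vec_eq_iff algebra_simps)
  have shift: "cbox (v + a) (v + b) = (+) v ` cbox a b" by (simp add: cbox_translation)
  have "h ` cbox (v + a) (v + b) = (+) (h v) ` h ` cbox a b"
    unfolding shift image_image linear_add[OF lin] ..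
  then have "measure lebesgue (h ` cbox a b) = measure lebesgue (h ` cbox (v + a) (v + b))"
    by (simp add: measure_translation)
  also have "\<dots> = measure lebesgue (cbox (v + a) (v + b))"
    unfolding h
  proof (rule measure_shear_interval[OF ij])
    show "cbox (v + a) (v + b) \<noteq> {}" using False by (simp add: shift)
    show "0 \<le> (v + a) $ j" by (simp add: v_def axis_def)
  qed
  also have "\<dots> = measure lebesgue (cbox a b)" unfolding shift by (rule measure_translation)
  finally show ?thesis .
qed simp

lemma swap_image_measure:
  fixes h :: "real^'n \<Rightarrow> real^'n" and i j :: 'n
  assumes h: "h = (\<lambda>x. \<chi> k. x $ Transposition.transpose i j k)"
  shows "measure lebesgue (h ` cbox a b) = measure lebesgue (cbox a b)"
proof (cases "cbox a b = {}")
  case False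
  let ?t = "Transposition.transpose i j"
  have hh: "h (h x) = x" for x by (simp add: h vec_eq_iff)
  have mem: "h x \<in> cbox (h a) (h b)" if "x \<in> cbox a b" for x a b
    using that by (auto simp: h mem_box_cart)
  have img: "h ` cbox a b = cbox (h a) (h b)"
  proof (intro equalityI subsetI)
    fix y assume "y \<in> cbox (h a) (h b)"
    from mem[OF this] have "h y \<in> cbox a b" by (simp only: hh)
    then show "y \<in> h ` cbox a b" using hh[of y] by (metis imageI)
  qed (use mem in blast)
  moreover have "cbox (h a) (h b) \<noteq> {}" using False img by blast
  moreover have "(\<Prod>k\<in>UNIV. b $ ?t k - a $ ?t k) = (\<Prod>k\<in>UNIV. b $ k - a $ k)"
    by (rule prod.reindex_bij_betw[of ?t UNIV UNIV "\<lambda>k. b $ k - a $ k"]) simp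
  ultimately show ?thesis using False by (simp add: content_cbox_cart h)
qed simp

text \<open>Induction over elementary maps. The index type is unordered, so shears are not triangular
matrices; their determinant comes from a row operation, and that of a swap from
\<open>abs_det_involution\<close>.\<close>

lemma linear_image_measure:
  fixes f :: "real^'n \<Rightarrow> real^'n"
  assumes "linear f"
  shows "\<forall>S\<in>lmeasurable. f ` S \<in> lmeasurable \<and>
    measure lebesgue (f ` S) = \<bar>det (matrix f)\<bar> * measure lebesgue S"
proof (rule induct_linear_elementary[OF assms]; intro ballI)
  fix f g :: "real^'n \<Rightarrow> real^'n" and S :: "(real^'n) set"
  assume lin: "linear f" "linear g"
    and f: "\<forall>S\<in>lmeasurable. f ` S \<in> lmeasurable \<and> measure lebesgue (f ` S) = \<bar>det (matrix f)\<bar> * measure lebesgue S"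
    and g: "\<forall>S\<in>lmeasurable. g ` S \<in> lmeasurable \<and> measure lebesgue (g ` S) = \<bar>det (matrix g)\<bar> * measure lebesgue S"
    and S: "S \<in> lmeasurable"
  have img: "(f \<circ> g) ` S = f ` g ` S" by (simp add: image_comp)
  show "(f \<circ> g) ` S \<in> lmeasurable \<and>
      measure lebesgue ((f \<circ> g) ` S) = \<bar>det (matrix (f \<circ> g))\<bar> * measure lebesgue S"
    unfolding img matrix_compose[OF lin(2,1)] det_mul abs_mult using f g S by simp
next
  fix f :: "real^'n \<Rightarrow> real^'n" and i and S :: "(real^'n) set"
  assume lin: "linear f" and 0: "\<And>x. f x $ i = 0"
  have "\<not> surj f" using 0 by (metis one_index one_neq_zero surjE)
  then have inj: "\<not> inj f" using lin linear_injective_imp_surjective by blast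
  then have "det (matrix f) = 0" using det_nz_iff_inj[OF lin] by blast
  moreover have "negligible (f ` S)" by (rule negligible_linear_singular_image[OF lin inj])
  ultimately show "f ` S \<in> lmeasurable \<and> measure lebesgue (f ` S) = \<bar>det (matrix f)\<bar> * measure lebesgue S"
    by (simp add: negligible_iff_measure)
next
  fix c :: "'n \<Rightarrow> real" and S :: "(real^'n) set"
  assume S: "S \<in> lmeasurable"
  have "det (matrix (\<lambda>x :: real^'n. \<chi> i. c i * x $ i)) = prod c UNIV"
    by (subst det_diagonal) (simp_all add: matrix_def axis_def)
  then show "(\<lambda>x. \<chi> i. c i * x $ i) ` S \<in> lmeasurable \<and> measure lebesgue ((\<lambda>x. \<chi> i. c i * x $ i) ` S)
      = \<bar>det (matrix (\<lambda>x. \<chi> i. c i * x $ i))\<bar> * measure lebesgue S"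
    using measurable_stretch[OF S] measure_stretch[OF S] by simp
next
  fix m n :: 'n and S :: "(real^'n) set"
  assume S: "S \<in> lmeasurable"
  define h :: "real^'n \<Rightarrow> real^'n" where "h = (\<lambda>x. \<chi> i. x $ Transposition.transpose m n i)"
  have lin: "linear h" unfolding h_def by (rule linearI) (simp_all add: vec_eq_iff)
  have "\<bar>det (matrix h)\<bar> = 1"
    by (rule abs_det_involution[OF lin]) (simp add: h_def vec_eq_iff)
  then show "h ` S \<in> lmeasurable \<and> measure lebesgue (h ` S) = \<bar>det (matrix h)\<bar> * measure lebesgue S"
    using measure_linear_sufficient[OF lin S, of 1] swap_image_measure[OF h_def] by simp
next
  fix m n :: 'n and S :: "(real^'n) set"
  assume mn: "m \<noteq> n" and S: "S \<in> lmeasurable"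
  define h :: "real^'n \<Rightarrow> real^'n" where "h = (\<lambda>x. \<chi> i. if i = m then x $ m + x $ n else x $ i)"
  have lin: "linear h" unfolding h_def by (rule linearI) (auto simp: vec_eq_iff algebra_simps)
  have "matrix h = (\<chi> k. if k = m then row m (mat 1) + 1 *s row n (mat 1) else row k (mat 1))"
    by (auto simp: h_def vec_eq_iff matrix_def row_def mat_def axis_def)
  then have "det (matrix h) = 1" using det_row_operation[OF mn, where c = 1 and A = "mat 1 :: real^'n^'n"] by simp
  then show "h ` S \<in> lmeasurable \<and> measure lebesgue (h ` S) = \<bar>det (matrix h)\<bar> * measure lebesgue S"
    using measure_linear_sufficient[OF lin S, of 1] shear_image_measure[OF mn h_def] by simp
qed

lemma linear_inverse_measurable_lebesgue:
  fixes f g :: "real^'n \<Rightarrow> real^'n"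
  assumes g: "linear g" and gf: "\<And>x. g (f x) = x" and fg: "\<And>x. f (g x) = x"
  shows "f \<in> lebesgue \<rightarrow>\<^sub>M lebesgue"
proof (rule measurableI)
  fix S :: "(real^'n) set" assume "S \<in> sets lebesgue"
  then have "g ` S \<in> sets lebesgue"
    using linear_imp_differentiable_on[OF g] by (intro differentiable_image_in_sets_lebesgue) auto
  moreover have "f -` S \<inter> space lebesgue = g ` S"
    using gf fg by (auto simp: image_iff) metis
  ultimately show "f -` S \<inter> space lebesgue \<in> sets lebesgue" by simp
qed simp

text \<open>The density form transfers integrals and null sets at once, for all measurable functions.\<close>

lemma lebesgue_linear_density:
  fixes f g :: "real^'n \<Rightarrow> real^'n"
  assumes f: "linear f" and g: "linear g" and gf: "\<And>x. g (f x) = x" and fg: "\<And>x. f (g x) = x"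
  shows "lebesgue = density (distr lebesgue lebesgue f) (\<lambda>_. ennreal \<bar>det (matrix f)\<bar>)" (is "_ = ?D")
proof (rule measure_eqI)
  fix S :: "(real^'n) set" assume S: "S \<in> sets lebesgue"
  note fm = linear_inverse_measurable_lebesgue[OF g gf fg]
  define P where "P = f -` S"
  have PS: "f ` P = S" unfolding P_def using fg by (auto simp: image_iff) metis
  have SP: "g ` S = P" unfolding PS[symmetric] using gf by (simp add: image_image)
  have P: "P \<in> sets lebesgue" using measurable_sets[OF fm S] by (simp add: P_def)
  have "inj f" using gf by (metis injI)
  then have det: "\<bar>det (matrix f)\<bar> > 0" using det_nz_iff_inj[OF f] by simp
  have D: "emeasure ?D S = ennreal \<bar>det (matrix f)\<bar> * emeasure lebesgue P"
    using S fm by (simp add: emeasure_density nn_integral_cmult_indicator emeasure_distr P_def)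
  show "emeasure lebesgue S = emeasure ?D S"
  proof (cases "S \<in> lmeasurable")
    case True
    then have Pm: "P \<in> lmeasurable" using linear_image_measure[OF g] SP by blast
    then have "measure lebesgue S = \<bar>det (matrix f)\<bar> * measure lebesgue P"
      using linear_image_measure[OF f] PS by blast
    then show ?thesis
      unfolding D emeasure_eq_measure2[OF True] emeasure_eq_measure2[OF Pm] by (simp add: ennreal_mult)
  next
    case False
    then have "P \<notin> lmeasurable" using linear_image_measure[OF f] PS by blast
    then have "emeasure lebesgue P = \<infinity>" "emeasure lebesgue S = \<infinity>"
      using False P S by (simp_all add: fmeasurable_def flip: less_top del: emeasure_completion)
    then show ?thesis unfolding D using det by (simp add: ennreal_mult_top)
  qed
qed simp

lemma translation_measurable_lebesgue: "(\<lambda>x. c + x) \<in> lebesgue \<rightarrow>\<^sub>M (lebesgue :: ('a::euclidean_space) measure)"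
  using lebesgue_affine_measurable[of "\<lambda>_. 1" c] by (simp add: euclidean_representation)

lemma emeasure_lebesgue_vimage_translation:
  fixes S :: "('a::euclidean_space) set"
  assumes "S \<in> sets lebesgue"
  shows "emeasure lebesgue ((\<lambda>x. c + x) -` S) = emeasure lebesgue S"
proof -
  have "(\<lambda>x. c + x) -` S = (+) (- c) ` S" by (force simp: image_iff)
  then show ?thesis using emeasure_lebesgue_affine[of 1 "- c" S] by simp
qed

lemma sigma_finite_lebesgue: "sigma_finite_measure (lebesgue :: ('a::euclidean_space) measure)"
proof
  let ?A = "range (\<lambda>n. ball (0 :: 'a) (real n))"
  have "\<Union>?A = space lebesgue"
    by (auto simp: reals_Archimedean2)
  moreover have "emeasure lebesgue a \<noteq> \<infinity>" if "a \<in> ?A" for a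
    using that lmeasurable_ball by (auto simp: fmeasurable_def less_top simp del: emeasure_completion)
  ultimately show "\<exists>A. countable A \<and> A \<subseteq> sets (lebesgue :: 'a measure) \<and> \<Union>A = space lebesgue \<and>
      (\<forall>a\<in>A. emeasure lebesgue a \<noteq> \<infinity>)"
    by (intro exI[of _ ?A]) auto
qed

lemma AE_lebesgue_translation:
  fixes c :: "'a::euclidean_space"
  assumes "AE y in lebesgue. P y" shows "AE x in lebesgue. P (c + x)"
proof -
  obtain N where N: "N \<in> null_sets lebesgue" "{y. \<not> P y} \<subseteq> N"
    using assms by (auto simp: eventually_ae_filter)
  have "(\<lambda>x. c + x) -` N \<in> null_sets lebesgue"
    using N(1) emeasure_lebesgue_vimage_translation[of N c] measurable_sets[OF translation_measurable_lebesgue, of N c]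
    by (simp add: null_sets_def del: emeasure_completion)
  then show ?thesis by (rule AE_I') (use N(2) in auto)
qed

text \<open>Completeness of Lebesgue measure: modifying a function on a null set keeps it measurable.\<close>

lemma borel_measurable_lebesgue_on_AE:
  fixes f g :: "'a::euclidean_space \<Rightarrow> complex"
  assumes S: "S \<in> sets lebesgue" and f: "f \<in> borel_measurable (lebesgue_on S)"
    and ae: "AE x in lebesgue_on S. f x = g x"
  shows "g \<in> borel_measurable (lebesgue_on S)"
proof -
  have "(\<lambda>x. indicator S x *\<^sub>R f x) \<in> borel_measurable lebesgue"
    using f S by (simp add: borel_measurable_restrict_space_iff)
  moreover have "AE x in lebesgue. indicator S x *\<^sub>R f x = indicator S x *\<^sub>R g x"
    using ae S by (simp add: AE_restrict_space_iff) (auto elim!: eventually_mono simp: indicator_def)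
  ultimately have "(\<lambda>x. indicator S x *\<^sub>R g x) \<in> borel_measurable lebesgue" by (rule borel_measurable_AE)
  then show ?thesis using S by (simp add: borel_measurable_restrict_space_iff)
qed

section \<open>Products with a countable index set\<close>

lemma borel_measurable_pair_count_space_iff:
  assumes J: "countable J"
  shows "f \<in> borel_measurable (M \<Otimes>\<^sub>M count_space J) \<longleftrightarrow> (\<forall>j\<in>J. (\<lambda>x. f (x, j)) \<in> borel_measurable M)"
proof
  assume f: "f \<in> borel_measurable (M \<Otimes>\<^sub>M count_space J)"
  show "\<forall>j\<in>J. (\<lambda>x. f (x, j)) \<in> borel_measurable M"
    by (intro ballI measurable_compose[OF _ f] measurable_Pair) auto
next
  assume f: "\<forall>j\<in>J. (\<lambda>x. f (x, j)) \<in> borel_measurable M"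
  have "(\<lambda>z. f (fst z, snd z)) \<in> borel_measurable (M \<Otimes>\<^sub>M count_space J)"
  proof (rule measurable_compose_countable'[where f = "\<lambda>j z. f (fst z, j)" and g = snd, OF _ _ J])
    fix j assume "j \<in> J"
    then show "(\<lambda>z. f (fst z, j)) \<in> borel_measurable (M \<Otimes>\<^sub>M count_space J)"
      using f by (intro measurable_compose[OF measurable_fst]) auto
  qed simp
  then show "f \<in> borel_measurable (M \<Otimes>\<^sub>M count_space J)" by simp
qed

text \<open>A countable union of null layers is null. Conversely the layers of a null set are null, because
every index has mass \<open>1\<close>.\<close>

lemma AE_pair_count_space_iff:
  assumes J: "countable J"
  shows "(AE z in M \<Otimes>\<^sub>M count_space J. P z) \<longleftrightarrow> (\<forall>j\<in>J. AE x in M. P (x, j))"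
proof -
  interpret J: sigma_finite_measure "count_space J"
    by (rule sigma_finite_measure_count_space_countable[OF J])
  show ?thesis
  proof (intro iffI ballI)
    fix j assume ae: "AE z in M \<Otimes>\<^sub>M count_space J. P z" and j: "j \<in> J"
    from ae obtain N where N: "{z \<in> space (M \<Otimes>\<^sub>M count_space J). \<not> P z} \<subseteq> N"
        "emeasure (M \<Otimes>\<^sub>M count_space J) N = 0" "N \<in> sets (M \<Otimes>\<^sub>M count_space J)"
      by (rule AE_E)
    define N' where "N' = (\<lambda>x. (x, j)) -` N"
    have N'M: "N' \<in> sets M" unfolding N'_def using N(3) by (rule sets_Pair2)
    have "emeasure M N' = emeasure (M \<Otimes>\<^sub>M count_space J) (N' \<times> {j})"
      using N'M j by (subst J.emeasure_pair_measure_Times) auto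
    also have "\<dots> \<le> emeasure (M \<Otimes>\<^sub>M count_space J) N"
      using N(3) by (intro emeasure_mono) (auto simp: N'_def)
    finally have "N' \<in> null_sets M" using N(2) N'M by auto
    then show "AE x in M. P (x, j)"
      by (rule AE_I') (use N(1) j in \<open>auto simp: N'_def space_pair_measure\<close>)
  next
    assume "\<forall>j\<in>J. AE x in M. P (x, j)"
    then have "\<forall>j\<in>J. \<exists>N. N \<in> null_sets M \<and> {x \<in> space M. \<not> P (x, j)} \<subseteq> N"
      by (simp add: eventually_ae_filter Bex_def)
    from bchoice[OF this] obtain N where N: "\<And>j. j \<in> J \<Longrightarrow> N j \<in> null_sets M"
        "\<And>j. j \<in> J \<Longrightarrow> {x \<in> space M. \<not> P (x, j)} \<subseteq> N j"
      by blast
    have "(\<Union>j\<in>J. N j \<times> {j}) \<in> null_sets (M \<Otimes>\<^sub>M count_space J)"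
    proof (rule null_sets_UN'[OF J])
      fix j assume "j \<in> J"
      then show "N j \<times> {j} \<in> null_sets (M \<Otimes>\<^sub>M count_space J)"
        using N(1)[of j] by (auto simp: null_sets_def J.emeasure_pair_measure_Times)
    qed
    then show "AE z in M \<Otimes>\<^sub>M count_space J. P z"
      by (rule AE_I') (use N(2) in \<open>force simp: space_pair_measure\<close>)
  qed
qed

lemma emeasure_pair_count_space:
  assumes "sigma_finite_measure M" "countable J" "E \<in> sets (M \<Otimes>\<^sub>M count_space J)"
  shows "emeasure (M \<Otimes>\<^sub>M count_space J) E = (\<integral>\<^sup>+ j. emeasure M ((\<lambda>x. (x, j)) -` E) \<partial>count_space J)"
proof -
  interpret M: sigma_finite_measure M by fact
  interpret J: sigma_finite_measure "count_space J"
    by (rule sigma_finite_measure_count_space_countable[OF assms(2)])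
  interpret pair_sigma_finite M "count_space J" ..
  show ?thesis by (rule emeasure_pair_measure_alt2[OF assms(3)])
qed

section \<open>Classes of square-integrable functions\<close>

lemma borel_measurable_cnj [measurable (raw)]:
  "f \<in> borel_measurable M \<Longrightarrow> (\<lambda>x. cnj (f x)) \<in> borel_measurable M"
  by (rule borel_measurable_continuous_on[of cnj]) (simp_all add: continuous_on_cnj)

lemma L2_fun_measurable: "f \<in> L2_fun M \<Longrightarrow> f \<in> borel_measurable M"
  and L2_fun_integrable: "f \<in> L2_fun M \<Longrightarrow> integrable M (\<lambda>x. (norm (f x))\<^sup>2)"
  by (simp_all add: L2_fun_def)

lemma L2_fun_scale:
  assumes "f \<in> L2_fun M" shows "(\<lambda>x. c * f x) \<in> L2_fun M"
  using assms by (auto simp: L2_fun_def norm_mult power_mult_distrib intro!: borel_measurable_times)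

lemma L2_fun_add:
  assumes f: "f \<in> L2_fun M" and g: "g \<in> L2_fun M" shows "(\<lambda>x. f x + g x) \<in> L2_fun M"
proof -
  note [measurable] = L2_fun_measurable[OF f] L2_fun_measurable[OF g]
  have "integrable M (\<lambda>x. (norm (f x + g x))\<^sup>2)"
  proof (rule Bochner_Integration.integrable_bound)
    show "integrable M (\<lambda>x. 2 * (norm (f x))\<^sup>2 + 2 * (norm (g x))\<^sup>2)"
      using L2_fun_integrable[OF f] L2_fun_integrable[OF g] by simp
    have "(norm (a + b))\<^sup>2 \<le> 2 * (norm a)\<^sup>2 + 2 * (norm b)\<^sup>2" for a b :: complex
    proof -
      have "(norm (a + b))\<^sup>2 \<le> (norm a + norm b)\<^sup>2" by (intro power_mono norm_triangle_ineq) simp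
      also have "\<dots> \<le> 2 * (norm a)\<^sup>2 + 2 * (norm b)\<^sup>2"
        using sum_squares_bound[of "norm a" "norm b"] by (simp add: power2_sum)
      finally show ?thesis .
    qed
    then show "AE x in M. norm ((norm (f x + g x))\<^sup>2) \<le> norm (2 * (norm (f x))\<^sup>2 + 2 * (norm (g x))\<^sup>2)"
      by simp
  qed measurable
  then show ?thesis by (simp add: L2_fun_def)
qed

lemma L2_fun_cong_AE:
  assumes "f \<in> L2_fun M" "g \<in> borel_measurable M" "AE x in M. f x = g x"
  shows "g \<in> L2_fun M"
proof -
  have "integrable M (\<lambda>x. (norm (f x))\<^sup>2) \<longleftrightarrow> integrable M (\<lambda>x. (norm (g x))\<^sup>2)"
  proof (rule integrable_cong_AE)
    show "AE x in M. (norm (f x))\<^sup>2 = (norm (g x))\<^sup>2" using assms(3) by eventually_elim simp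
  qed (use assms L2_fun_measurable in measurable)
  then show ?thesis using assms by (simp add: L2_fun_def)
qed

lemma L2_class_eq_iff:
  assumes "f \<in> L2_fun M"
  shows "L2_class M f = L2_class M g \<longleftrightarrow> (AE x in M. f x = g x)"
proof
  assume "L2_class M f = L2_class M g"
  then have "f \<in> L2_class M g" using assms by (auto simp: L2_class_def)
  then show "AE x in M. f x = g x" by (simp add: L2_class_def)
next
  assume ae: "AE x in M. f x = g x"
  have "(AE x in M. h x = f x) \<longleftrightarrow> (AE x in M. h x = g x)" for h
    using ae by (intro iffI; elim AE_mp) (auto elim: eventually_mono)
  then show "L2_class M f = L2_class M g" by (simp add: L2_class_def)
qed

lemma L2_class_in_L2: "f \<in> L2_fun M \<Longrightarrow> L2_class M f \<in> L2 M"
  by (simp add: L2_def)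

lemma L2_rep_class:
  assumes "f \<in> L2_fun M"
  shows "L2_rep (L2_class M f) \<in> L2_fun M" "AE x in M. L2_rep (L2_class M f) x = f x"
proof -
  have "f \<in> L2_class M f" using assms by (simp add: L2_class_def)
  then have "L2_rep (L2_class M f) \<in> L2_class M f"
    unfolding L2_rep_def by (rule someI[of "\<lambda>h. h \<in> L2_class M f"])
  then show "L2_rep (L2_class M f) \<in> L2_fun M" "AE x in M. L2_rep (L2_class M f) x = f x"
    by (simp_all add: L2_class_def)
qed

lemma L2_cases:
  assumes "F \<in> L2 M" obtains f where "f \<in> L2_fun M" "F = L2_class M f"
  using assms by (auto simp: L2_def)

lemma L2_add_class:
  assumes f: "f \<in> L2_fun M" and g: "g \<in> L2_fun M"
  shows "L2_add M (L2_class M f) (L2_class M g) = L2_class M (\<lambda>x. f x + g x)"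
  unfolding L2_add_def
proof (subst L2_class_eq_iff)
  show "AE x in M. L2_rep (L2_class M f) x + L2_rep (L2_class M g) x = f x + g x"
    using L2_rep_class(2)[OF f] L2_rep_class(2)[OF g] by eventually_elim simp
qed (intro L2_fun_add L2_rep_class f g)

lemma L2_scale_class:
  assumes f: "f \<in> L2_fun M"
  shows "L2_scale M c (L2_class M f) = L2_class M (\<lambda>x. c * f x)"
  unfolding L2_scale_def
proof (subst L2_class_eq_iff)
  show "AE x in M. c * L2_rep (L2_class M f) x = c * f x"
    using L2_rep_class(2)[OF f] by eventually_elim simp
qed (intro L2_fun_scale L2_rep_class f)

lemma L2_inner_class:
  assumes f: "f \<in> L2_fun M" and g: "g \<in> L2_fun M"
  shows "L2_inner M (L2_class M f) (L2_class M g) = (LINT x|M. f x * cnj (g x))"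
  unfolding L2_inner_def
proof (rule integral_cong_AE)
  note [measurable] = L2_fun_measurable[OF f] L2_fun_measurable[OF g]
    L2_fun_measurable[OF L2_rep_class(1)[OF f]] L2_fun_measurable[OF L2_rep_class(1)[OF g]]
  show "(\<lambda>x. L2_rep (L2_class M f) x * cnj (L2_rep (L2_class M g) x)) \<in> borel_measurable M"
    "(\<lambda>x. f x * cnj (g x)) \<in> borel_measurable M" by measurable
  show "AE x in M. L2_rep (L2_class M f) x * cnj (L2_rep (L2_class M g) x) = f x * cnj (g x)"
    using L2_rep_class(2)[OF f] L2_rep_class(2)[OF g] by eventually_elim simp
qed

lemma L2_add_closed: "F \<in> L2 M \<Longrightarrow> G \<in> L2 M \<Longrightarrow> L2_add M F G \<in> L2 M"
  by (elim L2_cases) (simp add: L2_add_class L2_class_in_L2 L2_fun_add)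

lemma L2_scale_closed: "F \<in> L2 M \<Longrightarrow> L2_scale M c F \<in> L2 M"
  by (elim L2_cases) (simp add: L2_scale_class L2_class_in_L2 L2_fun_scale)

lemma L2_respects_fun: "L2_respects M N \<Phi> \<Longrightarrow> f \<in> L2_fun M \<Longrightarrow> \<Phi> f \<in> L2_fun N"
  by (simp add: L2_respects_def)

lemma L2_respects_AE:
  "L2_respects M N \<Phi> \<Longrightarrow> f \<in> L2_fun M \<Longrightarrow> g \<in> L2_fun M \<Longrightarrow> AE x in M. f x = g x \<Longrightarrow>
    AE y in N. \<Phi> f y = \<Phi> g y"
  by (simp add: L2_respects_def)

section \<open>Unitary maps\<close>

lemma L2_iso_cong:
  assumes "L2_iso M N S" "\<And>F. F \<in> L2 M \<Longrightarrow> T F = S F"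
  shows "L2_iso M N T"
  using assms bij_betw_cong[of "L2 M" T S "L2 N"]
  unfolding L2_iso_def by (simp add: L2_add_closed L2_scale_closed)

lemma L2_iso_in: "L2_iso M N T \<Longrightarrow> F \<in> L2 M \<Longrightarrow> T F \<in> L2 N"
  unfolding L2_iso_def by (blast dest: bij_betwE)

lemma L2_iso_id: "L2_iso M M (\<lambda>F. F)"
  by (simp add: L2_iso_def bij_betw_def)

lemma L2_iso_comp:
  assumes S: "L2_iso M N S" and T: "L2_iso N P T"
  shows "L2_iso M P (\<lambda>F. T (S F))"
  using bij_betw_trans[of S "L2 M" "L2 N" T "L2 P"] S T L2_iso_in[OF S]
  by (simp add: L2_iso_def o_def)

lemma L2_iso_inv:
  assumes T: "L2_iso M N T"
  shows "L2_iso N M (inv_into (L2 M) T)"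
proof -
  let ?R = "inv_into (L2 M) T"
  have bij: "bij_betw T (L2 M) (L2 N)" using T by (simp add: L2_iso_def)
  have R: "?R (T F) = F" if "F \<in> L2 M" for F using bij that by (simp add: bij_betw_inv_into_left)
  have ex: "\<exists>F'\<in>L2 M. F = T F'" if "F \<in> L2 N" for F
    using bij that by (auto simp: bij_betw_def)
  show ?thesis
    unfolding L2_iso_def
  proof (intro conjI ballI allI bij_betw_inv_into[OF bij])
    fix F G assume "F \<in> L2 N" "G \<in> L2 N"
    then obtain F' G' where *: "F' \<in> L2 M" "F = T F'" "G' \<in> L2 M" "G = T G'" using ex by meson
    then have "L2_add N F G = T (L2_add M F' G')" using T by (simp add: L2_iso_def)
    then show "?R (L2_add N F G) = L2_add M (?R F) (?R G)" using * by (simp add: R L2_add_closed)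
    show "L2_inner M (?R F) (?R G) = L2_inner N F G" using * T by (simp add: R L2_iso_def)
  next
    fix c F assume "F \<in> L2 N"
    then obtain F' where *: "F' \<in> L2 M" "F = T F'" using ex by meson
    then have "L2_scale N c F = T (L2_scale M c F')" using T by (simp add: L2_iso_def)
    then show "?R (L2_scale N c F) = L2_scale M c (?R F)" using * by (simp add: R L2_scale_closed)
  qed
qed

lemma L2_iso_conjugate:
  assumes S: "L2_iso M N S" and T: "L2_iso M M T"
    and eq: "\<And>F. F \<in> L2 M \<Longrightarrow> S (T F) = T' (S F)"
  shows "L2_iso N N T'"
proof (rule L2_iso_cong[OF L2_iso_comp[OF L2_iso_inv[OF S] L2_iso_comp[OF T S]]])
  fix G assume G: "G \<in> L2 N"
  have "inv_into (L2 M) S G \<in> L2 M" by (rule L2_iso_in[OF L2_iso_inv[OF S] G])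
  moreover have "S (inv_into (L2 M) S G) = G"
    using S by (intro bij_betw_inv_into_right[OF _ G]) (simp add: L2_iso_def)
  ultimately show "T' G = S (T (inv_into (L2 M) S G))" using eq by simp
qed

text \<open>Injectivity comes from preservation of the inner product, applied to the difference of two functions.\<close>

lemma L2_iso_lift:
  assumes resp: "L2_respects M N \<Phi>"
    and add: "\<And>f g. f \<in> L2_fun M \<Longrightarrow> g \<in> L2_fun M \<Longrightarrow> AE y in N. \<Phi> (\<lambda>x. f x + g x) y = \<Phi> f y + \<Phi> g y"
    and scale: "\<And>c f. f \<in> L2_fun M \<Longrightarrow> AE y in N. \<Phi> (\<lambda>x. c * f x) y = c * \<Phi> f y"
    and inner: "\<And>f g. f \<in> L2_fun M \<Longrightarrow> g \<in> L2_fun M \<Longrightarrow>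
      (LINT y|N. \<Phi> f y * cnj (\<Phi> g y)) = (LINT x|M. f x * cnj (g x))"
    and surj: "\<And>h. h \<in> L2_fun N \<Longrightarrow> \<exists>f\<in>L2_fun M. AE y in N. \<Phi> f y = h y"
  shows "L2_iso M N (L2_lift M N \<Phi>)"
proof -
  note lift = L2_lift_class[OF resp]
  note in_N = L2_respects_fun[OF resp]
  have inj: "AE x in M. f x = g x" if f: "f \<in> L2_fun M" and g: "g \<in> L2_fun M"
    and eq: "AE y in N. \<Phi> f y = \<Phi> g y" for f g
  proof -
    define d where "d = (\<lambda>x. f x + (-1) * g x)"
    have d: "d \<in> L2_fun M" unfolding d_def by (intro L2_fun_add L2_fun_scale f g)
    have "AE y in N. \<Phi> d y * cnj (\<Phi> d y) = 0"
      using add[OF f L2_fun_scale[OF g, of "-1"]] scale[OF g, of "-1"] eq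
      unfolding d_def by eventually_elim simp
    then have "(LINT y|N. \<Phi> d y * cnj (\<Phi> d y)) = 0" by (rule integral_eq_zero_AE)
    then have "(LINT x|M. complex_of_real ((norm (d x))\<^sup>2)) = 0"
      using inner[OF d d] by (simp only: complex_norm_square)
    then have "(LINT x|M. (norm (d x))\<^sup>2) = 0"
      by (simp only: integral_complex_of_real of_real_eq_0_iff)
    then have "AE x in M. (norm (d x))\<^sup>2 = 0"
      using integral_nonneg_eq_0_iff_AE[OF L2_fun_integrable[OF d]] by simp
    then show ?thesis by eventually_elim (simp add: d_def)
  qed
  have "bij_betw (L2_lift M N \<Phi>) (L2 M) (L2 N)"
  proof (rule bij_betwI')
    fix F G assume "F \<in> L2 M" "G \<in> L2 M"
    then obtain f g where *: "f \<in> L2_fun M" "F = L2_class M f" "g \<in> L2_fun M" "G = L2_class M g"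
      by (elim L2_cases)
    then show "(L2_lift M N \<Phi> F = L2_lift M N \<Phi> G) = (F = G)"
      using inj[of f g] L2_respects_AE[OF resp, of f g] by (auto simp: lift L2_class_eq_iff in_N)
  next
    fix F assume "F \<in> L2 M"
    then show "L2_lift M N \<Phi> F \<in> L2 N" by (elim L2_cases) (simp add: lift L2_class_in_L2 in_N)
  next
    fix H assume "H \<in> L2 N"
    then obtain h where h: "h \<in> L2_fun N" "H = L2_class N h" by (elim L2_cases)
    then obtain f where f: "f \<in> L2_fun M" "AE y in N. \<Phi> f y = h y" using surj by blast
    then have "H = L2_lift M N \<Phi> (L2_class M f)"
      using L2_class_eq_iff[OF in_N[OF f(1)], of h] by (simp add: h(2) lift)
    then show "\<exists>F\<in>L2 M. H = L2_lift M N \<Phi> F" using L2_class_in_L2[OF f(1)] by blast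
  qed
  moreover have "L2_lift M N \<Phi> (L2_add M F G) = L2_add N (L2_lift M N \<Phi> F) (L2_lift M N \<Phi> G)
      \<and> L2_inner N (L2_lift M N \<Phi> F) (L2_lift M N \<Phi> G) = L2_inner M F G"
    if F: "F \<in> L2 M" and G: "G \<in> L2 M" for F G
  proof -
    obtain f where f: "f \<in> L2_fun M" "F = L2_class M f" using F by (rule L2_cases)
    obtain g where g: "g \<in> L2_fun M" "G = L2_class M g" using G by (rule L2_cases)
    from f g show ?thesis
      by (simp add: lift in_N L2_add_class L2_inner_class L2_fun_add L2_class_eq_iff add inner)
  qed
  moreover have "L2_lift M N \<Phi> (L2_scale M c F) = L2_scale N c (L2_lift M N \<Phi> F)" if F: "F \<in> L2 M" for c F
  proof -
    obtain f where "f \<in> L2_fun M" "F = L2_class M f" using F by (rule L2_cases)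
    then show ?thesis by (simp add: lift in_N L2_scale_class L2_fun_scale L2_class_eq_iff scale)
  qed
  ultimately show ?thesis by (simp add: L2_iso_def)
qed

text \<open>All operators in question except \<open>f \<mapsto> f \<circ> \<rho>\<^sup>-\<^sup>1\<close> have the form \<open>f \<mapsto> w * (f \<circ> \<Psi>)\<close>, where the
constant modulus \<open>c\<close> of \<open>w\<close> compensates the factor by which \<open>\<Psi>\<close> distorts the measure.\<close>

lemma weighted_composition:
  fixes \<Phi> :: "('a \<Rightarrow> complex) \<Rightarrow> 'b \<Rightarrow> complex" and c :: real
  assumes \<Psi>: "\<Psi> \<in> N \<rightarrow>\<^sub>M M" and w: "w \<in> borel_measurable N"
    and norm_w: "\<And>y. y \<in> space N \<Longrightarrow> norm (w y) = c" and c: "0 < c"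
    and M: "M = density (distr N M \<Psi>) (\<lambda>_. ennreal (c\<^sup>2))"
    and \<Phi>: "\<And>f y. y \<in> space N \<Longrightarrow> \<Phi> f y = w y * f (\<Psi> y)"
  shows "L2_respects M N \<Phi>"
    and "\<And>f g. f \<in> L2_fun M \<Longrightarrow> g \<in> L2_fun M \<Longrightarrow>
      (LINT y|N. \<Phi> f y * cnj (\<Phi> g y)) = (LINT x|M. f x * cnj (g x))"
proof -
  note [measurable] = \<Psi> w
  have AE_M: "AE y in N. P (\<Psi> y)" if "AE x in M. P x" for P
  proof -
    have "AE x in density (distr N M \<Psi>) (\<lambda>_. ennreal (c\<^sup>2)). P x"
      unfolding M[symmetric] by (rule that)
    then have "AE x in distr N M \<Psi>. P x" using c by (simp add: AE_density)
    then show ?thesis by (rule AE_distrD[OF \<Psi>])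
  qed
  have meas: "\<Phi> f \<in> borel_measurable N" if [measurable]: "f \<in> borel_measurable M" for f
  proof -
    have "(\<lambda>y. w y * f (\<Psi> y)) \<in> borel_measurable N" by measurable
    then show ?thesis by (subst measurable_cong[OF \<Phi>])
  qed
  show "L2_respects M N \<Phi>"
    unfolding L2_respects_def
  proof (intro conjI ballI impI)
    fix f assume f: "f \<in> L2_fun M"
    note [measurable] = L2_fun_measurable[OF f]
    have "integrable (density (distr N M \<Psi>) (\<lambda>_. ennreal (c\<^sup>2))) (\<lambda>x. (norm (f x))\<^sup>2)"
      unfolding M[symmetric] by (rule L2_fun_integrable[OF f])
    then have int: "integrable N (\<lambda>y. c\<^sup>2 *\<^sub>R (norm (f (\<Psi> y)))\<^sup>2)"
      by (simp add: integrable_density integrable_distr_eq)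
    have eq: "c\<^sup>2 *\<^sub>R (norm (f (\<Psi> y)))\<^sup>2 = (norm (\<Phi> f y))\<^sup>2" if "y \<in> space N" for y
      by (simp add: \<Phi>[OF that] norm_mult norm_w[OF that] power_mult_distrib)
    have "integrable N (\<lambda>y. c\<^sup>2 *\<^sub>R (norm (f (\<Psi> y)))\<^sup>2) \<longleftrightarrow> integrable N (\<lambda>y. (norm (\<Phi> f y))\<^sup>2)"
      by (rule Bochner_Integration.integrable_cong[OF refl]) (rule eq)
    with int have "integrable N (\<lambda>y. (norm (\<Phi> f y))\<^sup>2)" by blast
    then show "\<Phi> f \<in> L2_fun N" using meas by (simp add: L2_fun_def)
  next
    fix f g :: "'a \<Rightarrow> complex" assume "AE x in M. f x = g x"
    from AE_M[OF this] AE_space show "AE y in N. \<Phi> f y = \<Phi> g y"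
      by eventually_elim (simp add: \<Phi>)
  qed
  fix f g assume f: "f \<in> L2_fun M" and g: "g \<in> L2_fun M"
  note [measurable] = L2_fun_measurable[OF f] L2_fun_measurable[OF g]
  have "(LINT x|M. f x * cnj (g x)) =
      (LINT x|density (distr N M \<Psi>) (\<lambda>_. ennreal (c\<^sup>2)). f x * cnj (g x))"
    unfolding M[symmetric] ..
  also have "\<dots> = (LINT y|N. c\<^sup>2 *\<^sub>R (f (\<Psi> y) * cnj (g (\<Psi> y))))"
    by (subst integral_density) (simp_all add: integral_distr)
  also have "\<dots> = (LINT y|N. \<Phi> f y * cnj (\<Phi> g y))"
  proof (rule Bochner_Integration.integral_cong[OF refl])
    fix y assume y: "y \<in> space N"
    have "w y * cnj (w y) = complex_of_real (c\<^sup>2)"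
      using norm_w[OF y] by (metis complex_norm_square)
    moreover have "\<Phi> f y * cnj (\<Phi> g y) = (w y * cnj (w y)) * (f (\<Psi> y) * cnj (g (\<Psi> y)))"
      by (simp add: \<Phi>[OF y] mult.assoc mult.left_commute)
    ultimately show "c\<^sup>2 *\<^sub>R (f (\<Psi> y) * cnj (g (\<Psi> y))) = \<Phi> f y * cnj (\<Phi> g y)"
      by (simp only: scaleR_conv_of_real)
  qed
  finally show "(LINT y|N. \<Phi> f y * cnj (\<Phi> g y)) = (LINT x|M. f x * cnj (g x))" by simp
qed

text \<open>A measurable preimage suffices for surjectivity: the isometry identity forces it to be square-integrable.\<close>

lemma L2_iso_weighted_composition:
  fixes \<Phi> :: "('a \<Rightarrow> complex) \<Rightarrow> 'b \<Rightarrow> complex" and c :: real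
  assumes \<Psi>: "\<Psi> \<in> N \<rightarrow>\<^sub>M M" and w: "w \<in> borel_measurable N"
    and norm_w: "\<And>y. y \<in> space N \<Longrightarrow> norm (w y) = c" and c: "0 < c"
    and M: "M = density (distr N M \<Psi>) (\<lambda>_. ennreal (c\<^sup>2))"
    and \<Phi>: "\<And>f y. y \<in> space N \<Longrightarrow> \<Phi> f y = w y * f (\<Psi> y)"
    and surj: "\<And>h. h \<in> L2_fun N \<Longrightarrow> \<exists>f\<in>borel_measurable M. AE y in N. \<Phi> f y = h y"
  shows "L2_iso M N (L2_lift M N \<Phi>)"
    and "\<And>h. h \<in> L2_fun N \<Longrightarrow> \<exists>f\<in>L2_fun M. AE y in N. \<Phi> f y = h y"
proof -
  note wc = weighted_composition[where \<Psi> = \<Psi> and \<Phi> = \<Phi> and w = w, OF \<Psi> w norm_w c M \<Phi>]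
  note [measurable] = \<Psi> w
  show ex: "\<exists>f\<in>L2_fun M. AE y in N. \<Phi> f y = h y" if h: "h \<in> L2_fun N" for h
  proof -
    obtain f where [measurable]: "f \<in> borel_measurable M" and ae: "AE y in N. \<Phi> f y = h y"
      using surj[OF h] by blast
    note [measurable] = L2_fun_measurable[OF h]
    have "integrable N (\<lambda>y. c\<^sup>2 *\<^sub>R (norm (f (\<Psi> y)))\<^sup>2) \<longleftrightarrow> integrable N (\<lambda>y. (norm (h y))\<^sup>2)"
    proof (rule integrable_cong_AE)
      show "AE y in N. c\<^sup>2 *\<^sub>R (norm (f (\<Psi> y)))\<^sup>2 = (norm (h y))\<^sup>2"
        using ae AE_space
      proof eventually_elim
        fix y assume y: "\<Phi> f y = h y" "y \<in> space N"
        show "c\<^sup>2 *\<^sub>R (norm (f (\<Psi> y)))\<^sup>2 = (norm (h y))\<^sup>2"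
          unfolding y(1)[symmetric] \<Phi>[OF y(2)] by (simp add: norm_mult norm_w[OF y(2)] power_mult_distrib)
      qed
    qed measurable
    then have "integrable (density (distr N M \<Psi>) (\<lambda>_. ennreal (c\<^sup>2))) (\<lambda>x. (norm (f x))\<^sup>2)"
      using L2_fun_integrable[OF h] by (simp add: integrable_density integrable_distr_eq)
    then have "f \<in> L2_fun M" unfolding M[symmetric] by (simp add: L2_fun_def)
    with ae show ?thesis by blast
  qed
  show "L2_iso M N (L2_lift M N \<Phi>)"
  proof (rule L2_iso_lift[OF wc(1)])
    fix f g :: "'a \<Rightarrow> complex"
    show "AE y in N. \<Phi> (\<lambda>x. f x + g x) y = \<Phi> f y + \<Phi> g y"
      using AE_space by eventually_elim (simp add: \<Phi> distrib_left)
    show "AE y in N. \<Phi> (\<lambda>x. a * f x) y = a * \<Phi> f y" for a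
      using AE_space by eventually_elim (simp add: \<Phi>)
  qed (use wc(2) ex in blast)+
qed

lemma L2_lift_extensional: "L2_lift M N \<Phi> \<in> extensional (L2 M)"
  by (simp add: L2_lift_def)

lemma L2_lift_lift_class:
  assumes "L2_respects M N \<Phi>" "L2_respects N P \<Phi>'" "f \<in> L2_fun M"
  shows "L2_lift N P \<Phi>' (L2_lift M N \<Phi> (L2_class M f)) = L2_class P (\<Phi>' (\<Phi> f))"
  using assms by (simp add: L2_lift_class L2_respects_fun)

lemma L2_lift_commuteI:
  assumes "L2_respects M N \<Phi>" "L2_respects N P \<Phi>'" "L2_respects M N' \<Psi>" "L2_respects N' P \<Psi>'"
    and "f \<in> L2_fun M" and "AE y in P. \<Phi>' (\<Phi> f) y = \<Psi>' (\<Psi> f) y"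
  shows "L2_lift N P \<Phi>' (L2_lift M N \<Phi> (L2_class M f)) = L2_lift N' P \<Psi>' (L2_lift M N' \<Psi> (L2_class M f))"
proof -
  have "\<Phi>' (\<Phi> f) \<in> L2_fun P" using assms by (blast intro: L2_respects_fun)
  then show ?thesis using assms by (simp add: L2_lift_lift_class L2_class_eq_iff)
qed

section \<open>The group \<open>G\<^sub>A\<close> and its representations\<close>

locale invertible_matrix =
  fixes A :: "int^'n^'n"
  assumes inv_A: "invertible (real_mat A)"
begin

lemma real_mat_cancel:
  "real_mat A *v (matrix_inv (real_mat A) *v v) = v"
  "matrix_inv (real_mat A) *v (real_mat A *v v) = v"
proof -
  have "real_mat A ** matrix_inv (real_mat A) = mat 1 \<and> matrix_inv (real_mat A) ** real_mat A = mat 1"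
    using inv_A unfolding matrix_inv_def invertible_def by (rule someI_ex)
  then show "real_mat A *v (matrix_inv (real_mat A) *v v) = v"
    "matrix_inv (real_mat A) *v (real_mat A *v v) = v"
    by (simp_all add: matrix_vector_mul_assoc)
qed

lemma A_powi_0: "A_powi A 0 v = v"
  by (simp add: A_powi_def)

lemma A_powi_succ: "A_powi A (i + 1) v = real_mat A *v A_powi A i v"
proof (cases "0 \<le> i")
  case True
  then have "nat (i + 1) = Suc (nat i)" by simp
  then show ?thesis using True by (simp add: A_powi_def)
next
  case False
  define m where "m = nat (- (i + 1))"
  have m: "nat (- i) = Suc m" using False by (simp add: m_def)
  have "A_powi A (i + 1) v = ((\<lambda>v. matrix_inv (real_mat A) *v v) ^^ m) v"
    using False by (cases "i = -1") (simp_all add: A_powi_def m_def)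
  then show ?thesis using False by (simp add: A_powi_def m real_mat_cancel)
qed

lemma A_powi_pred: "A_powi A (i - 1) v = matrix_inv (real_mat A) *v A_powi A i v"
  using A_powi_succ[of "i - 1" v] by (simp add: real_mat_cancel)

lemma A_powi_A_powi: "A_powi A i (A_powi A j v) = A_powi A (i + j) v"
proof (induction i rule: int_induct[where k = 0])
  case base show ?case by (simp add: A_powi_0)
next
  case (step1 i)
  have "i + 1 + j = (i + j) + 1" by simp
  then show ?case using step1 by (simp only: A_powi_succ)
next
  case (step2 i)
  have "i - 1 + j = (i + j) - 1" by simp
  then show ?case using step2 by (simp only: A_powi_pred)
qed

lemma A_powi_add_right: "A_powi A i (v + w) = A_powi A i v + A_powi A i w"
proof (induction i rule: int_induct[where k = 0])
  case base show ?case by (simp add: A_powi_0)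
next
  case (step1 i) then show ?case by (simp add: A_powi_succ matrix_vector_right_distrib)
next
  case (step2 i) then show ?case by (simp add: A_powi_pred matrix_vector_right_distrib)
qed

lemma A_powi_zero_right: "A_powi A i 0 = 0"
  using A_powi_add_right[of i 0 0] by simp

lemma A_powi_minus_right: "A_powi A i (- v) = - A_powi A i v"
  using A_powi_add_right[of i v "- v"] by (simp add: A_powi_zero_right minus_unique)

lemma A_powi_int: "A_powi A (int n) (real_vec k) = real_vec (((*v) A ^^ n) k)"
proof (induction n)
  case 0 show ?case by (simp add: A_powi_0)
next
  case (Suc n)
  have "A_powi A (int (Suc n)) (real_vec k) = real_mat A *v real_vec (((*v) A ^^ n) k)"
    using A_powi_succ[of "int n"] Suc by (simp add: add.commute)
  also have "\<dots> = real_vec (A *v ((*v) A ^^ n) k)"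
    by (simp add: vec_eq_iff matrix_vector_mult_def)
  finally show ?case by simp
qed

lemma A_powi_cancel: "A_powi A (- i) (A_powi A i v) = v" "A_powi A i (A_powi A (- i) v) = v"
  by (simp_all add: A_powi_A_powi A_powi_0)

definition ZA :: "(real^'n) set" where
  "ZA = {A_powi A (- int j) (real_vec k) | j k. True}"

lemma ZA_I: "A_powi A i (real_vec k) \<in> ZA"
proof (cases "i \<le> 0")
  case True
  then obtain n where "i = - int n" by (metis int_nat_eq minus_minus neg_0_le_iff_le)
  then show ?thesis unfolding ZA_def by blast
next
  case False
  then have "A_powi A i (real_vec k) = A_powi A (- int 0) (real_vec (((*v) A ^^ nat i) k))"
    using A_powi_int[of "nat i" k] by (simp add: A_powi_0)
  then show ?thesis unfolding ZA_def by blast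
qed

lemma ZA_common:
  assumes "b \<in> ZA" "c \<in> ZA"
  obtains i k l where "b = A_powi A i (real_vec k)" "c = A_powi A i (real_vec l)"
proof -
  obtain m k n l where b: "b = A_powi A (- int m) (real_vec k)" and c: "c = A_powi A (- int n) (real_vec l)"
    using assms unfolding ZA_def by blast
  show thesis
  proof
    show "b = A_powi A (- int (m + n)) (real_vec (((*v) A ^^ n) k))"
      unfolding b A_powi_int[symmetric] A_powi_A_powi by simp
    show "c = A_powi A (- int (m + n)) (real_vec (((*v) A ^^ m) l))"
      unfolding c A_powi_int[symmetric] A_powi_A_powi by simp
  qed
qed

lemma ZA_A_powi: assumes "b \<in> ZA" shows "A_powi A i b \<in> ZA"
proof -
  obtain j k where b: "b = A_powi A (- int j) (real_vec k)" using assms unfolding ZA_def by blast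
  show ?thesis unfolding b A_powi_A_powi by (rule ZA_I)
qed

lemma ZA_add: assumes "b \<in> ZA" "c \<in> ZA" shows "b + c \<in> ZA"
proof -
  obtain i k l where b: "b = A_powi A i (real_vec k)" and c: "c = A_powi A i (real_vec l)"
    using assms by (rule ZA_common)
  have "real_vec k + real_vec l = real_vec (k + l)" by (simp add: vec_eq_iff)
  then have "b + c = A_powi A i (real_vec (k + l))" unfolding b c by (simp only: flip: A_powi_add_right)
  then show ?thesis using ZA_I by (simp only:)
qed

lemma ZA_real_vec: "real_vec k \<in> ZA"
  using ZA_I[of 0 k] by (simp add: A_powi_0)

lemma ZA_0: "0 \<in> ZA"
  using ZA_real_vec[of 0] by (simp add: zero_vec_def)

lemma ZA_minus: assumes "b \<in> ZA" shows "- b \<in> ZA"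
proof -
  obtain j k where b: "b = A_powi A (- int j) (real_vec k)" using assms unfolding ZA_def by blast
  have "- real_vec k = real_vec (- k)" by (simp add: vec_eq_iff)
  then have "- b = A_powi A (- int j) (real_vec (- k))" unfolding b by (simp only: flip: A_powi_minus_right)
  then show ?thesis using ZA_I by (simp only:)
qed

lemma G_A_simps:
  "carrier (G_A A) = UNIV \<times> ZA"
  "(j, b) \<otimes>\<^bsub>G_A A\<^esub> (k, c) = (j + k, A_powi A j c + b)"
  "\<one>\<^bsub>G_A A\<^esub> = (0, 0)"
  by (simp_all add: G_A_def ZA_def)

lemma group_G_A: "group (G_A A)"
proof (rule groupI)
  fix x y assume "x \<in> carrier (G_A A)" "y \<in> carrier (G_A A)"
  then show "x \<otimes>\<^bsub>G_A A\<^esub> y \<in> carrier (G_A A)"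
    by (cases x; cases y) (simp add: G_A_simps ZA_add ZA_A_powi)
next
  fix x y z assume "x \<in> carrier (G_A A)" "y \<in> carrier (G_A A)" "z \<in> carrier (G_A A)"
  show "x \<otimes>\<^bsub>G_A A\<^esub> y \<otimes>\<^bsub>G_A A\<^esub> z = x \<otimes>\<^bsub>G_A A\<^esub> (y \<otimes>\<^bsub>G_A A\<^esub> z)"
    by (cases x; cases y; cases z) (simp add: G_A_simps A_powi_add_right A_powi_A_powi)
next
  fix x assume "x \<in> carrier (G_A A)"
  then show "\<exists>y\<in>carrier (G_A A). y \<otimes>\<^bsub>G_A A\<^esub> x = \<one>\<^bsub>G_A A\<^esub>"
    by (cases x, intro bexI[of _ "(- fst x, - A_powi A (- fst x) (snd x))"])
      (auto simp: G_A_simps intro!: ZA_minus ZA_A_powi)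
qed (auto simp: G_A_simps ZA_0 A_powi_0)

lemma G_A_pow: "(1, 0) [^]\<^bsub>G_A A\<^esub> (i :: int) = (i, 0)"
proof -
  interpret G: group "G_A A" by (rule group_G_A)
  have u: "(1, 0) \<in> carrier (G_A A)" by (simp add: G_A_simps ZA_0)
  show ?thesis
  proof (induction i rule: int_induct[where k = 0])
    case base show ?case by (simp add: G_A_simps)
  next
    case (step1 i)
    then show ?case
      using G.int_pow_mult[OF u, of i 1] u by (simp add: G_A_simps A_powi_zero_right)
  next
    case (step2 i)
    have "inv\<^bsub>G_A A\<^esub> (1, 0) = (-1, 0)"
      by (rule G.inv_equality) (auto simp: G_A_simps A_powi_zero_right ZA_0)
    then have "(1, 0) [^]\<^bsub>G_A A\<^esub> (-1 :: int) = (-1, 0)"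
      using u by (simp add: G.int_pow_neg)
    then show ?case
      using G.int_pow_mult[OF u, of i "-1"] step2 by (simp add: G_A_simps A_powi_zero_right)
  qed
qed

text \<open>The element \<open>(j, A\<^sup>i k)\<close> is a word in the generators, which gives uniqueness and dictates the
definition used for existence.\<close>

lemma G_A_factor:
  assumes "b = A_powi A i (real_vec k)"
  shows "(j, b) = (1, 0) [^]\<^bsub>G_A A\<^esub> i \<otimes>\<^bsub>G_A A\<^esub> (0, real_vec k) \<otimes>\<^bsub>G_A A\<^esub> (1, 0) [^]\<^bsub>G_A A\<^esub> (j - i)"
  unfolding G_A_pow G_A_simps A_powi_zero_right assms by simp

lemma G_A_hom_unique:
  assumes "group K" "\<pi> \<in> hom (G_A A) K" "\<pi>' \<in> hom (G_A A) K"
    and u: "\<pi> (1, 0) = \<pi>' (1, 0)" and t: "\<And>k. \<pi> (0, real_vec k) = \<pi>' (0, real_vec k)"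
    and g: "g \<in> carrier (G_A A)"
  shows "\<pi> g = \<pi>' g"
proof -
  interpret G: group "G_A A" by (rule group_G_A)
  interpret h: group_hom "G_A A" K \<pi> using assms by (simp add: group_hom_def group_hom_axioms_def group_G_A)
  interpret h': group_hom "G_A A" K \<pi>' using assms by (simp add: group_hom_def group_hom_axioms_def group_G_A)
  obtain j i k where g: "g = (j, A_powi A i (real_vec k))"
    using g by (cases g) (auto simp: G_A_simps ZA_def)
  have c: "(1, 0) \<in> carrier (G_A A)" "(0, real_vec k) \<in> carrier (G_A A)"
    by (simp_all add: G_A_simps ZA_0 ZA_real_vec)
  show ?thesis
    unfolding g G_A_factor[OF refl] using c
    by (simp add: h.hom_int_pow h'.hom_int_pow u t del: One_nat_def)
qed

text \<open>Let \<open>S (A\<^sup>i k) = u\<^sup>i t\<^sub>k u\<^sup>-\<^sup>i\<close>. The relation \<open>u t\<^sub>k u\<^sup>-\<^sup>1 = t\<^bsub>Ak\<^esub>\<close> makes this independent of the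
representation of the argument. Then \<open>S\<close> is additive, because two arguments have a common
\<open>i\<close>, it turns \<open>A\<^sup>j\<close> into conjugation by \<open>u\<^sup>j\<close>, and \<open>(j, b) \<mapsto> S b u\<^sup>j\<close> is the homomorphism.\<close>

lemma G_A_hom_exists:
  fixes K (structure)
  assumes "group K" and u: "u \<in> carrier K" and t: "\<And>k. t k \<in> carrier K"
    and t_add: "\<And>k l. t (k + l) = t k \<otimes> t l"
    and rel: "\<And>k. u \<otimes> t k = t (A *v k) \<otimes> u"
  shows "\<exists>\<pi>\<in>hom (G_A A) K. \<pi> (1, 0) = u \<and> (\<forall>k. \<pi> (0, real_vec k) = t k)"
proof -
  interpret K: group K by fact
  define \<psi> where "\<psi> = (\<lambda>(i :: int) g. u [^] i \<otimes> g \<otimes> u [^] (- i))"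
  have up: "u [^] (i :: int) \<in> carrier K" for i using u by simp
  have cancel: "u [^] (- i) \<otimes> (u [^] i \<otimes> g) = g" if "g \<in> carrier K" for i :: int and g
    using that up u by (simp add: K.m_assoc[symmetric] K.int_pow_mult[symmetric])
  have \<psi>_closed: "\<psi> i g \<in> carrier K" if "g \<in> carrier K" for i g
    using that up by (simp add: \<psi>_def)
  have \<psi>_\<psi>: "\<psi> i (\<psi> j g) = \<psi> (i + j) g" if "g \<in> carrier K" for i j g
  proof -
    have "- (i + j) = - j + - i" by simp
    then have "u [^] (- (i + j)) = u [^] (- j) \<otimes> u [^] (- i)"
      by (simp only: K.int_pow_mult[OF u])
    then show ?thesis using that up u by (simp add: \<psi>_def K.int_pow_mult K.m_assoc del: minus_add_distrib)
  qed
  have \<psi>_mult: "\<psi> i (g \<otimes> h) = \<psi> i g \<otimes> \<psi> i h" if "g \<in> carrier K" "h \<in> carrier K" for i g h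
    using that up by (simp add: \<psi>_def K.m_assoc cancel)
  have \<psi>_0: "\<psi> 0 g = g" if "g \<in> carrier K" for g using that by (simp add: \<psi>_def)
  have \<psi>_t: "\<psi> (int n) (t k) = t (((*v) A ^^ n) k)" for n k
  proof (induction n)
    case 0 show ?case by (simp add: \<psi>_0 t)
  next
    case (Suc n)
    have "\<psi> (int (Suc n)) (t k) = \<psi> 1 (t (((*v) A ^^ n) k))"
      using \<psi>_\<psi>[OF t, of 1 "int n" k] Suc by simp
    also have "\<dots> = t (A *v ((*v) A ^^ n) k) \<otimes> u \<otimes> inv u"
      using u by (simp add: \<psi>_def rel K.int_pow_neg)
    finally show ?case using u t by (simp add: K.m_assoc)
  qed
  have well_aux: "\<psi> (- int m) (t k) = \<psi> (- int n) (t l)"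
    if eq: "A_powi A (- int m) (real_vec k) = A_powi A (- int n) (real_vec l)" and "m \<le> n" for m n k l
  proof -
    have "real_vec l = A_powi A (int n) (A_powi A (- int m) (real_vec k))"
      unfolding eq by (simp add: A_powi_cancel)
    also have "\<dots> = real_vec (((*v) A ^^ (n - m)) k)"
      unfolding A_powi_int[symmetric] A_powi_A_powi using \<open>m \<le> n\<close> by (simp add: of_nat_diff)
    finally have "l = ((*v) A ^^ (n - m)) k" by (simp add: vec_eq_iff)
    then have "\<psi> (- int n) (t l) = \<psi> (- int n) (\<psi> (int (n - m)) (t k))" by (simp only: \<psi>_t)
    also have "\<dots> = \<psi> (- int m) (t k)" using \<open>m \<le> n\<close> by (simp add: \<psi>_\<psi> t of_nat_diff)
    finally show ?thesis by simp
  qed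
  have well: "\<psi> (- int m) (t k) = \<psi> (- int n) (t l)"
    if eq: "A_powi A (- int m) (real_vec k) = A_powi A (- int n) (real_vec l)" for m n k l
    using well_aux[OF eq] well_aux[OF eq[symmetric]] by (metis linear)
  define S where "S = (\<lambda>b. SOME g. \<exists>m k. b = A_powi A (- int m) (real_vec k) \<and> g = \<psi> (- int m) (t k))"
  have S_neg: "S (A_powi A (- int m) (real_vec k)) = \<psi> (- int m) (t k)" for m k
    unfolding S_def
  proof (rule some_equality)
    fix g assume "\<exists>n l. A_powi A (- int m) (real_vec k) = A_powi A (- int n) (real_vec l) \<and> g = \<psi> (- int n) (t l)"
    then show "g = \<psi> (- int m) (t k)" using well by metis
  qed blast
  have S_eq: "S (A_powi A i (real_vec k)) = \<psi> i (t k)" for i k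
  proof (cases "i \<le> 0")
    case True
    then show ?thesis using S_neg[of "nat (- i)" k] by simp
  next
    case False
    then have "A_powi A i (real_vec k) = A_powi A (- int 0) (real_vec (((*v) A ^^ nat i) k))"
      using A_powi_int[of "nat i" k] by (simp add: A_powi_0)
    then have "S (A_powi A i (real_vec k)) = \<psi> (- int 0) (t (((*v) A ^^ nat i) k))"
      by (simp only: S_neg)
    then show ?thesis using \<psi>_t[of "nat i" k] False by (simp add: \<psi>_0 t)
  qed
  have S_t: "S (real_vec k) = t k" for k
    using S_eq[of 0 k] by (simp add: A_powi_0 \<psi>_0 t)
  have S_closed: "S b \<in> carrier K" if "b \<in> ZA" for b
    using that by (auto simp: ZA_def S_neg \<psi>_closed t)
  have S_conj: "S (A_powi A i b) = \<psi> i (S b)" if "b \<in> ZA" for i b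
    using that by (auto simp: ZA_def A_powi_A_powi S_eq \<psi>_\<psi> t)
  have S_add: "S (b + c) = S b \<otimes> S c" if bc: "b \<in> ZA" "c \<in> ZA" for b c
  proof -
    obtain i k l where b: "b = A_powi A i (real_vec k)" and c: "c = A_powi A i (real_vec l)"
      using bc by (rule ZA_common)
    have "real_vec k + real_vec l = real_vec (k + l)" by (simp add: vec_eq_iff)
    then have sum: "b + c = A_powi A i (real_vec (k + l))" unfolding b c by (simp only: flip: A_powi_add_right)
    show ?thesis unfolding sum S_eq t_add unfolding b c S_eq by (rule \<psi>_mult[OF t t])
  qed
  define \<pi> where "\<pi> = (\<lambda>(j :: int, b). S b \<otimes> u [^] j)"
  have "\<pi> \<in> hom (G_A A) K"
  proof (rule homI)
    fix x assume "x \<in> carrier (G_A A)"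
    then show "\<pi> x \<in> carrier K" using up by (cases x) (simp add: G_A_simps \<pi>_def S_closed)
  next
    fix x y assume "x \<in> carrier (G_A A)" "y \<in> carrier (G_A A)"
    then obtain j b k c where x: "x = (j, b)" "b \<in> ZA" and y: "y = (k, c)" "c \<in> ZA"
      by (cases x; cases y) (simp add: G_A_simps)
    have "\<pi> (x \<otimes>\<^bsub>G_A A\<^esub> y) = S (b + A_powi A j c) \<otimes> u [^] (j + k)"
      by (simp add: x y G_A_simps \<pi>_def add.commute)
    also have "\<dots> = S b \<otimes> (u [^] j \<otimes> S c \<otimes> u [^] (- j)) \<otimes> (u [^] j \<otimes> u [^] k)"
      using u x y by (simp add: S_add S_conj ZA_A_powi \<psi>_def K.int_pow_mult)
    also have "\<dots> = \<pi> x \<otimes> \<pi> y"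
      using up x y by (simp add: \<pi>_def K.m_assoc cancel S_closed)
    finally show "\<pi> (x \<otimes>\<^bsub>G_A A\<^esub> y) = \<pi> x \<otimes> \<pi> y" .
  qed
  moreover have "t 0 = \<one>" using t_add[of 0 0] t[of 0] by (simp add: K.l_cancel_one)
  then have "\<pi> (1, 0) = u" using u S_t[of 0] by (simp add: \<pi>_def zero_vec_def)
  moreover have "\<pi> (0, real_vec k) = t k" for k using t by (simp add: \<pi>_def S_t)
  ultimately show ?thesis by blast
qed

end

lemma subgroup_unitaries:
  "subgroup {T \<in> Bij (L2 M). L2_iso M M T} (BijGroup (L2 M))"
proof (rule group.subgroupI[OF group_BijGroup])
  show "{T \<in> Bij (L2 M). L2_iso M M T} \<subseteq> carrier (BijGroup (L2 M))" by (auto simp: BijGroup_def)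
  have "L2_iso M M (\<lambda>F\<in>L2 M. F)" by (rule L2_iso_cong[OF L2_iso_id]) simp
  then have "(\<lambda>F\<in>L2 M. F) \<in> {T \<in> Bij (L2 M). L2_iso M M T}" using id_Bij by blast
  then show "{T \<in> Bij (L2 M). L2_iso M M T} \<noteq> {}" by blast
next
  fix T assume T: "T \<in> {T \<in> Bij (L2 M). L2_iso M M T}"
  have "L2_iso M M (\<lambda>F\<in>L2 M. inv_into (L2 M) T F)"
    by (rule L2_iso_cong[OF L2_iso_inv]) (use T in auto)
  then show "inv\<^bsub>BijGroup (L2 M)\<^esub> T \<in> {T \<in> Bij (L2 M). L2_iso M M T}"
    using T by (simp add: inv_BijGroup restrict_inv_into_Bij)
next
  fix S T assume ST: "S \<in> {T \<in> Bij (L2 M). L2_iso M M T}" "T \<in> {T \<in> Bij (L2 M). L2_iso M M T}"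
  have "L2_iso M M (compose (L2 M) S T)"
    by (rule L2_iso_cong[OF L2_iso_comp[of M M T M S]]) (use ST in \<open>auto simp: compose_def\<close>)
  then show "S \<otimes>\<^bsub>BijGroup (L2 M)\<^esub> T \<in> {T \<in> Bij (L2 M). L2_iso M M T}"
    using ST by (simp add: BijGroup_def compose_Bij)
qed

text \<open>Existence is applied in the subgroup of unitary bijections, which makes every operator
of the representation unitary; uniqueness is applied in the group of all bijections.\<close>

lemma rep_generated_by_exists_unique:
  assumes inv: "invertible (real_mat A)"
    and U: "L2_iso M M U" "U \<in> extensional (L2 M)"
    and T: "\<And>k. L2_iso M M (T k)" "\<And>k. T k \<in> extensional (L2 M)"
    and T_add: "\<And>k l F. F \<in> L2 M \<Longrightarrow> T (k + l) F = T k (T l F)"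
    and rel: "\<And>k F. F \<in> L2 M \<Longrightarrow> U (T k F) = T (A *v k) (U F)"
  shows "\<exists>!\<pi>. rep_generated_by A M U T \<pi>"
proof -
  interpret invertible_matrix A by standard (rule inv)
  let ?B = "BijGroup (L2 M)"
  let ?H = "{T \<in> Bij (L2 M). L2_iso M M T}"
  let ?K = "?B\<lparr>carrier := ?H\<rparr>"
  have grp: "group ?K" by (rule subgroup.subgroup_is_group[OF subgroup_unitaries group_BijGroup])
  have Bij: "S \<in> Bij (L2 M)" if "L2_iso M M S" "S \<in> extensional (L2 M)" for S
    using that by (simp add: Bij_def L2_iso_def)
  have "\<exists>\<pi>\<in>hom (G_A A) ?K. \<pi> (1, 0) = U \<and> (\<forall>k. \<pi> (0, real_vec k) = T k)"
  proof (rule G_A_hom_exists[OF grp])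
    show "U \<in> carrier ?K" using U Bij by simp
    show "T k \<in> carrier ?K" for k using T Bij by simp
    show "T (k + l) = T k \<otimes>\<^bsub>?K\<^esub> T l" for k l
    proof (rule extensionalityI[of _ "L2 M"])
      show "T k \<otimes>\<^bsub>?K\<^esub> T l \<in> extensional (L2 M)" using T Bij by (simp add: BijGroup_def)
    qed (use T Bij T_add in \<open>simp_all add: BijGroup_def compose_eq\<close>)
    show "U \<otimes>\<^bsub>?K\<^esub> T k = T (A *v k) \<otimes>\<^bsub>?K\<^esub> U" for k
    proof (rule extensionalityI[of _ "L2 M"])
      show "U \<otimes>\<^bsub>?K\<^esub> T k \<in> extensional (L2 M)" "T (A *v k) \<otimes>\<^bsub>?K\<^esub> U \<in> extensional (L2 M)"
        using T U Bij by (simp_all add: BijGroup_def)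
    qed (use T U Bij rel in \<open>simp add: BijGroup_def compose_eq\<close>)
  qed
  then obtain \<pi>0 where \<pi>0: "\<pi>0 \<in> hom (G_A A) ?K" "\<pi>0 (1, 0) = U" "\<And>k. \<pi>0 (0, real_vec k) = T k" by blast
  define \<pi> where "\<pi> = restrict \<pi>0 (carrier (G_A A))"
  have gens: "(1, 0) \<in> carrier (G_A A)" "(0, real_vec k) \<in> carrier (G_A A)" for k
    by (simp_all add: G_A_simps ZA_0 ZA_real_vec)
  interpret G: group "G_A A" by (rule group_G_A)
  have \<pi>H: "\<pi> g \<in> ?H" if "g \<in> carrier (G_A A)" for g
    using hom_in_carrier[OF \<pi>0(1) that] that by (simp add: \<pi>_def)
  have "\<pi> \<in> hom (G_A A) ?B"
  proof (rule homI)
    fix x y assume "x \<in> carrier (G_A A)" "y \<in> carrier (G_A A)"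
    then show "\<pi> (x \<otimes>\<^bsub>G_A A\<^esub> y) = \<pi> x \<otimes>\<^bsub>?B\<^esub> \<pi> y"
      using hom_mult[OF \<pi>0(1)] by (simp add: \<pi>_def)
  qed (use \<pi>H in \<open>auto simp: BijGroup_def\<close>)
  then have "group_action (G_A A) (L2 M) \<pi>"
    by (simp add: group_action_def group_hom_def group_hom_axioms_def group_G_A group_BijGroup)
  then have rep: "rep_generated_by A M U T \<pi>"
    using \<pi>H \<pi>0 gens unfolding rep_generated_by_def unitary_rep_def by (auto simp: \<pi>_def)
  have hom_B: "\<sigma> \<in> hom (G_A A) ?B" "\<sigma> (1, 0) = U" "\<And>k. \<sigma> (0, real_vec k) = T k"
      "\<sigma> \<in> extensional (carrier (G_A A))" if "rep_generated_by A M U T \<sigma>" for \<sigma>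
    using that unfolding rep_generated_by_def unitary_rep_def group_action_def group_hom_def
      group_hom_axioms_def by blast+
  have "\<sigma> = \<pi>" if \<sigma>: "rep_generated_by A M U T \<sigma>" for \<sigma>
  proof (rule extensionalityI[OF hom_B(4)[OF \<sigma>] hom_B(4)[OF rep]])
    fix g assume g: "g \<in> carrier (G_A A)"
    show "\<sigma> g = \<pi> g"
      by (rule G_A_hom_unique[OF group_BijGroup hom_B(1)[OF \<sigma>] hom_B(1)[OF rep] _ _ g])
        (simp_all only: hom_B(2,3)[OF \<sigma>] hom_B(2,3)[OF rep])
  qed
  with rep show ?thesis by blast
qed

section \<open>Characters and the dilation on Lebesgue measure\<close>

lemma det_real_mat: "det (real_mat A) = of_int (det A)"
  by (simp add: det_def)

lemma cis_2pi_int: "cis (2 * pi * (real_vec k \<bullet> real_vec l)) = 1"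
proof -
  have "real_vec k \<bullet> real_vec l = real_of_int (\<Sum>i\<in>UNIV. k $ i * l $ i)"
    by (simp add: inner_vec_def)
  then show ?thesis by (metis cis_multiple_2pi Ints_of_int)
qed

lemma inner_real_vec_AT: "real_vec (A *v k) \<bullet> x = real_vec k \<bullet> AT A x"
proof -
  have "real_vec (A *v k) = real_mat A *v real_vec k" by (simp add: vec_eq_iff matrix_vector_mult_def)
  then have "real_vec (A *v k) \<bullet> x = (x v* real_mat A) \<bullet> real_vec k"
    by (simp only: dot_lmul_matrix inner_commute[of _ x])
  then show ?thesis by (simp add: AT_def inner_commute)
qed

lemma character_measurable: "(\<lambda>x. cis (2 * pi * (real_vec k \<bullet> x))) \<in> borel_measurable lebesgue"
proof -
  have "(\<lambda>x. cis (2 * pi * (real_vec k \<bullet> x))) \<in> borel_measurable borel"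
    by (intro borel_measurable_continuous_onI continuous_intros)
  then show ?thesis by (simp add: measurable_completion)
qed

context digit_system
begin

lemma det_nonzero: "det A \<noteq> 0"
  using expansive_invertible[OF expansive] by (auto simp: invertible_det_nz det_real_mat)

lemma AT_measurable: "AT A \<in> lebesgue \<rightarrow>\<^sub>M lebesgue"
  by (rule linear_inverse_measurable_lebesgue[OF linear_AT_inv AT_inv_AT AT_AT_inv])

lemma AT_inv_measurable: "AT_inv A \<in> lebesgue \<rightarrow>\<^sub>M lebesgue"
  by (rule linear_inverse_measurable_lebesgue[OF linear_AT AT_AT_inv AT_inv_AT])

lemma lebesgue_AT_density:
  "lebesgue = density (distr lebesgue lebesgue (AT A)) (\<lambda>_. ennreal \<bar>real_of_int (det A)\<bar>)"
proof -
  have "AT A = (*v) (transpose (real_mat A))" by (rule ext) (simp only: AT_def)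
  then have "det (matrix (AT A)) = real_of_int (det A)"
    by (simp only: matrix_of_matrix_vector_mul det_transpose det_real_mat)
  then show ?thesis
    using lebesgue_linear_density[OF linear_AT linear_AT_inv AT_inv_AT AT_AT_inv] by simp
qed

lemma emeasure_AT_vimage:
  assumes S: "S \<in> sets lebesgue"
  shows "ennreal \<bar>real_of_int (det A)\<bar> * emeasure lebesgue (AT A -` S) = emeasure lebesgue S"
proof -
  have "emeasure lebesgue S = emeasure (density (distr lebesgue lebesgue (AT A)) (\<lambda>_. ennreal \<bar>real_of_int (det A)\<bar>)) S"
    by (rule arg_cong[OF lebesgue_AT_density])
  also have "\<dots> = ennreal \<bar>real_of_int (det A)\<bar> * emeasure lebesgue (AT A -` S)"
    using S AT_measurable
    by (simp add: emeasure_density nn_integral_cmult_indicator emeasure_distr del: emeasure_completion)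
  finally show ?thesis by simp
qed

lemma AE_lebesgue_AT:
  assumes "AE y in lebesgue. P y" shows "AE x in lebesgue. P (AT A x)"
proof -
  have "AE y in density (distr lebesgue lebesgue (AT A)) (\<lambda>_. ennreal \<bar>real_of_int (det A)\<bar>). P y"
    unfolding lebesgue_AT_density[symmetric] by (rule assms)
  then have "AE y in distr lebesgue lebesgue (AT A). P y"
    using det_nonzero by (simp add: AE_density)
  then show ?thesis by (rule AE_distrD[OF AT_measurable])
qed

end

section \<open>Unfolding the tile\<close>

lemma bij_betw_pred_mod:
  assumes "0 < p"
  shows "bij_betw (\<lambda>j. (j + p - 1) mod p) {..<p} {..<p}"
    and "j < p \<Longrightarrow> Suc ((j + p - 1) mod p) mod p = j"
proof -
  have suc_pred: "Suc ((j + p - 1) mod p) mod p = j" if "j < p" for j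
    using that by (simp add: mod_Suc_eq)
  have pred_suc: "(Suc j mod p + p - 1) mod p = j" if "j < p" for j
    using that by (cases "Suc j = p") auto
  show "bij_betw (\<lambda>j. (j + p - 1) mod p) {..<p} {..<p}"
    by (rule bij_betw_byWitness[where f' = "\<lambda>j. Suc j mod p"]) (use assms suc_pred pred_suc in auto)
  show "j < p \<Longrightarrow> Suc ((j + p - 1) mod p) mod p = j" by (rule suc_pred)
qed

locale tiling_cycle_system = simple_cycle_system A D p \<theta>
  for A :: "int^'n^'n" and D :: "(int^'n) set" and p :: nat and \<theta> :: "nat \<Rightarrow> real^'n" +
  assumes tiling: "tiling_condition A D"
begin

abbreviation "X \<equiv> tile A D"
abbreviation "\<Omega> \<equiv> Omega_tilde A D p \<theta>"
abbreviation "H \<equiv> hat_mu p :: ((real^'n) \<times> nat) measure"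
abbreviation "B \<equiv> breve_mu A D p \<theta>"

lemma X_sets: "X \<in> sets lebesgue"
  using lmeasurable_compact[OF compact_tile] by (rule fmeasurableD)

lemma sigma_finite_X: "sigma_finite_measure (lebesgue_on X)"
  by (rule sigma_finite_measure_restrict_space[OF sigma_finite_lebesgue X_sets])

lemma space_H: "space H = UNIV \<times> {..<p}"
  by (simp add: hat_mu_def space_pair_measure)

lemma space_B: "space B = X \<times> \<Omega>"
  by (simp add: breve_mu_def space_pair_measure)

definition cell :: "(nat \<Rightarrow> int^'n) \<Rightarrow> (int^'n) \<times> nat" where
  "cell \<omega> = (SOME c. code \<omega> (fst c) (snd c))"

lemma cell_code: "\<omega> \<in> \<Omega> \<Longrightarrow> code \<omega> (fst (cell \<omega>)) (snd (cell \<omega>))"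
  using code_exists[of \<omega>] unfolding cell_def by (metis (mono_tags, lifting) fst_conv snd_conv someI)

lemma cell_eqI: "\<omega> \<in> \<Omega> \<Longrightarrow> code \<omega> k j \<Longrightarrow> cell \<omega> = (k, j)"
  using code_unique[OF cell_code] by (metis prod.collapse)

lemma bij_cell: "bij_betw cell \<Omega> (UNIV \<times> {..<p})"
proof (rule bij_betw_imageI)
  show "inj_on cell \<Omega>"
  proof (rule inj_onI)
    fix \<omega> \<omega>' assume w: "\<omega> \<in> \<Omega>" "\<omega>' \<in> \<Omega>" "cell \<omega> = cell \<omega>'"
    show "\<omega> = \<omega>'"
      using code_inj[OF cell_code[OF w(1)] cell_code[OF w(2), folded w(3)]] w(1,2)[THEN Omega_tilde_range] .
  qed
  show "cell ` \<Omega> = UNIV \<times> {..<p}"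
  proof (intro equalityI subsetI)
    fix c assume "c \<in> cell ` \<Omega>"
    then show "c \<in> UNIV \<times> {..<p}" using cell_code by (auto simp: code_def mem_Times_iff)
  next
    fix c :: "(int^'n) \<times> nat" assume "c \<in> UNIV \<times> {..<p}"
    then obtain \<omega> where "\<omega> \<in> \<Omega>" "code \<omega> (fst c) (snd c)" using code_surj by fastforce
    then show "c \<in> cell ` \<Omega>" using cell_eqI by (metis image_eqI prod.collapse)
  qed
qed

definition offset :: "(nat \<Rightarrow> int^'n) \<Rightarrow> real^'n" where
  "offset \<omega> = - \<theta> (snd (cell \<omega>)) - real_vec (fst (cell \<omega>))"

text \<open>The map \<open>hat_i\<^sup>-\<^sup>1 \<circ> \<dd>\<close> in coordinates: a translation on each layer \<open>X \<times> {\<omega>}\<close>.\<close>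

definition unfold :: "(real^'n) \<times> (nat \<Rightarrow> int^'n) \<Rightarrow> (real^'n) \<times> nat" where
  "unfold = (\<lambda>(x, \<omega>). (offset \<omega> + x, snd (cell \<omega>)))"

lemma W_eq: "\<omega> \<in> \<Omega> \<Longrightarrow> W A p \<theta> f (x, \<omega>) = f (unfold (x, \<omega>))"
  using inv_hat_i_frak_d[OF cell_code, of \<omega> x]
  by (simp add: W_def unfold_def offset_def algebra_simps)

lemma AE_unique_translate: "AE y in lebesgue. \<exists>!k. y + real_vec k \<in> X"
proof -
  have mem: "y \<in> (+) (real_vec k) ` X \<longleftrightarrow> y + real_vec (- k) \<in> X" for y k
    unfolding real_vec_minus by (force simp: image_iff algebra_simps)
  have "AE y in lebesgue. y \<in> (\<Union>k. (+) (real_vec k) ` X)"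
    using tiling unfolding tiling_condition_def by (auto intro!: AE_I'[of "UNIV - (\<Union>k. (+) (real_vec k) ` X)"])
  then have ex: "AE y in lebesgue. \<exists>k. y + real_vec k \<in> X"
    by eventually_elim (use mem in blast)
  have "AE y in lebesgue. \<not> (k \<noteq> k' \<and> y + real_vec k \<in> X \<and> y + real_vec k' \<in> X)" for k k'
  proof (cases "k = k'")
    case False
    then have "- k \<noteq> - k'" by simp
    then have "(+) (real_vec (- k)) ` X \<inter> (+) (real_vec (- k')) ` X \<in> null_sets lebesgue"
      using tiling unfolding tiling_condition_def by blast
    then show ?thesis
      by (rule AE_I') (use mem[of _ "- k"] mem[of _ "- k'"] in auto)
  qed simp
  then have "AE y in lebesgue. \<forall>k k'. \<not> (k \<noteq> k' \<and> y + real_vec k \<in> X \<and> y + real_vec k' \<in> X)"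
    by (simp only: AE_all_countable) simp
  with ex show ?thesis by eventually_elim blast
qed

text \<open>Translating back, the sets \<open>X - c - k\<close> cover almost every point of \<open>S\<close> exactly once.\<close>

lemma emeasure_by_translates:
  assumes S: "S \<in> sets lebesgue"
  shows "(\<integral>\<^sup>+ k. emeasure lebesgue (X \<inter> (\<lambda>x. (- c - real_vec k) + x) -` S) \<partial>count_space UNIV) = emeasure lebesgue S"
proof -
  let ?V = "\<lambda>k. (\<lambda>y. (c + real_vec k) + y) -` X"
  have V: "?V k \<in> sets lebesgue" for k
    using measurable_sets[OF translation_measurable_lebesgue X_sets, of "c + real_vec k"] by simp
  have "emeasure lebesgue (X \<inter> (\<lambda>x. (- c - real_vec k) + x) -` S) = (\<integral>\<^sup>+ y. indicator (?V k \<inter> S) y \<partial>lebesgue)" for k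
  proof -
    let ?E = "X \<inter> (\<lambda>x. (- c - real_vec k) + x) -` S"
    have E: "?E \<in> sets lebesgue"
      using X_sets measurable_sets[OF translation_measurable_lebesgue S, of "- c - real_vec k"] by (intro sets.Int) auto
    have "(\<lambda>y. (c + real_vec k) + y) -` ?E = ?V k \<inter> S" by auto
    then have "emeasure lebesgue ?E = emeasure lebesgue (?V k \<inter> S)"
      using emeasure_lebesgue_vimage_translation[OF E, of "c + real_vec k"] by simp
    then show ?thesis using V S by (subst nn_integral_indicator) auto
  qed
  then have "(\<integral>\<^sup>+ k. emeasure lebesgue (X \<inter> (\<lambda>x. (- c - real_vec k) + x) -` S) \<partial>count_space UNIV)
      = (\<integral>\<^sup>+ k. (\<integral>\<^sup>+ y. indicator (?V k \<inter> S) y \<partial>lebesgue) \<partial>count_space UNIV)" by simp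
  also have "\<dots> = (\<integral>\<^sup>+ y. (\<integral>\<^sup>+ k. indicator (?V k \<inter> S) y \<partial>count_space UNIV) \<partial>lebesgue)"
    using V S by (intro nn_integral_count_space_nn_integral[symmetric]) auto
  also have "\<dots> = (\<integral>\<^sup>+ y. indicator S y \<partial>lebesgue)"
  proof (rule nn_integral_cong_AE)
    show "AE y in lebesgue. (\<integral>\<^sup>+ k. indicator (?V k \<inter> S) y \<partial>count_space UNIV) = indicator S y"
      using AE_lebesgue_translation[OF AE_unique_translate, of c]
    proof eventually_elim
      fix y assume "\<exists>!k. c + y + real_vec k \<in> X"
      then obtain k0 where k0: "\<And>k. c + y + real_vec k \<in> X \<longleftrightarrow> k = k0" by auto
      have "(c + real_vec k) + y \<in> X \<longleftrightarrow> k = k0" for k using k0[of k] by (simp add: algebra_simps)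
      then have "indicator (?V k \<inter> S) y = indicator S y * (indicator {k0} k :: ennreal)" for k
        by (auto simp: indicator_def)
      then show "(\<integral>\<^sup>+ k. indicator (?V k \<inter> S) y \<partial>count_space UNIV) = indicator S y"
        by (simp add: nn_integral_cmult del: nn_integral_indicator_singleton) 
    qed
  qed
  also have "\<dots> = emeasure lebesgue S" using S by (rule nn_integral_indicator)
  finally show ?thesis .
qed

lemma unfold_measurable: "unfold \<in> B \<rightarrow>\<^sub>M H"
  unfolding breve_mu_def hat_mu_def
proof (rule measurable_pair)
  have "(\<lambda>z. offset (snd z) + fst z) \<in> lebesgue_on X \<Otimes>\<^sub>M count_space \<Omega> \<rightarrow>\<^sub>M lebesgue"
  proof (rule measurable_compose_countable'[where f = "\<lambda>\<omega> z. offset \<omega> + fst z" and g = snd and I = \<Omega>])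
    show "(\<lambda>z. offset \<omega> + fst z) \<in> lebesgue_on X \<Otimes>\<^sub>M count_space \<Omega> \<rightarrow>\<^sub>M lebesgue" for \<omega>
      by (rule measurable_compose[OF measurable_fst measurable_restrict_space1[OF translation_measurable_lebesgue]])
  qed (simp_all add: countable_Omega_tilde)
  then show "fst \<circ> unfold \<in> lebesgue_on X \<Otimes>\<^sub>M count_space \<Omega> \<rightarrow>\<^sub>M lebesgue"
    by (simp add: unfold_def case_prod_beta o_def)
  have "(\<lambda>\<omega>. snd (cell \<omega>)) \<in> count_space \<Omega> \<rightarrow>\<^sub>M count_space {..<p}"
    using cell_code by (auto simp: code_def)
  from measurable_compose[OF measurable_snd this]
  show "snd \<circ> unfold \<in> lebesgue_on X \<Otimes>\<^sub>M count_space \<Omega> \<rightarrow>\<^sub>M count_space {..<p}"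
    by (simp add: unfold_def case_prod_beta o_def)
qed

text \<open>The layers of \<open>X \<times> \<Omega>\<close> that are sent to \<open>\<real>\<^sup>d \<times> {j}\<close> are indexed by \<open>k \<in> \<int>\<^sup>d\<close>, and they are moved
onto the translates \<open>X - \<theta>\<^sub>j - k\<close>.\<close>

lemma distr_unfold: "distr B H unfold = H"
proof (rule measure_eqI)
  fix E assume "E \<in> sets (distr B H unfold)"
  then have E: "E \<in> sets H" by simp
  define S where "S = (\<lambda>j. (\<lambda>x. (x, j)) -` E)"
  have S: "S j \<in> sets lebesgue" for j
    unfolding S_def using E unfolding hat_mu_def by (rule sets_Pair2)
  define G where "G = (\<lambda>c. emeasure lebesgue (X \<inter> (\<lambda>x. (- \<theta> (snd c) - real_vec (fst c)) + x) -` S (snd c)))"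
  have pre: "unfold -` E \<inter> space B \<in> sets (lebesgue_on X \<Otimes>\<^sub>M count_space \<Omega>)"
    using measurable_sets[OF unfold_measurable E] by (simp add: breve_mu_def)
  have "emeasure (distr B H unfold) E = emeasure B (unfold -` E \<inter> space B)"
    using E unfold_measurable by (simp add: emeasure_distr)
  also have "\<dots> = (\<integral>\<^sup>+ \<omega>. emeasure (lebesgue_on X) ((\<lambda>x. (x, \<omega>)) -` (unfold -` E \<inter> space B)) \<partial>count_space \<Omega>)"
    using emeasure_pair_count_space[OF sigma_finite_X countable_Omega_tilde pre] by (simp add: breve_mu_def)
  also have "\<dots> = (\<integral>\<^sup>+ \<omega>. G (cell \<omega>) \<partial>count_space \<Omega>)"
  proof (rule nn_integral_cong)
    fix \<omega> assume "\<omega> \<in> space (count_space \<Omega>)"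
    then have "(\<lambda>x. (x, \<omega>)) -` (unfold -` E \<inter> space B)
        = X \<inter> (\<lambda>x. (- \<theta> (snd (cell \<omega>)) - real_vec (fst (cell \<omega>))) + x) -` S (snd (cell \<omega>))"
      by (auto simp: space_B unfold_def S_def offset_def)
    then show "emeasure (lebesgue_on X) ((\<lambda>x. (x, \<omega>)) -` (unfold -` E \<inter> space B)) = G (cell \<omega>)"
      using X_sets by (simp add: G_def emeasure_restrict_space del: emeasure_completion)
  qed
  also have "\<dots> = (\<integral>\<^sup>+ c. G c \<partial>count_space (UNIV \<times> {..<p}))"
    by (rule nn_integral_bij_count_space[OF bij_cell])
  also have "\<dots> = (\<integral>\<^sup>+ j. \<integral>\<^sup>+ k. G (k, j) \<partial>count_space UNIV \<partial>count_space {..<p})"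
  proof -
    interpret L: sigma_finite_measure "count_space (UNIV :: (int^'n) set)"
      by (rule sigma_finite_measure_count_space_countable) simp
    interpret R: sigma_finite_measure "count_space {..<p}"
      by (rule sigma_finite_measure_count_space_countable) simp
    interpret pair_sigma_finite "count_space (UNIV :: (int^'n) set)" "count_space {..<p}" ..
    have eq: "count_space (UNIV :: (int^'n) set) \<Otimes>\<^sub>M count_space {..<p} = count_space (UNIV \<times> {..<p})"
      by (rule pair_measure_countable) simp_all
    show ?thesis using nn_integral_snd[of G] unfolding eq by simp
  qed
  also have "\<dots> = (\<integral>\<^sup>+ j. emeasure lebesgue (S j) \<partial>count_space {..<p})"
    unfolding G_def by (simp add: emeasure_by_translates[OF S] del: emeasure_completion)
  also have "\<dots> = emeasure H E"
    unfolding S_def hat_mu_def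
    by (rule emeasure_pair_count_space[OF sigma_finite_lebesgue _ E[unfolded hat_mu_def], symmetric]) simp
  finally show "emeasure (distr B H unfold) E = emeasure H E" .
qed simp

text \<open>The preimage reads off \<open>f\<close> at the unique translate of \<open>X\<close> that contains the point. Its
measurability is checked on the countably many sets where this translate is constant.\<close>

lemma W_surj:
  assumes f: "f \<in> L2_fun B"
  shows "\<exists>h\<in>borel_measurable H. AE y in B. W A p \<theta> h y = f y"
proof -
  define word where "word = inv_into \<Omega> cell"
  have word: "word (k, j) \<in> \<Omega>" if "j < p" for k j
    unfolding word_def using bij_betw_imp_surj_on[OF bij_cell] that by (intro inv_into_into) auto
  define h where "h = (\<lambda>(y, j). if \<exists>!k. y + \<theta> j + real_vec k \<in> X
    then let k = (THE k. y + \<theta> j + real_vec k \<in> X) in f (y + \<theta> j + real_vec k, word (k, j)) else 0)"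
  have h_in: "h (y, j) = f (y + \<theta> j + real_vec k, word (k, j))"
    if "\<And>k'. y + \<theta> j + real_vec k' \<in> X \<longleftrightarrow> k' = k" for y j k
    using that by (auto simp: h_def Let_def)
  have "h \<in> borel_measurable H"
    unfolding hat_mu_def borel_measurable_pair_count_space_iff[OF countable_finite[OF finite_lessThan]]
  proof
    fix j assume "j \<in> {..<p}"
    then have j: "j < p" by simp
    define V where "V = (\<lambda>k. (\<lambda>y. (\<theta> j + real_vec k) + y) -` X)"
    define E where "E = (\<lambda>k. V k - (\<Union>k'\<in>- {k}. V k'))"
    have V: "V k \<in> sets lebesgue" for k
      using measurable_sets[OF translation_measurable_lebesgue X_sets, of "\<theta> j + real_vec k"] by (simp add: V_def)
    have E: "E k \<in> sets lebesgue" for k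
      unfolding E_def by (intro sets.Diff sets.countable_UN') (auto intro: V)
    have V_iff: "y \<in> V k \<longleftrightarrow> y + \<theta> j + real_vec k \<in> X" for y k by (simp add: V_def algebra_simps)
    have E_iff: "y \<in> E k \<longleftrightarrow> (\<forall>k'. y + \<theta> j + real_vec k' \<in> X \<longleftrightarrow> k' = k)" for y k
      unfolding E_def by (auto simp: V_iff)
    let ?C = "insert (- (\<Union>k. E k)) (range E)"
    show "(\<lambda>y. h (y, j)) \<in> borel_measurable lebesgue"
    proof (rule measurable_piecewise_restrict[of ?C])
      show "countable ?C" by simp
      have "(\<Union>k. E k) \<in> sets lebesgue" using E by (intro sets.countable_UN') auto
      then have "- (\<Union>k. E k) \<in> sets lebesgue" using sets.compl_sets[of "\<Union>k. E k" lebesgue] by (simp add: Compl_eq_Diff_UNIV)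
      then show "C \<inter> space lebesgue \<in> sets lebesgue" if "C \<in> ?C" for C using that E by auto
      show "space lebesgue \<subseteq> \<Union>?C" by auto
      fix C assume C: "C \<in> ?C"
      show "(\<lambda>y. h (y, j)) \<in> borel_measurable (lebesgue_on C)"
      proof (cases "C \<in> range E")
        case True
        then obtain k where k: "C = E k" by blast
        have "(\<lambda>x. f (x, word (k, j))) \<in> borel_measurable (lebesgue_on X)"
          using L2_fun_measurable[OF f] word[OF j]
          unfolding breve_mu_def borel_measurable_pair_count_space_iff[OF countable_Omega_tilde] by blast
        moreover have "(\<lambda>y. (\<theta> j + real_vec k) + y) \<in> lebesgue_on C \<rightarrow>\<^sub>M lebesgue_on X"
          by (rule measurable_restrict_space3[OF translation_measurable_lebesgue]) (auto simp: k E_def V_def)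
        ultimately have "(\<lambda>y. f ((\<theta> j + real_vec k) + y, word (k, j))) \<in> borel_measurable (lebesgue_on C)"
          by (rule measurable_compose[rotated])
        moreover have "h (y, j) = f ((\<theta> j + real_vec k) + y, word (k, j))" if "y \<in> C" for y
          using h_in[of y j k] that unfolding k E_iff by (simp add: algebra_simps)
        ultimately show ?thesis by (subst measurable_cong) auto
      next
        case False
        with C have "C = - (\<Union>k. E k)" by blast
        then have "h (y, j) = 0" if "y \<in> C" for y using that by (auto simp: h_def E_iff)
        then show ?thesis by (subst measurable_cong[of _ _ "\<lambda>_. 0"]) auto
      qed
    qed
  qed
  moreover have "AE y in B. W A p \<theta> h y = f y"
    unfolding breve_mu_def AE_pair_count_space_iff[OF countable_Omega_tilde]
  proof
    fix \<omega> assume \<omega>: "\<omega> \<in> \<Omega>"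
    obtain k j where c: "cell \<omega> = (k, j)" by fastforce
    have w: "word (k, j) = \<omega>"
      unfolding word_def c[symmetric] using bij_cell \<omega> by (simp add: bij_betw_inv_into_left)
    have "AE x in lebesgue_on X. \<exists>!m. x + real_vec m \<in> X"
      using AE_unique_translate X_sets by (simp add: AE_restrict_space_iff) (auto elim: eventually_mono)
    moreover have "AE x in lebesgue_on X. x \<in> X" using AE_space[of "lebesgue_on X"] by simp
    ultimately show "AE x in lebesgue_on X. W A p \<theta> h (x, \<omega>) = f (x, \<omega>)"
    proof eventually_elim
      fix x assume u: "\<exists>!m. x + real_vec m \<in> X" and x: "x \<in> X"
      have u0: "x + real_vec m \<in> X \<longleftrightarrow> m = 0" for m
        using u x real_vec_0 by (metis add.right_neutral)
      let ?y = "offset \<omega> + x"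
      have y: "?y + \<theta> j + real_vec k' = x + real_vec (k' - k)" for k'
        unfolding real_vec_diff by (simp add: offset_def c)
      have "?y + \<theta> j + real_vec k' \<in> X \<longleftrightarrow> k' = k" for k' unfolding y u0 by simp
      from h_in[OF this] have "h (?y, j) = f (x + real_vec 0, \<omega>)" unfolding y w by simp
      then show "W A p \<theta> h (x, \<omega>) = f (x, \<omega>)"
        unfolding real_vec_0 by (simp add: W_eq[OF \<omega>] unfold_def c)
    qed
  qed
  ultimately show ?thesis by blast
qed

lemma W_respects: "L2_respects H B (W A p \<theta>)"
  and W_iso: "L2_iso H B (L2_lift H B (W A p \<theta>))"
  and W_L2_surj: "f \<in> L2_fun B \<Longrightarrow> \<exists>h\<in>L2_fun H. AE y in B. W A p \<theta> h y = f y"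
proof -
  have H: "H = density (distr B H unfold) (\<lambda>_. ennreal (1\<^sup>2))"
    unfolding distr_unfold by (simp add: density_1)
  have W: "W A p \<theta> f y = 1 * f (unfold y)" if "y \<in> space B" for f y
    using that W_eq by (auto simp: space_B)
  show "L2_respects H B (W A p \<theta>)"
    by (rule weighted_composition(1)[where w = "\<lambda>_. 1" and \<Psi> = unfold and \<Phi> = "W A p \<theta>" and c = 1, OF unfold_measurable _ _ _ H W]) simp_all
  show "L2_iso H B (L2_lift H B (W A p \<theta>))"
    by (rule L2_iso_weighted_composition(1)[where w = "\<lambda>_. 1" and \<Psi> = unfold and \<Phi> = "W A p \<theta>" and c = 1, OF unfold_measurable _ _ _ H W W_surj]) simp_all
  show "f \<in> L2_fun B \<Longrightarrow> \<exists>h\<in>L2_fun H. AE y in B. W A p \<theta> h y = f y"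
    by (rule L2_iso_weighted_composition(2)[where w = "\<lambda>_. 1" and \<Psi> = unfold and \<Phi> = "W A p \<theta>" and c = 1, OF unfold_measurable _ _ _ H W W_surj]) simp_all
qed

section \<open>The operators on \<open>L\<^sup>2(\<real>\<^sup>d \<times> \<int>\<^sub>p)\<close>\<close>

lemma H_measurable_iff: "f \<in> borel_measurable H \<longleftrightarrow> (\<forall>j<p. (\<lambda>x. f (x, j)) \<in> borel_measurable lebesgue)"
  unfolding hat_mu_def borel_measurable_pair_count_space_iff[OF countable_finite[OF finite_lessThan]]
  by auto

lemma H_unit_density: "H = density (distr H H (\<lambda>y. y)) (\<lambda>_. ennreal (1\<^sup>2))"
  by (simp add: density_1 distr_id)

lemma That_weight_measurable: "That p \<theta> k (\<lambda>_. 1) \<in> borel_measurable H"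
  unfolding H_measurable_iff That_def by (auto intro!: borel_measurable_times character_measurable)

lemma That_eq: "That p \<theta> k f y = That p \<theta> k (\<lambda>_. 1) y * f y"
  by (simp add: That_def case_prod_beta)

lemma norm_That_weight: "norm (That p \<theta> k (\<lambda>_. 1) y) = 1"
  by (simp add: That_def case_prod_beta norm_mult)

lemma That_surj:
  assumes "h \<in> L2_fun H" shows "\<exists>f\<in>borel_measurable H. AE y in H. That p \<theta> k f y = h y"
proof (intro bexI always_eventually allI)
  have "(\<lambda>y. That p \<theta> (- k) (\<lambda>_. 1) y * h y) \<in> borel_measurable H"
    using That_weight_measurable L2_fun_measurable[OF assms] by (rule borel_measurable_times)
  then show "That p \<theta> (- k) h \<in> borel_measurable H" by (simp flip: That_eq)
  have "cis a * cis b * (cis (- a) * cis (- b) * z) = z" for a b z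
    by (simp add: cis_mult mult.assoc[symmetric])
  then show "That p \<theta> k (That p \<theta> (- k) h) y = h y" for y
    unfolding That_def real_vec_minus inner_minus_left mult_minus_right by (simp add: case_prod_beta)
qed

lemma That_respects: "L2_respects H H (That p \<theta> k)"
  by (rule weighted_composition(1)[where \<Phi> = "That p \<theta> k" and w = "That p \<theta> k (\<lambda>_. 1)" and \<Psi> = "\<lambda>y. y" and c = 1,
      OF _ That_weight_measurable norm_That_weight _ H_unit_density That_eq]) simp_all

lemma That_iso: "L2_iso H H (L2_lift H H (That p \<theta> k))"
  by (rule L2_iso_weighted_composition(1)[where \<Phi> = "That p \<theta> k" and w = "That p \<theta> k (\<lambda>_. 1)" and \<Psi> = "\<lambda>y. y" and c = 1,
      OF _ That_weight_measurable norm_That_weight _ H_unit_density That_eq That_surj]) simp_all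

abbreviation "sqrt_det \<equiv> sqrt \<bar>real_of_int (det A)\<bar>"

definition dilation :: "(real^'n) \<times> nat \<Rightarrow> (real^'n) \<times> nat" where
  "dilation = (\<lambda>(x, j). (AT A x, (j + p - 1) mod p))"

lemma sqrt_det_pos: "0 < sqrt_det" using det_nonzero by simp

lemma Uhat_eq: "Uhat A p h y = of_real sqrt_det * h (dilation y)"
  by (simp add: Uhat_def dilation_def case_prod_beta)

lemma dilation_measurable: "dilation \<in> H \<rightarrow>\<^sub>M H"
  unfolding hat_mu_def
proof (rule measurable_pair)
  show "fst \<circ> dilation \<in> lebesgue \<Otimes>\<^sub>M count_space {..<p} \<rightarrow>\<^sub>M lebesgue"
    using measurable_compose[OF measurable_fst AT_measurable] by (simp add: dilation_def case_prod_beta o_def)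
  have "(\<lambda>j. (j + p - 1) mod p) \<in> count_space {..<p} \<rightarrow>\<^sub>M count_space {..<p}" using p_pos by simp
  from measurable_compose[OF measurable_snd this]
  show "snd \<circ> dilation \<in> lebesgue \<Otimes>\<^sub>M count_space {..<p} \<rightarrow>\<^sub>M count_space {..<p}"
    by (simp add: dilation_def case_prod_beta o_def)
qed

text \<open>Each layer is stretched by \<open>A\<^sup>T\<close>, which multiplies volumes by \<open>\<bar>det A\<bar>\<close>, and the layers are permuted cyclically.\<close>

lemma H_dilation_density: "H = density (distr H H dilation) (\<lambda>_. ennreal (sqrt_det\<^sup>2))"
proof (rule measure_eqI)
  fix E assume E: "E \<in> sets H"
  define S where "S = (\<lambda>j. (\<lambda>x. (x, j)) -` E)"
  have S: "S j \<in> sets lebesgue" for j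
    unfolding S_def using E unfolding hat_mu_def by (rule sets_Pair2)
  note emeasure_H = emeasure_pair_count_space[OF sigma_finite_lebesgue countable_finite[OF finite_lessThan[of p]]]
  let ?\<Delta> = "ennreal \<bar>real_of_int (det A)\<bar>"
  have pre: "dilation -` E \<inter> space H \<in> sets (lebesgue \<Otimes>\<^sub>M count_space {..<p})"
    using measurable_sets[OF dilation_measurable E] by (simp add: hat_mu_def)
  have "emeasure (density (distr H H dilation) (\<lambda>_. ennreal (sqrt_det\<^sup>2))) E = ?\<Delta> * emeasure H (dilation -` E \<inter> space H)"
    using E dilation_measurable by (simp add: emeasure_density nn_integral_cmult_indicator emeasure_distr)
  also have "emeasure H (dilation -` E \<inter> space H)
      = (\<integral>\<^sup>+ j. emeasure lebesgue ((\<lambda>x. (x, j)) -` (dilation -` E \<inter> space H)) \<partial>count_space {..<p})"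
    using emeasure_H[OF pre] by (simp add: hat_mu_def del: emeasure_completion)
  also have "\<dots> = (\<integral>\<^sup>+ j. emeasure lebesgue (AT A -` S ((j + p - 1) mod p)) \<partial>count_space {..<p})"
  proof (rule nn_integral_cong)
    fix j assume "j \<in> space (count_space {..<p})"
    then have "(\<lambda>x. (x, j)) -` (dilation -` E \<inter> space H) = AT A -` S ((j + p - 1) mod p)"
      by (auto simp: space_H dilation_def S_def)
    then show "emeasure lebesgue ((\<lambda>x. (x, j)) -` (dilation -` E \<inter> space H))
        = emeasure lebesgue (AT A -` S ((j + p - 1) mod p))" by (simp only:)
  qed
  also have "?\<Delta> * \<dots> = (\<integral>\<^sup>+ j. ?\<Delta> * emeasure lebesgue (AT A -` S ((j + p - 1) mod p)) \<partial>count_space {..<p})"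
    by (rule nn_integral_cmult[symmetric]) simp
  also have "\<dots> = (\<integral>\<^sup>+ j. emeasure lebesgue (S ((j + p - 1) mod p)) \<partial>count_space {..<p})"
    by (simp only: emeasure_AT_vimage[OF S])
  also have "\<dots> = (\<integral>\<^sup>+ j. emeasure lebesgue (S j) \<partial>count_space {..<p})"
    by (rule nn_integral_bij_count_space[OF bij_betw_pred_mod(1)[OF p_pos]])
  also have "\<dots> = emeasure H E"
    unfolding S_def using emeasure_H[of E] E by (simp add: hat_mu_def del: emeasure_completion)
  finally show "emeasure H E = emeasure (density (distr H H dilation) (\<lambda>_. ennreal (sqrt_det\<^sup>2))) E" by simp
qed simp

lemma Uhat_surj:
  assumes h: "h \<in> L2_fun H" shows "\<exists>f\<in>borel_measurable H. AE y in H. Uhat A p f y = h y"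
proof -
  define f where "f = (\<lambda>(x, j). of_real (inverse sqrt_det) * h (AT_inv A x, Suc j mod p))"
  have "f \<in> borel_measurable H"
    unfolding H_measurable_iff
  proof (intro allI impI)
    fix j
    have "(\<lambda>x. h (x, Suc j mod p)) \<in> borel_measurable lebesgue"
      using L2_fun_measurable[OF h] p_pos unfolding H_measurable_iff by simp
    from measurable_compose[OF AT_inv_measurable this]
    show "(\<lambda>x. f (x, j)) \<in> borel_measurable lebesgue" by (simp add: f_def)
  qed
  moreover have "AE y in H. Uhat A p f y = h y"
    using AE_space
  proof eventually_elim
    fix y assume "y \<in> space H"
    then obtain x j where y: "y = (x, j)" "j < p" by (auto simp: space_H)
    have "of_real sqrt_det * (of_real (inverse sqrt_det) * z) = (z :: complex)" for z
      using sqrt_det_pos by (simp flip: of_real_mult mult.assoc)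
    then show "Uhat A p f y = h y"
      unfolding Uhat_eq by (simp only: y dilation_def f_def prod.case AT_inv_AT bij_betw_pred_mod(2)[OF p_pos y(2)])
  qed
  ultimately show ?thesis by blast
qed

lemma Uhat_respects: "L2_respects H H (Uhat A p)"
  by (rule weighted_composition(1)[where \<Phi> = "Uhat A p" and w = "\<lambda>_. of_real sqrt_det" and \<Psi> = dilation and c = sqrt_det,
      OF dilation_measurable _ _ sqrt_det_pos H_dilation_density Uhat_eq]) simp_all

lemma Uhat_iso: "L2_iso H H (L2_lift H H (Uhat A p))"
  by (rule L2_iso_weighted_composition(1)[where \<Phi> = "Uhat A p" and w = "\<lambda>_. of_real sqrt_det" and \<Psi> = dilation and c = sqrt_det,
      OF dilation_measurable _ _ sqrt_det_pos H_dilation_density Uhat_eq Uhat_surj]) simp_all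

lemma That_add: "That p \<theta> (k + l) f y = That p \<theta> k (That p \<theta> l f) y"
  unfolding That_def case_prod_beta real_vec_add inner_add_left distrib_left cis_mult[symmetric]
  by (simp add: mult_ac)

lemma Uhat_That:
  assumes "y \<in> space H"
  shows "Uhat A p (That p \<theta> k f) y = That p \<theta> (A *v k) (Uhat A p f) y"
proof -
  obtain x j where y: "y = (x, j)" "j < p" using assms by (auto simp: space_H)
  define i where "i = (j + p - 1) mod p"
  have i: "i < p" "Suc i mod p = j"
    using p_pos bij_betw_pred_mod(2)[OF p_pos y(2)] by (simp_all add: i_def)
  obtain l where "AT A (\<theta> j) - \<theta> i = real_vec l" using AT_cycle[of i] i by auto
  then have "AT A (\<theta> j) = \<theta> i + real_vec l" by (simp add: algebra_simps)
  then have "cis (2 * pi * (real_vec (A *v k) \<bullet> \<theta> j)) = cis (2 * pi * (real_vec k \<bullet> \<theta> i))"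
    unfolding inner_real_vec_AT by (simp only: inner_add_right distrib_left cis_mult[symmetric] cis_2pi_int mult_1_right)
  then show ?thesis
    unfolding y Uhat_def That_def prod.case i_def[symmetric] inner_real_vec_AT by simp
qed

section \<open>The operators on \<open>L\<^sup>2(X \<times> \<Omega>)\<close>\<close>

lemma B_measurable_iff: "f \<in> borel_measurable B \<longleftrightarrow> (\<forall>\<omega>\<in>\<Omega>. (\<lambda>x. f (x, \<omega>)) \<in> borel_measurable (lebesgue_on X))"
  unfolding breve_mu_def by (rule borel_measurable_pair_count_space_iff[OF countable_Omega_tilde])

lemma AE_B_iff: "(AE y in B. P y) \<longleftrightarrow> (\<forall>\<omega>\<in>\<Omega>. AE x in lebesgue_on X. P (x, \<omega>))"
  unfolding breve_mu_def by (rule AE_pair_count_space_iff[OF countable_Omega_tilde])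

lemma AE_X_iff: "(AE x in lebesgue_on X. P x) \<longleftrightarrow> (AE x in lebesgue. x \<in> X \<longrightarrow> P x)"
  using X_sets by (simp add: AE_restrict_space_iff)

lemma Tbreve_respects: "L2_respects B B (Tbreve k)"
proof (rule weighted_composition(1)[where w = "\<lambda>y. cis (2 * pi * (real_vec k \<bullet> fst y))" and \<Psi> = "\<lambda>y. y" and c = 1])
  show "(\<lambda>y. cis (2 * pi * (real_vec k \<bullet> fst y))) \<in> borel_measurable B"
    unfolding B_measurable_iff using measurable_restrict_space1[OF character_measurable, of k X] by auto
  show "B = density (distr B B (\<lambda>y. y)) (\<lambda>_. ennreal (1\<^sup>2))" by (simp add: density_1 distr_id)
qed (simp_all add: Tbreve_def case_prod_beta)

lemma Tbreve_add: "Tbreve (k + l) f y = Tbreve k (Tbreve l f) y"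
  unfolding Tbreve_def case_prod_beta real_vec_add inner_add_left distrib_left cis_mult[symmetric]
  by (simp add: mult_ac)

lemma Ubreve_Tbreve: "Ubreve A D (Tbreve k f) y = Tbreve (A *v k) (Ubreve A D f) y"
proof -
  obtain x \<omega> where y: "y = (x, \<omega>)" by fastforce
  define a where "a = first_digit A D x"
  have "cis (2 * pi * (real_vec k \<bullet> (AT A x - real_vec a))) = cis (2 * pi * (real_vec k \<bullet> AT A x))"
    unfolding inner_diff_right right_diff_distrib cis_divide[symmetric] cis_2pi_int by simp
  then show ?thesis
    by (simp add: y Ubreve_def Tbreve_def rho_inv_def inner_real_vec_AT a_def[symmetric] del: inner_diff_right)
qed

lemma W_That:
  assumes "y \<in> space B"
  shows "W A p \<theta> (That p \<theta> k f) y = Tbreve k (W A p \<theta> f) y"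
proof -
  obtain x \<omega> where y: "y = (x, \<omega>)" "\<omega> \<in> \<Omega>" using assms by (auto simp: space_B)
  obtain l j where c: "cell \<omega> = (l, j)" by fastforce
  have "real_vec k \<bullet> x = real_vec k \<bullet> \<theta> j + real_vec k \<bullet> (offset \<omega> + x) + real_vec k \<bullet> real_vec l"
    by (simp add: offset_def c inner_add_right inner_diff_right)
  then have "cis (2 * pi * (real_vec k \<bullet> x)) =
      cis (2 * pi * (real_vec k \<bullet> \<theta> j)) * cis (2 * pi * (real_vec k \<bullet> (offset \<omega> + x)))"
    by (simp only: distrib_left cis_mult[symmetric] cis_2pi_int mult_1_right)
  then show ?thesis by (simp add: y(1) W_eq[OF y(2)] unfold_def c That_def Tbreve_def)
qed

text \<open>Two digits \<open>l\<close> with \<open>A\<^sup>T x - l\<close> in the tile would give two translates of the tile containing \<open>A\<^sup>T x\<close>,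
which is excluded for almost every \<open>x\<close>.\<close>

lemma AE_first_digit:
  "AE x in lebesgue_on X. first_digit A D x \<in> D \<and> AT A x - real_vec (first_digit A D x) \<in> X"
proof -
  have tau: "x \<in> tau A l ` X \<longleftrightarrow> AT A x - real_vec l \<in> X" for x l
  proof
    assume "AT A x - real_vec l \<in> X"
    moreover have "x = tau A l (AT A x - real_vec l)" by (simp add: tau_def)
    ultimately show "x \<in> tau A l ` X" by blast
  qed (auto simp: tau_def)
  have "AE x in lebesgue. \<exists>!k. AT A x + real_vec k \<in> X"
    by (rule AE_lebesgue_AT[OF AE_unique_translate])
  then have "AE x in lebesgue. x \<in> X \<longrightarrow> first_digit A D x \<in> D \<and> AT A x - real_vec (first_digit A D x) \<in> X"
  proof eventually_elim
    fix x assume u: "\<exists>!k. AT A x + real_vec k \<in> X"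
    have "first_digit A D x \<in> D \<and> AT A x - real_vec (first_digit A D x) \<in> X" if x: "x \<in> X"
    proof -
    obtain l where l: "l \<in> D" "AT A x - real_vec l \<in> X" using tile_subset_tau x tau by blast
    have m: "AT A x - real_vec l' \<in> X \<longleftrightarrow> AT A x + real_vec (- l') \<in> X" for l'
      unfolding real_vec_minus by simp
    have "first_digit A D x = l"
      unfolding first_digit_def tau
    proof (rule the_equality)
      fix l' assume "l' \<in> D \<and> AT A x - real_vec l' \<in> X"
      with l u have "- l' = - l" unfolding m by blast
      then show "l' = l" by simp
    qed (use l in blast)
    then show ?thesis using l by simp
    qed
    then show "x \<in> X \<longrightarrow> first_digit A D x \<in> D \<and> AT A x - real_vec (first_digit A D x) \<in> X" ..
  qed
  then show ?thesis unfolding AE_X_iff .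
qed

text \<open>Prepending the first digit of \<open>x\<close> to \<open>\<omega>\<close> changes the unfolded point by one application of the
dilation on \<open>\<real>\<^sup>d \<times> \<int>\<^sub>p\<close>.\<close>

lemma Ubreve_W:
  assumes \<omega>: "\<omega> \<in> \<Omega>" and a: "first_digit A D x \<in> D"
  shows "Ubreve A D (W A p \<theta> h) (x, \<omega>) = W A p \<theta> (Uhat A p h) (x, \<omega>)"
proof -
  define a where "a = first_digit A D x"
  have cons: "case_nat a \<omega> \<in> \<Omega>" using Omega_tilde_cons[OF \<omega>] assms(2) by (simp add: a_def)
  obtain k j where c: "cell \<omega> = (k, j)" by fastforce
  define j' where "j' = (j + p - 1) mod p"
  obtain k' where k': "code (case_nat a \<omega>) k' j'"
      "\<And>x. (AT A x - real_vec a) - \<theta> j' - real_vec k' = AT A (x - \<theta> j - real_vec k)"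
    using code_cons[of \<omega> k j a] cell_code[OF \<omega>] c unfolding j'_def by auto
  have "unfold (AT A x - real_vec a, case_nat a \<omega>) = ((AT A x - real_vec a) - \<theta> j' - real_vec k', j')"
    by (simp add: unfold_def offset_def cell_eqI[OF cons k'(1)])
  also have "\<dots> = dilation (unfold (x, \<omega>))"
    unfolding k'(2) by (simp add: unfold_def offset_def c dilation_def j'_def algebra_simps)
  finally have "unfold (AT A x - real_vec a, case_nat a \<omega>) = dilation (unfold (x, \<omega>))" .
  then show ?thesis
    by (simp add: Ubreve_def rho_inv_def a_def[symmetric] W_eq[OF \<omega>] W_eq[OF cons] Uhat_eq)
qed

lemma AE_Ubreve_W: "AE y in B. Ubreve A D (W A p \<theta> h) y = W A p \<theta> (Uhat A p h) y"
  unfolding AE_B_iff using AE_first_digit Ubreve_W by (auto elim: eventually_mono)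

text \<open>Up to the null set where the first digit is not unique, \<open>\<rho>\<^sup>-\<^sup>1\<close> is one of finitely many maps
\<open>x \<mapsto> A\<^sup>T x - a\<close>, and each of them pulls null sets back to null sets.\<close>

lemma Ubreve_AE:
  assumes "AE y in B. f y = g y"
  shows "AE y in B. Ubreve A D f y = Ubreve A D g y"
  unfolding AE_B_iff
proof
  fix \<omega> assume \<omega>: "\<omega> \<in> \<Omega>"
  have "AE x in lebesgue. AT A x - real_vec a \<in> X \<longrightarrow>
      f (AT A x - real_vec a, case_nat a \<omega>) = g (AT A x - real_vec a, case_nat a \<omega>)" if "a \<in> D" for a
  proof -
    have "AE z in lebesgue. z \<in> X \<longrightarrow> f (z, case_nat a \<omega>) = g (z, case_nat a \<omega>)"
      using assms Omega_tilde_cons[OF \<omega> that] unfolding AE_B_iff AE_X_iff by blast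
    from AE_lebesgue_AT[OF AE_lebesgue_translation[OF this, of "- real_vec a"]]
    show ?thesis by simp
  qed
  then have "AE x in lebesgue. \<forall>a\<in>D. AT A x - real_vec a \<in> X \<longrightarrow>
      f (AT A x - real_vec a, case_nat a \<omega>) = g (AT A x - real_vec a, case_nat a \<omega>)"
    by (rule AE_finite_allI[OF finite_D])
  with AE_first_digit[unfolded AE_X_iff]
  have "AE x in lebesgue. x \<in> X \<longrightarrow> Ubreve A D f (x, \<omega>) = Ubreve A D g (x, \<omega>)"
    by eventually_elim (simp add: Ubreve_def rho_inv_def)
  then show "AE x in lebesgue_on X. Ubreve A D f (x, \<omega>) = Ubreve A D g (x, \<omega>)"
    unfolding AE_X_iff .
qed

text \<open>Every \<open>f\<close> is almost everywhere \<open>\<W> h\<close>, so its image is almost everywhere \<open>\<W>\<close> applied to the dilate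
of \<open>h\<close>. This also gives measurability, since \<open>f \<circ> \<rho>\<^sup>-\<^sup>1\<close> is arbitrary on the exceptional null set.\<close>

lemma Ubreve_respects: "L2_respects B B (Ubreve A D)"
  unfolding L2_respects_def
proof (intro conjI ballI impI Ubreve_AE)
  fix f assume f: "f \<in> L2_fun B"
  obtain h where h: "h \<in> L2_fun H" "AE y in B. W A p \<theta> h y = f y" using W_L2_surj[OF f] by blast
  have in_L2: "W A p \<theta> (Uhat A p h) \<in> L2_fun B"
    by (intro L2_respects_fun[OF W_respects] L2_respects_fun[OF Uhat_respects] h(1))
  have ae: "AE y in B. W A p \<theta> (Uhat A p h) y = Ubreve A D f y"
    using AE_Ubreve_W[of h] Ubreve_AE[OF h(2)] by eventually_elim simp
  have "Ubreve A D f \<in> borel_measurable B"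
    unfolding B_measurable_iff
  proof
    fix \<omega> assume \<omega>: "\<omega> \<in> \<Omega>"
    have "(\<lambda>x. W A p \<theta> (Uhat A p h) (x, \<omega>)) \<in> borel_measurable (lebesgue_on X)"
      using L2_fun_measurable[OF in_L2] \<omega> unfolding B_measurable_iff by (rule bspec)
    moreover have "AE x in lebesgue_on X. W A p \<theta> (Uhat A p h) (x, \<omega>) = Ubreve A D f (x, \<omega>)"
      using ae \<omega> unfolding AE_B_iff by (rule bspec)
    ultimately show "(\<lambda>x. Ubreve A D f (x, \<omega>)) \<in> borel_measurable (lebesgue_on X)"
      by (rule borel_measurable_lebesgue_on_AE[OF X_sets])
  qed
  with in_L2 show "Ubreve A D f \<in> L2_fun B" using ae by (rule L2_fun_cong_AE)
qed

section \<open>The unitary equivalence\<close>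

lemma W_intertwines_T:
  assumes F: "F \<in> L2 H"
  shows "L2_lift H B (W A p \<theta>) (L2_lift H H (That p \<theta> k) F) = L2_lift B B (Tbreve k) (L2_lift H B (W A p \<theta>) F)"
proof -
  obtain f where f: "f \<in> L2_fun H" "F = L2_class H f" using F by (rule L2_cases)
  have "AE y in B. W A p \<theta> (That p \<theta> k f) y = Tbreve k (W A p \<theta> f) y"
    using AE_space by eventually_elim (rule W_That)
  then show ?thesis
    unfolding f(2) by (intro L2_lift_commuteI[OF That_respects W_respects W_respects Tbreve_respects f(1)])
qed

lemma W_intertwines_U:
  assumes F: "F \<in> L2 H"
  shows "L2_lift H B (W A p \<theta>) (L2_lift H H (Uhat A p) F) = L2_lift B B (Ubreve A D) (L2_lift H B (W A p \<theta>) F)"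
proof -
  obtain f where f: "f \<in> L2_fun H" "F = L2_class H f" using F by (rule L2_cases)
  have "AE y in B. W A p \<theta> (Uhat A p f) y = Ubreve A D (W A p \<theta> f) y"
    using AE_Ubreve_W[of f] by eventually_elim simp
  then show ?thesis
    unfolding f(2) by (intro L2_lift_commuteI[OF Uhat_respects W_respects W_respects Ubreve_respects f(1)])
qed

lemma Tbreve_iso: "L2_iso B B (L2_lift B B (Tbreve k))"
  by (rule L2_iso_conjugate[where T' = "L2_lift B B (Tbreve k)", OF W_iso That_iso W_intertwines_T])

lemma Ubreve_iso: "L2_iso B B (L2_lift B B (Ubreve A D))"
  by (rule L2_iso_conjugate[where T' = "L2_lift B B (Ubreve A D)", OF W_iso Uhat_iso W_intertwines_U])

lemma rep_on_H: "\<exists>!\<pi>. rep_generated_by A H (L2_lift H H (Uhat A p)) (\<lambda>k. L2_lift H H (That p \<theta> k)) \<pi>"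
proof (rule rep_generated_by_exists_unique[OF expansive_invertible[OF expansive]
    Uhat_iso L2_lift_extensional That_iso L2_lift_extensional])
  fix k l F assume "F \<in> L2 H"
  then obtain f where f: "f \<in> L2_fun H" "F = L2_class H f" by (rule L2_cases)
  show "L2_lift H H (That p \<theta> (k + l)) F = L2_lift H H (That p \<theta> k) (L2_lift H H (That p \<theta> l) F)"
    unfolding f(2) L2_lift_lift_class[OF That_respects That_respects f(1)] L2_lift_class[OF That_respects f(1), of "k + l"]
    by (rule arg_cong[of _ _ "L2_class H"]) (rule ext, rule That_add)
next
  fix k F assume "F \<in> L2 H"
  then obtain f where f: "f \<in> L2_fun H" "F = L2_class H f" by (rule L2_cases)
  have "AE y in H. Uhat A p (That p \<theta> k f) y = That p \<theta> (A *v k) (Uhat A p f) y"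
    using AE_space by eventually_elim (rule Uhat_That)
  then show "L2_lift H H (Uhat A p) (L2_lift H H (That p \<theta> k) F)
      = L2_lift H H (That p \<theta> (A *v k)) (L2_lift H H (Uhat A p) F)"
    unfolding f(2) by (intro L2_lift_commuteI[OF That_respects Uhat_respects Uhat_respects That_respects f(1)])
qed

lemma rep_on_B: "\<exists>!\<pi>. rep_generated_by A B (L2_lift B B (Ubreve A D)) (\<lambda>k. L2_lift B B (Tbreve k)) \<pi>"
proof (rule rep_generated_by_exists_unique[OF expansive_invertible[OF expansive]
    Ubreve_iso L2_lift_extensional Tbreve_iso L2_lift_extensional])
  fix k l F assume "F \<in> L2 B"
  then obtain f where f: "f \<in> L2_fun B" "F = L2_class B f" by (rule L2_cases)
  show "L2_lift B B (Tbreve (k + l)) F = L2_lift B B (Tbreve k) (L2_lift B B (Tbreve l) F)"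
    unfolding f(2) L2_lift_lift_class[OF Tbreve_respects Tbreve_respects f(1)] L2_lift_class[OF Tbreve_respects f(1), of "k + l"]
    by (rule arg_cong[of _ _ "L2_class B"]) (rule ext, rule Tbreve_add)
next
  fix k F assume "F \<in> L2 B"
  then obtain f where f: "f \<in> L2_fun B" "F = L2_class B f" by (rule L2_cases)
  show "L2_lift B B (Ubreve A D) (L2_lift B B (Tbreve k) F)
      = L2_lift B B (Tbreve (A *v k)) (L2_lift B B (Ubreve A D) F)"
    unfolding f(2) by (intro L2_lift_commuteI[OF Tbreve_respects Ubreve_respects Ubreve_respects Tbreve_respects f(1)])
      (simp add: Ubreve_Tbreve)
qed

end

theorem corollary6p18:
  fixes A :: "int^'n^'n" and D :: "(int^'n) set" and p :: nat and \<theta> :: "nat \<Rightarrow> real^'n"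
  assumes "expansive A"
    and "complete_representatives A D"
    and "tiling_condition A D"
    and "simple_cycle A D p \<theta>"
  defines "H \<equiv> hat_mu p :: ((real^'n) \<times> nat) measure"
    and "B \<equiv> breve_mu A D p \<theta>"
  defines "Th \<equiv> \<lambda>k. L2_lift H H (That p \<theta> k)"
    and "Uh \<equiv> L2_lift H H (Uhat A p)"
    and "Tb \<equiv> \<lambda>k. L2_lift B B (Tbreve k)"
    and "Ub \<equiv> L2_lift B B (Ubreve A D)"
    and "\<W> \<equiv> L2_lift H B (W A p \<theta>)"
  shows
    "(\<forall>k. L2_respects H H (That p \<theta> k)) \<and> L2_respects H H (Uhat A p) \<and>
     (\<forall>k. L2_respects B B (Tbreve k)) \<and> L2_respects B B (Ubreve A D) \<and>
     L2_respects H B (W A p \<theta>) \<and>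
     (\<exists>!\<pi>. rep_generated_by A H Uh Th \<pi>) \<and>
     (\<exists>!\<pi>. rep_generated_by A B Ub Tb \<pi>) \<and>
     L2_iso H B \<W> \<and>
     (\<forall>k. \<forall>F \<in> L2 H. \<W> (Th k F) = Tb k (\<W> F)) \<and>
     (\<forall>F \<in> L2 H. \<W> (Uh F) = Ub (\<W> F))"
proof -
  interpret system: tiling_cycle_system A D p \<theta>
    by unfold_locales (rule assms)+
  show ?thesis
    unfolding H_def B_def Th_def Uh_def Tb_def Ub_def \<W>_def
    by (intro conjI allI ballI system.That_respects system.Uhat_respects system.Tbreve_respects
        system.Ubreve_respects system.W_respects system.rep_on_H system.rep_on_B system.W_iso
        system.W_intertwines_T system.W_intertwines_U)
qed

end
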